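(* Let $q,w\in L^1[-1,1]$ be real-valued with $w(x)\ne0$ for a.e. $x\in[-1,1]$, $q(x)=q(-x)$ and $w(-x)=-w(x)$ for a.e. $x$. Suppose the Dirichlet problem $-y''+q(x)y=\lambda y$, $y(-1)=y(1)=0$, has exactly one negative eigenvalue and all its other eigenvalues are positive. Then the problem $-y''+qy=\lambda wy$, $y(-1)=y(1)=0$, has exactly two non-real eigenvalues, and they are purely imaginary (of the form $\pm i\alpha$ with $\alpha>0$).
   Context: A number $\lambda\in\mathbb{C}$ is an eigenvalue of $-y''+qy=\lambda wy$, $y(-1)=y(1)=0$, if there is a nontrivial function $y$ with $y,y'$ absolutely continuous on $[-1,1]$ satisfying $-y''+qy=\lambda wy$ a.e. on $[-1,1]$ and $y(-1)=y(1)=0$ (similarly with $w\equiv1$). *)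

theory Defs
  imports "HOL-Analysis.Analysis"
begin

definition abs_cont_on :: "real \<Rightarrow> real \<Rightarrow> (real \<Rightarrow> 'b::real_normed_vector) \<Rightarrow> bool" where
  "abs_cont_on a b f \<longleftrightarrow>
     (\<forall>\<epsilon>>0. \<exists>\<delta>>0. \<forall>(n::nat) (I::nat \<Rightarrow> real \<times> real).
        (\<forall>k<n. a \<le> fst (I k) \<and> fst (I k) \<le> snd (I k) \<and> snd (I k) \<le> b) \<and>
        (\<forall>j<n. \<forall>k<n. j \<noteq> k \<longrightarrow>
            {fst (I j)<..<snd (I j)} \<inter> {fst (I k)<..<snd (I k)} = {}) \<and>
        (\<Sum>k<n. snd (I k) - fst (I k)) < \<delta>
        \<longrightarrow> (\<Sum>k<n. norm (f (snd (I k)) - f (fst (I k)))) < \<epsilon>)"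

definition is_eigenvalue :: "(real \<Rightarrow> real) \<Rightarrow> (real \<Rightarrow> real) \<Rightarrow> complex \<Rightarrow> bool" where
  "is_eigenvalue q w lam \<longleftrightarrow>
     (\<exists>y y1 y2 :: real \<Rightarrow> complex.
        (\<exists>x\<in>{-1..1}. y x \<noteq> 0) \<and>
        abs_cont_on (-1) 1 y \<and> abs_cont_on (-1) 1 y1 \<and>
        (\<forall>x\<in>{-1..1}. (y has_vector_derivative y1 x) (at x within {-1..1})) \<and>
        (AE x in lborel. x \<in> {-1..1} \<longrightarrow>
            (y1 has_vector_derivative y2 x) (at x within {-1..1}) \<and>
            - y2 x + complex_of_real (q x) * y x = lam * complex_of_real (w x) * y x) \<and>
        y (-1) = 0 \<and> y 1 = 0)"

end

theory Submission
  imports Defs "HOL-Complex_Analysis.Great_Picard"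
begin

text \<open>
  The form \<open>\<integral> |y'|\<^sup>2 + q |y|\<^sup>2\<close> vanishes on the span of two eigenfunctions whose eigenvalues \<open>l\<close>, \<open>m\<close>
  are non-real with \<open>l \<noteq> cnj m\<close>. The spectral hypothesis and the evenness of \<open>q\<close> make the odd
  solution of \<open>-y'' + q y = 0\<close> positive on \<open>(0, 1]\<close>; by Jacobi's identity the form is then
  positive definite on functions that vanish at \<open>-1\<close>, \<open>0\<close> and \<open>1\<close>. A two-dimensional neutral space
  would contain such a function, so there is at most one conjugate pair.

  For existence, let \<open>\<phi>\<close>, \<open>\<psi>\<close> be the solutions for \<open>\<i> a\<close> with data \<open>(1, 0)\<close> and \<open>(0, 1)\<close> at \<open>0\<close>. A
  solution on \<open>[0, 1]\<close> that continues by \<open>y (-x) = cnj (y x)\<close> is a combination \<open>A \<phi> + \<i> B \<psi>\<close> with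
  real \<open>A\<close>, \<open>B\<close>, and one of these vanishes at \<open>1\<close> exactly when \<open>Re (\<phi> 1 * cnj (\<psi> 1)) = 0\<close>. This
  real part is negative at \<open>a = 0\<close>, by the spectral hypothesis. It cannot stay negative for all \<open>a\<close>:
  it is the energy of the solution vanishing at \<open>1\<close>, negative energy bounds that solution in
  \<open>H\<^sup>1\<close>, and a uniform limit as \<open>a\<close> tends to infinity is annihilated by \<open>w\<close>.
\<close>

section \<open>Absolutely continuous functions\<close>

text \<open>Everything reduces to \<open>[0, 1]\<close>. Since \<open>q\<close> is even and
  \<open>w\<close> is odd, conjugating the equation for \<open>\<i> a\<close> has the same effect as
  reflecting it. Hence \<open>cnj (y x)\<close> continues a solution to the left, provided that
  \<open>y 0\<close> is real and \<open>y1 0\<close> is imaginary. The coefficients are merely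
  integrable, so solutions satisfy their equation only almost everywhere. The energy identities
  therefore rest on the fundamental theorem of calculus for absolutely continuous functions, and
  uniqueness and continuity in the parameter rest on Gronwall's inequality. Evenness splits the
  Dirichlet problem into two problems on the half interval, and the negative eigenvalue belongs to
  the even one; this is why the form is definite once functions vanish at 0. That condition costs
  one complex dimension, which a two-dimensional neutral space can spare. The sign at
  \<open>a = 0\<close> has the same origin: there \<open>\<phi> 1 < 0 < \<psi> 1\<close>. On the
  imaginary axis the real part of the potential is \<open>q\<close>, so the weight disappears from
  the energy and the bounds do not depend on \<open>a\<close>.\<close>

lemma AE_lborel_iff_negligible:
  "(AE x in lborel. P x) \<longleftrightarrow> (\<exists>N. negligible N \<and> (\<forall>x. x \<notin> N \<longrightarrow> P x))"
proof -
  have "(AE x in lborel. P x) \<longleftrightarrow> (AE x in lebesgue. P x)"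
    by (simp add: AE_completion_iff)
  also have "\<dots> \<longleftrightarrow> (\<exists>N. negligible N \<and> (\<forall>x. x \<notin> N \<longrightarrow> P x))"
    unfolding eventually_ae_filter_negligible by blast
  finally show ?thesis .
qed

definition nonoverlapping :: "real \<Rightarrow> real \<Rightarrow> nat \<Rightarrow> (nat \<Rightarrow> real \<times> real) \<Rightarrow> bool" where
  "nonoverlapping a b n I \<longleftrightarrow>
    (\<forall>k<n. a \<le> fst (I k) \<and> fst (I k) \<le> snd (I k) \<and> snd (I k) \<le> b) \<and>
    (\<forall>j<n. \<forall>k<n. j \<noteq> k \<longrightarrow>
      {fst (I j)<..<snd (I j)} \<inter> {fst (I k)<..<snd (I k)} = {})"

lemma abs_cont_on_iff:
  "abs_cont_on a b f \<longleftrightarrow>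
    (\<forall>\<epsilon>>0. \<exists>\<delta>>0. \<forall>n I. nonoverlapping a b n I \<and> (\<Sum>k<n. snd (I k) - fst (I k)) < \<delta>
      \<longrightarrow> (\<Sum>k<n. norm (f (snd (I k)) - f (fst (I k)))) < \<epsilon>)"
  by (simp add: abs_cont_on_def nonoverlapping_def conj_assoc)

text \<open>The index set is freed from initial segments of the naturals, because the intervals of a
  tagged division are indexed by pairs of a point and a set.\<close>

lemma abs_cont_onD:
  assumes "abs_cont_on a b f" "\<epsilon> > 0"
  shows "\<exists>\<delta>>0. \<forall>J u v. finite (J::'i set) \<and> (\<forall>i\<in>J. a \<le> u i \<and> u i \<le> v i \<and> v i \<le> b) \<and>
      (\<forall>i\<in>J. \<forall>j\<in>J. i \<noteq> j \<longrightarrow> {u i<..<v i} \<inter> {u j<..<v j} = {}) \<and>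
      (\<Sum>i\<in>J. v i - u i) < \<delta> \<longrightarrow> (\<Sum>i\<in>J. norm (f (v i) - f (u i))) < \<epsilon>"
proof -
  obtain \<delta> where d0: "\<delta> > 0" and d: "\<And>n I. nonoverlapping a b n I \<and>
        (\<Sum>k<n. snd (I k) - fst (I k)) < \<delta>
        \<Longrightarrow> (\<Sum>k<n. norm (f (snd (I k)) - f (fst (I k)))) < \<epsilon>"
    using assms unfolding abs_cont_on_iff by blast
  show ?thesis
  proof (intro exI[of _ \<delta>] conjI allI impI d0, elim conjE)
    fix J :: "'i set" and u v :: "'i \<Rightarrow> real"
    assume J: "finite J" and uv: "\<forall>i\<in>J. a \<le> u i \<and> u i \<le> v i \<and> v i \<le> b"
      and dj: "\<forall>i\<in>J. \<forall>j\<in>J. i \<noteq> j \<longrightarrow> {u i<..<v i} \<inter> {u j<..<v j} = {}"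
      and small: "(\<Sum>i\<in>J. v i - u i) < \<delta>"
    obtain h where h: "bij_betw h {..<card J} J"
      using ex_bij_betw_nat_finite[OF J] by (auto simp: atLeast0LessThan)
    have hJ: "h k \<in> J" if "k < card J" for k
      using h that by (auto simp: bij_betw_def)
    have hi: "h j \<noteq> h k" if "j < card J" "k < card J" "j \<noteq> k" for j k
      using h that by (auto simp: bij_betw_def inj_on_def)
    let ?I = "\<lambda>k. (u (h k), v (h k))"
    have "(\<Sum>k<card J. norm (f (snd (?I k)) - f (fst (?I k)))) < \<epsilon>"
    proof (rule d, rule conjI)
      show "(\<Sum>k<card J. snd (?I k) - fst (?I k)) < \<delta>"
        using small sum.reindex_bij_betw[OF h, of "\<lambda>i. v i - u i"] by simp
      show "nonoverlapping a b (card J) ?I"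
        using uv dj hJ hi unfolding nonoverlapping_def by simp
    qed
    then show "(\<Sum>i\<in>J. norm (f (v i) - f (u i))) < \<epsilon>"
      using sum.reindex_bij_betw[OF h, of "\<lambda>i. norm (f (v i) - f (u i))"] by simp
  qed
qed

text \<open>Sums, products, linear images and Lipschitz compositions all reduce to such a bound on
  increments, so their epsilon-delta argument is carried out only here.\<close>

lemma abs_cont_on_comparison:
  fixes f :: "real \<Rightarrow> 'a::real_normed_vector" and g :: "real \<Rightarrow> 'b::real_normed_vector"
    and h :: "real \<Rightarrow> 'c::real_normed_vector"
  assumes f: "abs_cont_on a b f" and g: "abs_cont_on a b g"
    and h: "\<And>u v. a \<le> u \<Longrightarrow> u \<le> v \<Longrightarrow> v \<le> b \<Longrightarrow>
      norm (h v - h u) \<le> M * (norm (f v - f u) + norm (g v - g u))"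
  shows "abs_cont_on a b h"
  unfolding abs_cont_on_iff
proof (intro allI impI)
  fix \<epsilon> :: real assume e: "\<epsilon> > 0"
  \<comment> \<open>\<open>M\<close> may be zero or negative; a positive majorant is needed as a
    divisor.\<close>
  define M' where "M' = \<bar>M\<bar> + 1"
  have M': "M' > 0" "M \<le> M'" by (auto simp: M'_def)
  let ?e = "\<epsilon> / (2 * M')"
  have e': "?e > 0" using e M' by simp
  obtain d1 where d1: "d1 > 0" "\<And>(n::nat) (I::nat \<Rightarrow> real \<times> real).
        nonoverlapping a b n I \<and>
        (\<Sum>k<n. snd (I k) - fst (I k)) < d1
        \<Longrightarrow> (\<Sum>k<n. norm (f (snd (I k)) - f (fst (I k)))) < ?e"
    using f e' unfolding abs_cont_on_iff by blast
  obtain d2 where d2: "d2 > 0" "\<And>(n::nat) (I::nat \<Rightarrow> real \<times> real).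
        nonoverlapping a b n I \<and>
        (\<Sum>k<n. snd (I k) - fst (I k)) < d2
        \<Longrightarrow> (\<Sum>k<n. norm (g (snd (I k)) - g (fst (I k)))) < ?e"
    using g e' unfolding abs_cont_on_iff by blast
  show "\<exists>\<delta>>0. \<forall>(n::nat) (I::nat \<Rightarrow> real \<times> real).
        nonoverlapping a b n I \<and>
        (\<Sum>k<n. snd (I k) - fst (I k)) < \<delta>
        \<longrightarrow> (\<Sum>k<n. norm (h (snd (I k)) - h (fst (I k)))) < \<epsilon>"
  proof (intro exI[of _ "min d1 d2"] conjI allI impI)
    show "min d1 d2 > 0" using d1 d2 by simp
    fix n :: nat and I :: "nat \<Rightarrow> real \<times> real"
    assume A: "nonoverlapping a b n I \<and>
        (\<Sum>k<n. snd (I k) - fst (I k)) < min d1 d2"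
    have 1: "(\<Sum>k<n. norm (f (snd (I k)) - f (fst (I k)))) < ?e"
      by (rule d1(2)) (use A in auto)
    have 2: "(\<Sum>k<n. norm (g (snd (I k)) - g (fst (I k)))) < ?e"
      by (rule d2(2)) (use A in auto)
    have "(\<Sum>k<n. norm (h (snd (I k)) - h (fst (I k))))
        \<le> (\<Sum>k<n. M' * (norm (f (snd (I k)) - f (fst (I k))) + norm (g (snd (I k)) - g (fst (I k)))))"
    proof (rule sum_mono)
      fix k assume "k \<in> {..<n}"
      then have "norm (h (snd (I k)) - h (fst (I k)))
        \<le> M * (norm (f (snd (I k)) - f (fst (I k))) + norm (g (snd (I k)) - g (fst (I k))))"
        using A by (intro h) (auto simp: nonoverlapping_def)
      also have "\<dots> \<le> M' * (norm (f (snd (I k)) - f (fst (I k))) + norm (g (snd (I k)) - g (fst (I k))))"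
        using M' by (intro mult_right_mono) auto
      finally show "norm (h (snd (I k)) - h (fst (I k))) \<le> \<dots>" .
    qed
    also have "\<dots> = M' * ((\<Sum>k<n. norm (f (snd (I k)) - f (fst (I k)))) + (\<Sum>k<n. norm (g (snd (I k)) - g (fst (I k)))))"
      by (simp add: sum.distrib sum_distrib_left distrib_left)
    also have "\<dots> < M' * (?e + ?e)"
      using 1 2 M' by (intro mult_strict_left_mono add_strict_mono) auto
    also have "\<dots> = \<epsilon>" using M' by (simp add: field_simps)
    finally show "(\<Sum>k<n. norm (h (snd (I k)) - h (fst (I k)))) < \<epsilon>" .
  qed
qed

lemma abs_cont_on_ident: "abs_cont_on a b (\<lambda>x::real. x)"
  unfolding abs_cont_on_iff
proof (intro allI impI)
  fix e :: real assume "e > 0"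
  have *: "(\<Sum>k<n. norm (snd (I k) - fst (I k))) = (\<Sum>k<n. snd (I k) - fst (I k))"
    if "nonoverlapping a b n I" for n I
    using that by (intro sum.cong) (auto simp: nonoverlapping_def)
  show "\<exists>\<delta>>0. \<forall>n I. nonoverlapping a b n I \<and> (\<Sum>k<n. snd (I k) - fst (I k)) < \<delta>
        \<longrightarrow> (\<Sum>k<n. norm (snd (I k) - fst (I k))) < e"
    using \<open>e > 0\<close> * by (intro exI[of _ e]) metis
qed

lemma abs_cont_on_lipschitz:
  fixes h :: "real \<Rightarrow> 'c::real_normed_vector"
  assumes "\<And>u v. a \<le> u \<Longrightarrow> u \<le> v \<Longrightarrow> v \<le> b \<Longrightarrow> norm (h v - h u) \<le> M * (v - u)"
  shows "abs_cont_on a b h"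
  by (rule abs_cont_on_comparison[OF abs_cont_on_ident abs_cont_on_ident, where M = "M/2"])
     (use assms in \<open>fastforce simp: field_simps\<close>)

lemma abs_cont_on_const: "abs_cont_on a b (\<lambda>x. c)"
  by (rule abs_cont_on_lipschitz[where M=0]) auto

lemma abs_cont_on_linear:
  assumes "abs_cont_on a b f" "bounded_linear L"
  shows "abs_cont_on a b (\<lambda>x. L (f x))"
proof -
  obtain K where K: "\<And>x. norm (L x) \<le> norm x * K"
    using bounded_linear.bounded[OF assms(2)] by blast
  show ?thesis
  proof (rule abs_cont_on_comparison[OF assms(1) abs_cont_on_const[of _ _ "0::real"], where M = K])
    fix u v :: real
    show "norm (L (f v) - L (f u)) \<le> K * (norm (f v - f u) + norm ((0::real) - 0))"
      using K[of "f v - f u"] by (simp add: linear_diff[OF bounded_linear.linear[OF assms(2)]] mult.commute)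
  qed
qed

lemma abs_cont_on_add:
  assumes "abs_cont_on a b f" "abs_cont_on a b g"
  shows "abs_cont_on a b (\<lambda>x. f x + g x)"
proof (rule abs_cont_on_comparison[OF assms, where M = 1])
  fix u v :: real
  have "norm ((f v - f u) + (g v - g u)) \<le> norm (f v - f u) + norm (g v - g u)"
    by (rule norm_triangle_ineq)
  then show "norm (f v + g v - (f u + g u)) \<le> 1 * (norm (f v - f u) + norm (g v - g u))"
    by (simp add: algebra_simps)
qed

lemma abs_cont_on_minus: "abs_cont_on a b f \<Longrightarrow> abs_cont_on a b (\<lambda>x. - f x)"
  by (erule abs_cont_on_linear[where L = uminus]) (rule bounded_linear_minus[OF bounded_linear_ident])

lemma abs_cont_on_diff:
  "abs_cont_on a b f \<Longrightarrow> abs_cont_on a b g \<Longrightarrow> abs_cont_on a b (\<lambda>x. f x - g x)"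
  using abs_cont_on_add[OF _ abs_cont_on_minus] by fastforce

lemma abs_cont_on_imp_continuous_on:
  assumes "abs_cont_on a b f"
  shows "continuous_on {a..b} f"
  unfolding continuous_on_iff
proof (intro ballI allI impI)
  fix x e :: real assume x: "x \<in> {a..b}" and e: "e > 0"
  obtain d where d0: "d > 0" and d: "\<And>J u v. finite (J::unit set) \<and> (\<forall>i\<in>J. a \<le> u i \<and> u i \<le> v i \<and> v i \<le> b) \<and>
      (\<forall>i\<in>J. \<forall>j\<in>J. i \<noteq> j \<longrightarrow> {u i<..<v i} \<inter> {u j<..<v j} = {}) \<and>
      (\<Sum>i\<in>J. v i - u i) < d \<Longrightarrow> (\<Sum>i\<in>J. norm (f (v i) - f (u i))) < e"
    using abs_cont_onD[OF assms e, where 'i=unit] by auto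
  show "\<exists>d>0. \<forall>x'\<in>{a..b}. dist x' x < d \<longrightarrow> dist (f x') (f x) < e"
  proof (intro exI[of _ d] conjI ballI impI d0)
    fix x' assume x': "x' \<in> {a..b}" "dist x' x < d"
    have "(\<Sum>i\<in>{()}. norm (f (max x x') - f (min x x'))) < e"
      by (rule d) (use x x' in \<open>auto simp: dist_real_def\<close>)
    then show "dist (f x') (f x) < e"
      by (auto simp: dist_norm min_def max_def norm_minus_commute split: if_splits)
  qed
qed

lemma continuous_on_Icc_bound:
  fixes f :: "real \<Rightarrow> 'a::real_normed_vector"
  assumes "continuous_on {a..b} f"
  obtains M where "M > 0" "\<And>x. x \<in> {a..b} \<Longrightarrow> norm (f x) \<le> M"
  using compact_imp_bounded[OF compact_continuous_image[OF assms compact_Icc]]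
  unfolding bounded_pos by auto

lemma abs_cont_on_bilinear:
  assumes "bounded_bilinear B" "abs_cont_on a b f" "abs_cont_on a b g"
  shows "abs_cont_on a b (\<lambda>x. B (f x) (g x))"
proof -
  interpret bounded_bilinear B by fact
  obtain K where K: "K > 0" "\<And>x y. norm (B x y) \<le> norm x * norm y * K"
    using pos_bounded by blast
  obtain M1 where M1: "M1 > 0" "\<And>x. x \<in> {a..b} \<Longrightarrow> norm (f x) \<le> M1"
    by (rule continuous_on_Icc_bound[OF abs_cont_on_imp_continuous_on[OF assms(2)]]) (rule that)
  obtain M2 where M2: "M2 > 0" "\<And>x. x \<in> {a..b} \<Longrightarrow> norm (g x) \<le> M2"
    by (rule continuous_on_Icc_bound[OF abs_cont_on_imp_continuous_on[OF assms(3)]]) (rule that)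
  show ?thesis
  proof (rule abs_cont_on_comparison[OF assms(2,3), where M = "(M1 + M2) * K"])
    fix u v assume uv: "a \<le> u" "u \<le> v" "v \<le> b"
    have "norm (B (f v) (g v) - B (f u) (g u)) = norm (B (f v - f u) (g v) + B (f u) (g v - g u))"
      by (simp add: diff_left diff_right)
    also have "\<dots> \<le> norm (f v - f u) * norm (g v) * K + norm (f u) * norm (g v - g u) * K"
      by (rule norm_triangle_mono[OF K(2) K(2)])
    also have "\<dots> \<le> norm (f v - f u) * (M1 + M2) * K + (M1 + M2) * norm (g v - g u) * K"
      using M1(2)[of u] M2(2)[of v] M1(1) M2(1) uv K(1)
      by (intro add_mono mult_right_mono mult_left_mono) auto
    finally show "norm (B (f v) (g v) - B (f u) (g u)) \<le> (M1 + M2) * K * (norm (f v - f u) + norm (g v - g u))"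
      by (simp add: algebra_simps)
  qed
qed

lemmas abs_cont_on_mult = abs_cont_on_bilinear[OF bounded_bilinear_mult]

lemma abs_cont_on_compose_lipschitz:
  assumes f: "abs_cont_on a b f"
    and L: "\<And>u v. u \<in> {a..b} \<Longrightarrow> v \<in> {a..b} \<Longrightarrow> norm (h (f v) - h (f u)) \<le> M * norm (f v - f u)"
  shows "abs_cont_on a b (\<lambda>x. h (f x))"
  by (rule abs_cont_on_comparison[OF f f, where M = "M/2"]) (use L in auto)

text \<open>A nondecreasing nonexpansive \<open>g\<close> sends nonoverlapping intervals to
  nonoverlapping intervals of no greater length. The identity gives restriction to a subinterval;
  \<open>min x c\<close> and \<open>max x c\<close> give the gluing of functions at
  \<open>c\<close>.\<close>

lemma abs_cont_on_compose_clamp: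
  fixes f :: "real \<Rightarrow> 'a::real_normed_vector"
  assumes f: "abs_cont_on c d f"
    and g: "\<And>u v. a \<le> u \<Longrightarrow> u \<le> v \<Longrightarrow> v \<le> b \<Longrightarrow> c \<le> g u \<and> g u \<le> g v \<and> g v \<le> d \<and> g v - g u \<le> v - u"
  shows "abs_cont_on a b (\<lambda>x. f (g x))"
  unfolding abs_cont_on_iff
proof (intro allI impI)
  fix e :: real assume "e > 0"
  then obtain \<delta> where d0: "\<delta> > 0" and d: "\<And>n I. nonoverlapping c d n I \<and> (\<Sum>k<n. snd (I k) - fst (I k)) < \<delta>
        \<Longrightarrow> (\<Sum>k<n. norm (f (snd (I k)) - f (fst (I k)))) < e"
    using f unfolding abs_cont_on_iff by blast
  show "\<exists>\<delta>>0. \<forall>n I. nonoverlapping a b n I \<and> (\<Sum>k<n. snd (I k) - fst (I k)) < \<delta>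
      \<longrightarrow> (\<Sum>k<n. norm (f (g (snd (I k))) - f (g (fst (I k))))) < e"
  proof (intro exI[of _ \<delta>] conjI allI impI d0; elim conjE)
    fix n I assume no: "nonoverlapping a b n I" and small: "(\<Sum>k<n. snd (I k) - fst (I k)) < \<delta>"
    let ?I = "\<lambda>k. (g (fst (I k)), g (snd (I k)))"
    have uv: "a \<le> fst (I k)" "fst (I k) \<le> snd (I k)" "snd (I k) \<le> b" if "k < n" for k
      using no that by (auto simp: nonoverlapping_def)
    have G: "c \<le> g (fst (I k)) \<and> g (fst (I k)) \<le> g (snd (I k)) \<and> g (snd (I k)) \<le> d \<and>
        g (snd (I k)) - g (fst (I k)) \<le> snd (I k) - fst (I k)" if "k < n" for k
      by (rule g[OF uv[OF that]])
    have dj: "{g (fst (I j))<..<g (snd (I j))} \<inter> {g (fst (I k))<..<g (snd (I k))} = {}"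
      if jk: "j < n" "k < n" "j \<noteq> k" for j k
    proof (rule ccontr)
      assume "{g (fst (I j))<..<g (snd (I j))} \<inter> {g (fst (I k))<..<g (snd (I k))} \<noteq> {}"
      then obtain t where t: "g (fst (I j)) < t" "t < g (snd (I j))" "g (fst (I k)) < t" "t < g (snd (I k))"
        unfolding ex_in_conv[symmetric] Int_iff greaterThanLessThan_iff by blast
      \<comment> \<open>Monotonicity of \<open>g\<close> turns a common image point into an ordering
        of the endpoints, so the original intervals would share a point as well.\<close>
      have "fst (I j) < snd (I k)"
        using t g[of "snd (I k)" "fst (I j)"] uv[OF jk(1)] uv[OF jk(2)] by fastforce
      moreover have "fst (I k) < snd (I j)"
        using t g[of "snd (I j)" "fst (I k)"] uv[OF jk(1)] uv[OF jk(2)] by fastforce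
      moreover have "fst (I j) < snd (I j)" "fst (I k) < snd (I k)"
        using t uv[OF jk(1)] uv[OF jk(2)] by (metis less_asym order_less_trans order_le_less)+
      ultimately have "max (fst (I j)) (fst (I k)) < min (snd (I j)) (snd (I k))" by simp
      then obtain s where "max (fst (I j)) (fst (I k)) < s" "s < min (snd (I j)) (snd (I k))"
        using dense by blast
      then have "s \<in> {fst (I j)<..<snd (I j)} \<inter> {fst (I k)<..<snd (I k)}" by auto
      then show False using no jk unfolding nonoverlapping_def by (metis empty_iff)
    qed
    have "(\<Sum>k<n. norm (f (snd (?I k)) - f (fst (?I k)))) < e"
    proof (rule d, rule conjI)
      show "nonoverlapping c d n ?I"
        unfolding nonoverlapping_def using G dj by simp
      have "(\<Sum>k<n. snd (?I k) - fst (?I k)) \<le> (\<Sum>k<n. snd (I k) - fst (I k))"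
        using G by (intro sum_mono) auto
      then show "(\<Sum>k<n. snd (?I k) - fst (?I k)) < \<delta>" using small by simp
    qed
    then show "(\<Sum>k<n. norm (f (g (snd (I k))) - f (g (fst (I k))))) < e" by simp
  qed
qed

lemma abs_cont_on_subinterval:
  assumes "abs_cont_on a b f" "a \<le> c" "d \<le> b"
  shows "abs_cont_on c d f"
  by (rule abs_cont_on_compose_clamp[OF assms(1), where g = "\<lambda>x. x"]) (use assms in auto)

lemma abs_cont_on_reflect:
  fixes f :: "real \<Rightarrow> 'a::real_normed_vector"
  assumes "abs_cont_on a b f"
  shows "abs_cont_on (-b) (-a) (\<lambda>x. f (- x))"
  unfolding abs_cont_on_iff
proof (intro allI impI)
  fix e :: real assume "e > 0"
  then obtain \<delta> where d0: "\<delta> > 0" and d: "\<And>J u v. finite (J::nat set) \<and> (\<forall>i\<in>J. a \<le> u i \<and> u i \<le> v i \<and> v i \<le> b) \<and>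
      (\<forall>i\<in>J. \<forall>j\<in>J. i \<noteq> j \<longrightarrow> {u i<..<v i} \<inter> {u j<..<v j} = {}) \<and>
      (\<Sum>i\<in>J. v i - u i) < \<delta> \<Longrightarrow> (\<Sum>i\<in>J. norm (f (v i) - f (u i))) < e"
    using abs_cont_onD[OF assms \<open>e > 0\<close>, where 'i=nat] by auto
  show "\<exists>\<delta>>0. \<forall>(n::nat) (I::nat \<Rightarrow> real \<times> real).
        nonoverlapping (-b) (-a) n I \<and>
        (\<Sum>k<n. snd (I k) - fst (I k)) < \<delta>
        \<longrightarrow> (\<Sum>k<n. norm (f (- snd (I k)) - f (- fst (I k)))) < e"
  proof (intro exI[of _ \<delta>] conjI allI impI d0)
    fix n :: nat and I :: "nat \<Rightarrow> real \<times> real"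
    assume A: "nonoverlapping (-b) (-a) n I \<and>
        (\<Sum>k<n. snd (I k) - fst (I k)) < \<delta>"
    then have N: "nonoverlapping (- b) (- a) n I" and small: "(\<Sum>k<n. snd (I k) - fst (I k)) < \<delta>"
      by simp_all
    have I: "- b \<le> fst (I k) \<and> fst (I k) \<le> snd (I k) \<and> snd (I k) \<le> - a" if "k < n" for k
      using N that unfolding nonoverlapping_def by metis
    have dj: "{fst (I i)<..<snd (I i)} \<inter> {fst (I j)<..<snd (I j)} = {}"
      if "i < n" "j < n" "i \<noteq> j" for i j
      using N that unfolding nonoverlapping_def by metis
    have "(\<Sum>k\<in>{..<n}. norm (f (- fst (I k)) - f (- snd (I k)))) < e"
    proof (rule d[of "{..<n}" "\<lambda>k. - snd (I k)" "\<lambda>k. - fst (I k)"], intro conjI ballI impI)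
      fix i j assume ij: "i \<in> {..<n}" "j \<in> {..<n}" "i \<noteq> j"
      have "x \<notin> {- snd (I i)<..<- fst (I i)} \<inter> {- snd (I j)<..<- fst (I j)}" for x
      proof
        assume "x \<in> {- snd (I i)<..<- fst (I i)} \<inter> {- snd (I j)<..<- fst (I j)}"
        then have "- x \<in> {fst (I i)<..<snd (I i)} \<inter> {fst (I j)<..<snd (I j)}"
          by auto
        then show False using dj[of i j] ij by (metis empty_iff lessThan_iff)
      qed
      then show "{- snd (I i)<..<- fst (I i)} \<inter> {- snd (I j)<..<- fst (I j)} = {}"
        by blast
    next
      fix i assume "i \<in> {..<n}"
      then show "a \<le> - snd (I i)" "- snd (I i) \<le> - fst (I i)" "- fst (I i) \<le> b"
        using I[of i] by auto
    qed (use small in simp_all)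
    then show "(\<Sum>k<n. norm (f (- snd (I k)) - f (- fst (I k)))) < e"
      by (simp add: norm_minus_commute)
  qed
qed

section \<open>Absolute continuity, differentiation and integration\<close>

lemma sum_integral_nonoverlapping_le:
  fixes g :: "real \<Rightarrow> real"
  assumes J: "finite J" and uv: "\<And>i. i \<in> J \<Longrightarrow> a \<le> u i \<and> u i \<le> v i \<and> v i \<le> b"
    and dj: "\<And>i j. i \<in> J \<Longrightarrow> j \<in> J \<Longrightarrow> i \<noteq> j \<Longrightarrow> {u i<..<v i} \<inter> {u j<..<v j} = {}"
    and g: "g integrable_on {a..b}" and nn: "\<And>x. x \<in> {a..b} \<Longrightarrow> g x \<ge> 0"
  shows "(\<Sum>i\<in>J. integral {u i..v i} g) \<le> integral {a..b} g"
proof -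
  have "(g has_integral integral {u i..v i} g) {u i<..<v i}" if "i \<in> J" for i
    unfolding has_integral_Icc_iff_Ioo[symmetric]
    using uv[OF that] by (intro integrable_integral integrable_subinterval_real[OF g]) auto
  moreover have "pairwise (\<lambda>i j. negligible ({u i<..<v i} \<inter> {u j<..<v j})) J"
    using dj by (auto simp: pairwise_def simp del: Int_greaterThanLessThan)
  ultimately have "(g has_integral (\<Sum>i\<in>J. integral {u i..v i} g)) (\<Union>i\<in>J. {u i<..<v i})"
    by (intro has_integral_UN[OF J])
  moreover have "(\<Union>i\<in>J. {u i<..<v i}) \<subseteq> {a..b}"
    using uv by fastforce
  ultimately show ?thesis
    using has_integral_subset_le[OF _ _ integrable_integral[OF g]] nn by blast
qed

lemma sum_lengths_le_measure:
  fixes u v :: "'i \<Rightarrow> real"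
  assumes J: "finite J" and uv: "\<And>i. i \<in> J \<Longrightarrow> u i \<le> v i"
    and dj: "\<And>i j. i \<in> J \<Longrightarrow> j \<in> J \<Longrightarrow> i \<noteq> j \<Longrightarrow> {u i<..<v i} \<inter> {u j<..<v j} = {}"
    and T: "\<And>i. i \<in> J \<Longrightarrow> {u i<..<v i} \<subseteq> T" "T \<in> lmeasurable"
  shows "(\<Sum>i\<in>J. v i - u i) \<le> measure lebesgue T"
proof -
  have "(\<Sum>i\<in>J. v i - u i) = (\<Sum>i\<in>J. measure lebesgue {u i<..<v i})"
    using uv by (intro sum.cong) auto
  also have "\<dots> = measure lebesgue (\<Union>i\<in>J. {u i<..<v i})"
    using dj uv
    by (intro measure_finite_Union[symmetric] J)
       (auto simp: disjoint_family_on_def simp del: Int_greaterThanLessThan)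
  also have "\<dots> \<le> measure lebesgue T"
    using T J by (intro measure_mono_fmeasurable) auto
  finally show ?thesis .
qed

lemma negligible_open_cover:
  fixes N :: "'a::euclidean_space set"
  assumes "negligible N" "\<delta> > 0"
  obtains T where "open T" "N \<subseteq> T" "T \<in> lmeasurable" "measure lebesgue T < \<delta>"
proof -
  obtain T where T: "open T" "N \<subseteq> T" "T - N \<in> lmeasurable" "emeasure lebesgue (T - N) < ennreal \<delta>"
    using sets_lebesgue_outer_open[OF negligible_imp_sets[OF assms(1)] assms(2)] by blast
  have eq: "T = (T - N) \<union> N" using T(2) by blast
  have m: "T \<in> lmeasurable"
    by (subst eq) (intro fmeasurable.Un T negligible_imp_measurable assms)
  have "measure lebesgue T \<le> measure lebesgue (T - N) + measure lebesgue N"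
    by (subst eq, intro measure_Un_le) (use T assms negligible_imp_sets in \<open>auto simp: fmeasurableD\<close>)
  also have "measure lebesgue N = 0" by (rule negligible_imp_measure0[OF assms(1)])
  also have "measure lebesgue (T - N) < \<delta>"
    using T(3,4) assms(2) by (simp add: emeasure_eq_measure2 ennreal_less_iff)
  finally show ?thesis using that T m by simp
qed

lemma has_vector_derivative_within_alt:
  "(f has_vector_derivative f') (at x within S) \<longleftrightarrow>
    (\<forall>e>0. \<exists>d>0. \<forall>y\<in>S. \<bar>y - x\<bar> < d \<longrightarrow> norm (f y - f x - (y - x) *\<^sub>R f') \<le> e * \<bar>y - x\<bar>)"
  unfolding has_vector_derivative_def has_derivative_within_alt
  by (simp add: bounded_linear_scaleR_left)

lemma has_vector_derivative_zero_on:
  fixes f :: "real \<Rightarrow> 'a::real_normed_vector"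
  assumes "(f has_vector_derivative f') (at x within {a..b})" "\<And>t. t \<in> {a..b} \<Longrightarrow> f t = 0"
    and "x \<in> {a..b}" "a < b"
  shows "f' = 0"
proof -
  have "(f has_vector_derivative 0) (at x within {a..b})"
    by (rule has_vector_derivative_transform[OF _ _ has_vector_derivative_const[of 0]]) (use assms in auto)
  then show ?thesis
    using assms by (intro vector_derivative_unique_within[OF _ assms(1)]) (auto simp: trivial_limit_within islimpt_Icc)
qed

text \<open>The gauge treats two kinds of tags. At a point of differentiability the Riemann term
  differs from the increment by a small multiple of the length. A tag in the exceptional null set
  confines its interval to an open set of measure below the \<open>\<delta>\<close> of absolute
  continuity, so the increments over such intervals are small in total.\<close>

theorem abs_cont_on_has_integral_derivative:
  fixes f :: "real \<Rightarrow> 'a::banach"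
  assumes ab: "a \<le> b" and ac: "abs_cont_on a b f"
    and der: "AE x in lborel. x \<in> {a..b} \<longrightarrow> (f has_vector_derivative f' x) (at x within {a..b})"
  shows "(f' has_integral (f b - f a)) {a..b}"
proof -
  obtain N where N: "negligible N"
    and fN: "\<And>x. x \<notin> N \<Longrightarrow> x \<in> {a..b} \<Longrightarrow> (f has_vector_derivative f' x) (at x within {a..b})"
    using der unfolding AE_lborel_iff_negligible by blast
  \<comment> \<open>With the value 0 on the exceptional set, the tags there contribute nothing but
    increments of \<open>f\<close>.\<close>
  define g where "g x = (if x \<in> N then 0 else f' x)" for x
  have "(g has_integral (f b - f a)) (cbox a b)"
    unfolding has_integral
  proof (intro allI impI)
    fix e :: real assume e: "e > 0"
    \<comment> \<open>Errors of \<open>e'\<close> times the length add up to less than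
      \<open>e / 2\<close>; the summand 1 keeps the divisor positive when
      \<open>a = b\<close>.\<close>
    define e' where "e' = e / (2 * (b - a + 1))"
    have e': "e' > 0" using e ab by (simp add: e'_def)
    have "\<forall>x. \<exists>d>0. x \<in> {a..b} - N \<longrightarrow>
         (\<forall>y\<in>{a..b}. \<bar>y - x\<bar> < d \<longrightarrow> norm (f y - f x - (y - x) *\<^sub>R f' x) \<le> e' * \<bar>y - x\<bar>)"
      using fN e' unfolding has_vector_derivative_within_alt by (metis DiffE zero_less_one)
    then obtain d where d0: "\<And>x. d x > 0"
      and d: "\<And>x y. x \<in> {a..b} - N \<Longrightarrow> y \<in> {a..b} \<Longrightarrow> \<bar>y - x\<bar> < d x \<Longrightarrow>
        norm (f y - f x - (y - x) *\<^sub>R f' x) \<le> e' * \<bar>y - x\<bar>"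
      by metis
    obtain \<delta> where \<delta>0: "\<delta> > 0" and \<delta>: "\<And>J u v. finite (J::(real \<times> real set) set) \<and>
      (\<forall>i\<in>J. a \<le> u i \<and> u i \<le> v i \<and> v i \<le> b) \<and>
      (\<forall>i\<in>J. \<forall>j\<in>J. i \<noteq> j \<longrightarrow> {u i<..<v i} \<inter> {u j<..<v j} = {}) \<and>
      (\<Sum>i\<in>J. v i - u i) < \<delta> \<Longrightarrow> (\<Sum>i\<in>J. norm (f (v i) - f (u i))) < e / 2"
      using abs_cont_onD[OF ac half_gt_zero[OF e], where 'i="real \<times> real set"] by auto
    obtain T where T: "open T" "N \<subseteq> T" "T \<in> lmeasurable" "measure lebesgue T < \<delta>"
      using negligible_open_cover[OF N \<delta>0] by blast
    define \<gamma> where "\<gamma> x = (if x \<in> N then T else ball x (d x))" for x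
    show "\<exists>\<gamma>. gauge \<gamma> \<and> (\<forall>\<D>. \<D> tagged_division_of cbox a b \<and> \<gamma> fine \<D> \<longrightarrow>
      norm ((\<Sum>(x,k)\<in>\<D>. measure lborel k *\<^sub>R g x) - (f b - f a)) < e)"
    proof (intro exI[of _ \<gamma>] conjI allI impI; (elim conjE)?)
      show "gauge \<gamma>"
        using T d0 by (intro gaugeI) (auto simp: \<gamma>_def)
      fix p assume p: "p tagged_division_of cbox a b" and fine: "\<gamma> fine p"
      note pD = tagged_division_ofD[OF p]
      define u where "u i = Inf (snd i)" for i :: "real \<times> real set"
      define v where "v i = Sup (snd i)" for i :: "real \<times> real set"
      have uv: "snd i = {u i..v i}" "u i \<le> v i" "fst i \<in> {u i..v i}" "a \<le> u i" "v i \<le> b"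
        if i: "i \<in> p" for i
      proof -
        have ip: "(fst i, snd i) \<in> p" using i by simp
        obtain c d where cd: "snd i = {c..d}" using pD(4)[OF ip] by auto
        have x: "fst i \<in> {c..d}" using pD(2)[OF ip] cd by simp
        then have "c \<le> d" by auto
        then have "u i = c" "v i = d" by (auto simp: u_def v_def cd)
        then show "snd i = {u i..v i}" "u i \<le> v i" "fst i \<in> {u i..v i}" "a \<le> u i" "v i \<le> b"
          using cd x \<open>c \<le> d\<close> pD(3)[OF ip] by auto
      qed
      have dj: "{u i<..<v i} \<inter> {u j<..<v j} = {}" if "i \<in> p" "j \<in> p" "i \<noteq> j" for i j
      proof -
        have "interior (snd i) \<inter> interior (snd j) = {}"
          using pD(5)[of "fst i" "snd i" "fst j" "snd j"] that by simp
        then show ?thesis using uv(1)[OF that(1)] uv(1)[OF that(2)] by simp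
      qed
      have fineD: "snd i \<subseteq> \<gamma> (fst i)" if "i \<in> p" for i
        using fine that unfolding fine_def by (cases i) auto
      define p1 where "p1 = {i \<in> p. fst i \<notin> N}"
      define p2 where "p2 = {i \<in> p. fst i \<in> N}"
      have p12: "p = p1 \<union> p2" "p1 \<inter> p2 = {}" "finite p1" "finite p2" "p1 \<subseteq> p" "p2 \<subseteq> p"
        using pD(1) by (auto simp: p1_def p2_def)
      define r where "r i = measure lborel (snd i) *\<^sub>R g (fst i) - (f (v i) - f (u i))" for i
      have "(\<Sum>(x,k)\<in>p. measure lborel k *\<^sub>R g x) - (f b - f a) = (\<Sum>i\<in>p. r i)"
        using additive_tagged_division_1[OF ab p[unfolded box_real], of f]
        by (simp add: r_def sum_subtractf u_def v_def split_beta)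
      also have "\<dots> = (\<Sum>i\<in>p1. r i) + (\<Sum>i\<in>p2. r i)"
        using p12 by (metis sum.union_disjoint)
      finally have eq: "norm ((\<Sum>(x,k)\<in>p. measure lborel k *\<^sub>R g x) - (f b - f a))
          \<le> norm (\<Sum>i\<in>p1. r i) + norm (\<Sum>i\<in>p2. r i)"
        by (metis norm_triangle_ineq)
      have "norm (\<Sum>i\<in>p1. r i) \<le> (\<Sum>i\<in>p1. e' * (v i - u i))"
      proof (rule sum_norm_le)
        fix i assume i: "i \<in> p1"
        then have ip: "i \<in> p" and x: "fst i \<notin> N" by (auto simp: p1_def)
        define x where "x = fst i"
        note U = uv[OF ip]
        have xab: "x \<in> {a..b} - N" using U x by (auto simp: x_def)
        have "snd i \<subseteq> ball x (d x)"
          using fineD[OF ip] x by (simp add: \<gamma>_def x_def)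
        moreover have "u i \<in> snd i" "v i \<in> snd i" using U(1,2) by auto
        ultimately have "u i \<in> ball x (d x)" "v i \<in> ball x (d x)" by blast+
        then have b1: "\<bar>u i - x\<bar> < d x" "\<bar>v i - x\<bar> < d x" by (auto simp: dist_real_def)
        \<comment> \<open>The estimates at the two endpoints are subtracted. The tag lies between
          the endpoints, so its distances to them add up to the length.\<close>
        have "r i = (f (u i) - f x - (u i - x) *\<^sub>R f' x) - (f (v i) - f x - (v i - x) *\<^sub>R f' x)"
          using U x by (simp add: r_def g_def x_def algebra_simps)
        then have "norm (r i) \<le> norm (f (u i) - f x - (u i - x) *\<^sub>R f' x) + norm (f (v i) - f x - (v i - x) *\<^sub>R f' x)"
          by (metis norm_triangle_ineq4)
        also have "\<dots> \<le> e' * \<bar>u i - x\<bar> + e' * \<bar>v i - x\<bar>"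
          using U by (intro add_mono d xab b1) auto
        also have "\<dots> = e' * (v i - u i)"
          using U by (simp add: x_def algebra_simps)
        finally show "norm (r i) \<le> e' * (v i - u i)" .
      qed
      also have "\<dots> = e' * (\<Sum>i\<in>p1. v i - u i)" by (simp add: sum_distrib_left)
      also have "\<dots> \<le> e' * (b - a)"
      proof -
        have "(\<Sum>i\<in>p1. v i - u i) \<le> measure lebesgue {a..b}"
        proof (rule sum_lengths_le_measure)
          show "{u i<..<v i} \<subseteq> {a..b}" if "i \<in> p1" for i
            using uv(4,5)[of i] that p12 by fastforce
        qed (use p12 uv(2) dj in auto)
        then show ?thesis using ab e' by simp
      qed
      also have "\<dots> < e / 2"
      proof -
        have "e' * (b - a) < e' * (b - a + 1)" using e' by simp
        also have "\<dots> = e / 2" using ab by (simp add: e'_def field_simps)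
        finally show ?thesis .
      qed
      finally have 1: "norm (\<Sum>i\<in>p1. r i) < e / 2" .
      have "(\<Sum>i\<in>p2. v i - u i) \<le> measure lebesgue T"
      proof (rule sum_lengths_le_measure)
        fix i assume i: "i \<in> p2"
        then have "snd i \<subseteq> T"
          using fineD[of i] by (simp add: \<gamma>_def p2_def)
        then show "{u i<..<v i} \<subseteq> T" using uv(1)[of i] i p12 by auto
      qed (use p12 uv(2) dj T in auto)
      then have "(\<Sum>i\<in>p2. v i - u i) < \<delta>" using T by simp
      then have 2: "(\<Sum>i\<in>p2. norm (f (v i) - f (u i))) < e / 2"
        using uv dj p12 by (intro \<delta>) (auto simp: subset_iff)
      have "norm (\<Sum>i\<in>p2. r i) \<le> (\<Sum>i\<in>p2. norm (f (v i) - f (u i)))"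
        by (rule sum_norm_le) (simp add: r_def p2_def g_def norm_minus_commute)
      with 1 2 eq show "norm ((\<Sum>(x,k)\<in>p. measure lborel k *\<^sub>R g x) - (f b - f a)) < e"
        by linarith
    qed
  qed
  then show ?thesis
    by (intro has_integral_spike[OF N, of _ f' g]) (auto simp: g_def)
qed

text \<open>Endpoints that violate the difference quotient by a fixed amount give a Vitali cover of the bad
  set, and Henstock's lemma bounds the total length of any finite disjoint part of that cover.\<close>

theorem lebesgue_differentiation:
  fixes f :: "real \<Rightarrow> 'a::euclidean_space"
  assumes f: "f integrable_on {a..b}"
  shows "AE x in lborel. x \<in> {a..b} \<longrightarrow>
    ((\<lambda>x. integral {a..x} f) has_vector_derivative f x) (at x within {a..b})"
proof -
  define F where "F x = integral {a..x} f" for x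
  define bad where "bad e = {x \<in> {a..b}. \<forall>d>0. \<exists>y\<in>{a..b}. \<bar>y - x\<bar> < d \<and>
    norm (F y - F x - (y - x) *\<^sub>R f x) > e * \<bar>y - x\<bar>}" for e
  have F: "integral {x..y} f = F y - F x" if "a \<le> x" "x \<le> y" "y \<le> b" for x y
    using Henstock_Kurzweil_Integration.integral_combine[of a x y f] that
      integrable_subinterval_real[OF f, of a y] by (simp add: F_def algebra_simps)
  have neg: "negligible (bad e)" if e: "e > 0" for e
    unfolding negligible_outer_le
  proof (intro allI impI)
    fix \<eta> :: real assume \<eta>: "\<eta> > 0"
    \<comment> \<open>Each bad interval misses its Riemann term by more than \<open>e\<close> times
      its length, so the tolerance \<open>\<eta> * e\<close> bounds the total length by
      \<open>\<eta>\<close>.\<close>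
    obtain \<gamma> where \<gamma>: "gauge \<gamma>" and hen: "\<And>p. \<lbrakk>p tagged_partial_division_of (cbox a b); \<gamma> fine p\<rbrakk> \<Longrightarrow>
             (\<Sum>(x,k)\<in>p. norm (measure lborel k *\<^sub>R f x - integral k f)) < \<eta> * e"
      using Henstock_lemma[of f a b "\<eta> * e"] f \<eta> e by auto
    \<comment> \<open>A pair consists of a tag and a violating partner on either side of it. The
      closed ball around the midpoint is exactly the interval between them, with the tag as an
      endpoint.\<close>
    define c where "c i = (fst i + snd i) / 2" for i :: "real \<times> real"
    define r where "r i = \<bar>snd i - fst i\<bar> / 2" for i :: "real \<times> real"
    define K where "K = {i. fst i \<in> bad e \<and> snd i \<in> {a..b} \<and> cball (c i) (r i) \<subseteq> \<gamma> (fst i) \<and>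
      norm (F (snd i) - F (fst i) - (snd i - fst i) *\<^sub>R f (fst i)) > e * \<bar>snd i - fst i\<bar>}"
    have cb: "cball (c i) (r i) = {min (fst i) (snd i)..max (fst i) (snd i)}" for i
      by (auto simp: c_def r_def cball_eq_atLeastAtMost min_def max_def field_simps)
    have r0: "r i > 0" if "i \<in> K" for i
      using that by (auto simp: K_def r_def)
    obtain C where C: "countable C" "C \<subseteq> K"
      and pw: "pairwise (\<lambda>i j. disjnt (cball (c i) (r i)) (cball (c j) (r j))) C"
      and neg: "negligible (bad e - (\<Union>i\<in>C. cball (c i) (r i)))"
    proof (rule Vitali_covering_theorem_cballs[of K r "bad e" c, OF r0])
      fix x d :: real assume x: "x \<in> bad e" and d: "d > 0"
      obtain \<rho> where \<rho>: "\<rho> > 0" "ball x \<rho> \<subseteq> \<gamma> x"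
        using \<gamma> unfolding gauge_def open_contains_ball by blast
      have "min \<rho> d > 0" using \<rho> d by simp
      then obtain y where y: "y \<in> {a..b}" "\<bar>y - x\<bar> < min \<rho> d"
          "norm (F y - F x - (y - x) *\<^sub>R f x) > e * \<bar>y - x\<bar>"
        using x unfolding bad_def by blast
      have "cball (c (x, y)) (r (x, y)) \<subseteq> ball x \<rho>"
        using y(2) by (auto simp: cb dist_real_def)
      then have "(x, y) \<in> K" using x y \<rho> by (auto simp: K_def)
      moreover have "x \<in> cball (c (x, y)) (r (x, y))" by (auto simp: cb)
      moreover have "r (x, y) < d" using y(2) by (auto simp: r_def)
      ultimately show "\<exists>i. i \<in> K \<and> x \<in> cball (c i) (r i) \<and> r i < d" by blast
    qed blast
    have bound: "measure lebesgue (\<Union>i\<in>I. cball (c i) (r i)) \<le> \<eta>" if I: "I \<subseteq> C" "finite I" for I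
    proof -
      have IK: "I \<subseteq> K" using I C by blast
      define k where "k i = (fst i, cball (c i) (r i))" for i
      have ne: "cball (c i) (r i) \<inter> cball (c j) (r j) = {}" if "i \<in> I" "j \<in> I" "i \<noteq> j" for i j
        using pw that I unfolding pairwise_def disjnt_def by blast
      have inj: "inj_on k I"
      proof (rule inj_onI, rule ccontr)
        fix i j assume ij: "i \<in> I" "j \<in> I" "k i = k j" "i \<noteq> j"
        then have "cball (c i) (r i) = {}" using ne[of i j] by (simp add: k_def)
        then show False using r0[of i] ij IK by auto
      qed
      have inab: "fst i \<in> {a..b}" "snd i \<in> {a..b}" if "i \<in> I" for i
        using that IK by (auto simp: K_def bad_def)
      have tp: "k ` I tagged_partial_division_of cbox a b"
        unfolding tagged_partial_division_of_def
      proof (intro conjI allI impI)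
        show "finite (k ` I)" using I by simp
      next
        fix x A assume "(x, A) \<in> k ` I"
        then obtain i where i: "i \<in> I" "x = fst i" "A = cball (c i) (r i)" by (auto simp: k_def)
        show "x \<in> A" "A \<subseteq> cbox a b" using i inab[of i] by (auto simp: cb)
        show "\<exists>a b. A = cbox a b" unfolding i cb box_real[symmetric] by blast
      next
        fix x A y B assume "(x, A) \<in> k ` I \<and> (y, B) \<in> k ` I \<and> (x, A) \<noteq> (y, B)"
        then obtain i j where "i \<in> I" "j \<in> I" "i \<noteq> j" "A = cball (c i) (r i)" "B = cball (c j) (r j)"
          by (auto simp: k_def)
        then have "A \<inter> B = {}" using ne by simp
        then show "interior A \<inter> interior B = {}" using interior_subset by blast
      qed
      have fine: "\<gamma> fine k ` I"
        using IK unfolding fine_def k_def K_def by blast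
      have "measure lebesgue (\<Union>i\<in>I. cball (c i) (r i)) \<le> (\<Sum>i\<in>I. measure lebesgue (cball (c i) (r i)))"
        by (intro measure_UNION_le I) auto
      also have "\<dots> = (\<Sum>i\<in>I. \<bar>snd i - fst i\<bar>)"
        by (intro sum.cong refl) (auto simp: cb)
      also have "e * \<dots> \<le> (\<Sum>i\<in>I. norm (measure lborel (snd (k i)) *\<^sub>R f (fst (k i)) - integral (snd (k i)) f))"
        unfolding sum_distrib_left
      proof (rule sum_mono)
        fix i assume i: "i \<in> I"
        let ?x = "fst i" and ?y = "snd i"
        have "norm (measure lborel (snd (k i)) *\<^sub>R f (fst (k i)) - integral (snd (k i)) f)
          = norm (F ?y - F ?x - (?y - ?x) *\<^sub>R f ?x)"
        proof (cases "?x \<le> ?y")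
          case True
          then show ?thesis using inab[OF i] by (simp add: k_def cb F norm_minus_commute)
        next
          case False
          then have *: "integral {?y..?x} f = F ?x - F ?y" using inab[OF i] by (intro F) auto
          have "norm (measure lborel (snd (k i)) *\<^sub>R f (fst (k i)) - integral (snd (k i)) f)
            = norm ((?x - ?y) *\<^sub>R f ?x - (F ?x - F ?y))"
            using False by (simp add: k_def cb *)
          also have "(?x - ?y) *\<^sub>R f ?x - (F ?x - F ?y) = F ?y - F ?x - (?y - ?x) *\<^sub>R f ?x"
            by (simp add: algebra_simps)
          finally show ?thesis .
        qed
        also have "\<dots> > e * \<bar>?y - ?x\<bar>" using i IK by (auto simp: K_def)
        finally show "e * \<bar>?y - ?x\<bar> \<le> norm (measure lborel (snd (k i)) *\<^sub>R f (fst (k i)) - integral (snd (k i)) f)"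
          by simp
      qed
      also have "\<dots> = (\<Sum>(x,k)\<in>k ` I. norm (measure lborel k *\<^sub>R f x - integral k f))"
        by (simp add: sum.reindex[OF inj] split_beta)
      also have "\<dots> < \<eta> * e" by (rule hen[OF tp fine])
      finally show ?thesis using e by (simp add: mult.commute)
    qed
    let ?U = "\<Union>i\<in>C. cball (c i) (r i)"
    have U: "?U \<in> lmeasurable" "measure lebesgue ?U \<le> \<eta>"
      by (rule fmeasurable_UN_bound[OF C(1) _ bound] measure_UN_bound[OF C(1) _ bound]; simp)+
    have "measure lebesgue ((bad e - ?U) \<union> ?U) \<le> measure lebesgue (bad e - ?U) + measure lebesgue ?U"
      using neg U by (intro measure_Un_le) (auto intro: negligible_imp_sets fmeasurableD)
    also have "\<dots> \<le> \<eta>" using negligible_imp_measure0[OF neg] U(2) by simp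
    finally have "measure lebesgue ((bad e - ?U) \<union> ?U) \<le> \<eta>" .
    moreover have "(bad e - ?U) \<union> ?U \<in> lmeasurable"
      using negligible_imp_measurable[OF neg] U(1) by (rule fmeasurable.Un)
    ultimately show "\<exists>T. bad e \<subseteq> T \<and> T \<in> lmeasurable \<and> measure lebesgue T \<le> \<eta>"
      by (intro exI[of _ "(bad e - ?U) \<union> ?U"]) auto
  qed
  define N where "N = (\<Union>n::nat. bad (1 / (real n + 1)))"
  have "negligible N"
    unfolding N_def by (intro negligible_countable_Union) (auto intro!: neg)
  moreover have "(F has_vector_derivative f x) (at x within {a..b})" if x: "x \<notin> N" "x \<in> {a..b}" for x
    unfolding has_vector_derivative_within_alt
  proof (intro allI impI)
    fix e :: real assume "e > 0"
    then obtain n :: nat where n: "1 / (real n + 1) < e"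
      using nat_approx_posE[of e] by (auto simp: add.commute)
    have "x \<notin> bad (1 / (real n + 1))" using x by (auto simp: N_def)
    then obtain d where d: "d > 0" "\<forall>y\<in>{a..b}. \<bar>y - x\<bar> < d \<longrightarrow>
        norm (F y - F x - (y - x) *\<^sub>R f x) \<le> 1 / (real n + 1) * \<bar>y - x\<bar>"
      using x unfolding bad_def mem_Collect_eq not_less[symmetric] by blast
    have "1 / (real n + 1) * \<bar>y - x\<bar> \<le> e * \<bar>y - x\<bar>" for y
      using n by (intro mult_right_mono) auto
    then show "\<exists>d>0. \<forall>y\<in>{a..b}. \<bar>y - x\<bar> < d \<longrightarrow> norm (F y - F x - (y - x) *\<^sub>R f x) \<le> e * \<bar>y - x\<bar>"
      using d by (meson order_trans)
  qed
  ultimately show ?thesis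
    unfolding AE_lborel_iff_negligible F_def[symmetric] by blast
qed

text \<open>The norm of \<open>f\<close> is split into its truncation at level \<open>n\<close> and
  the remainder. For large \<open>n\<close> the remainder has integral below \<open>e / 2\<close>
  over the whole interval, while the truncation is bounded and contributes at most a multiple of the
  total length.\<close>

theorem abs_cont_on_integral:
  fixes f :: "real \<Rightarrow> 'a::euclidean_space"
  assumes f: "f absolutely_integrable_on {a..b}"
  shows "abs_cont_on a b (\<lambda>x. integral {a..x} f)"
  unfolding abs_cont_on_iff
proof (intro allI impI)
  fix e :: real assume e: "e > 0"
  define g where "g n x = min (norm (f x)) (real n)" for n x
  have fi: "f integrable_on {a..b}" and nf: "(\<lambda>x. norm (f x)) absolutely_integrable_on {a..b}"
    using f absolutely_integrable_norm[OF f] by (auto simp: absolutely_integrable_on_def o_def)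
  have gi: "g n integrable_on {a..b}" for n
    unfolding g_def using absolutely_integrable_min_1[OF nf, of "\<lambda>x. real n"]
    by (auto simp: absolutely_integrable_on_def)
  have nfi: "(\<lambda>x. norm (f x)) integrable_on {a..b}"
    using nf by (auto simp: absolutely_integrable_on_def)
  have "(\<lambda>n. integral {a..b} (g n)) \<longlonglongrightarrow> integral {a..b} (\<lambda>x. norm (f x))"
  proof (rule dominated_convergence(2)[OF gi nfi])
    fix x :: real
    show "norm (g n x) \<le> norm (f x)" for n by (simp add: g_def)
    obtain N where "norm (f x) \<le> real N" using real_arch_simple by blast
    then have "\<forall>n\<ge>N. g n x = norm (f x)"
      by (auto simp: g_def min_def intro: order_antisym)
    then show "(\<lambda>n. g n x) \<longlonglongrightarrow> norm (f x)"
      by (intro tendsto_eventually) (auto simp: eventually_sequentially)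
  qed
  then have "\<forall>\<^sub>F n in sequentially. dist (integral {a..b} (g n)) (integral {a..b} (\<lambda>x. norm (f x))) < e / 2"
    using e by (intro tendstoD) auto
  then obtain n where "dist (integral {a..b} (g n)) (integral {a..b} (\<lambda>x. norm (f x))) < e / 2"
    by (auto simp: eventually_sequentially)
  then have n: "integral {a..b} (\<lambda>x. norm (f x) - g n x) < e / 2"
    using integral_diff[OF nfi gi[of n]] by (simp add: dist_real_def abs_real_def split: if_splits)
  define M where "M = real n + 1"
  have M: "M > 0" by (simp add: M_def)
  show "\<exists>\<delta>>0. \<forall>n I. nonoverlapping a b n I \<and> (\<Sum>k<n. snd (I k) - fst (I k)) < \<delta>
      \<longrightarrow> (\<Sum>k<n. norm (integral {a..snd (I k)} f - integral {a..fst (I k)} f)) < e"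
  proof (intro exI[of _ "e / (2 * M)"] conjI allI impI; (elim conjE)?)
    show "e / (2 * M) > 0" using e M by simp
    fix m and I :: "nat \<Rightarrow> real \<times> real"
    assume no: "nonoverlapping a b m I" and small: "(\<Sum>k<m. snd (I k) - fst (I k)) < e / (2 * M)"
    have uv: "a \<le> fst (I k) \<and> fst (I k) \<le> snd (I k) \<and> snd (I k) \<le> b" if "k < m" for k
      using no that by (simp add: nonoverlapping_def)
    have "norm (integral {a..snd (I k)} f - integral {a..fst (I k)} f)
        \<le> integral {fst (I k)..snd (I k)} (\<lambda>x. norm (f x) - g n x) + M * (snd (I k) - fst (I k))"
      if k: "k < m" for k
    proof -
      let ?u = "fst (I k)" and ?v = "snd (I k)"
      have sub: "h integrable_on {?u..?v}" if "h integrable_on {a..b}" for h :: "real \<Rightarrow> 'b::banach"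
        using integrable_subinterval_real[OF that, of ?u ?v] uv[OF k] by auto
      have "integral {a..?v} f - integral {a..?u} f = integral {?u..?v} f"
        using Henstock_Kurzweil_Integration.integral_combine[of a ?u ?v f] uv[OF k]
          integrable_subinterval_real[OF fi, of a ?v] by (simp add: algebra_simps)
      also have "norm \<dots> \<le> integral {?u..?v} (\<lambda>x. (norm (f x) - g n x) + M)"
        by (intro Henstock_Kurzweil_Integration.integral_norm_bound_integral sub fi
              integrable_add integrable_diff nfi gi integrable_const_ivl)
           (simp add: g_def M_def)
      also have "\<dots> = integral {?u..?v} (\<lambda>x. norm (f x) - g n x) + integral {?u..?v} (\<lambda>x. M)"
        by (intro Henstock_Kurzweil_Integration.integral_add sub integrable_diff nfi gi integrable_const_ivl)
      finally show ?thesis using uv[OF k] by (simp add: mult.commute)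
    qed
    then have "(\<Sum>k<m. norm (integral {a..snd (I k)} f - integral {a..fst (I k)} f))
        \<le> (\<Sum>k<m. integral {fst (I k)..snd (I k)} (\<lambda>x. norm (f x) - g n x) + M * (snd (I k) - fst (I k)))"
      by (intro sum_mono) auto
    also have "\<dots> = (\<Sum>k<m. integral {fst (I k)..snd (I k)} (\<lambda>x. norm (f x) - g n x))
        + M * (\<Sum>k<m. snd (I k) - fst (I k))"
      by (simp only: sum.distrib sum_distrib_left)
    also have "\<dots> \<le> integral {a..b} (\<lambda>x. norm (f x) - g n x) + M * (e / (2 * M))"
    proof (intro add_mono sum_integral_nonoverlapping_le mult_left_mono)
      show "{fst (I i)<..<snd (I i)} \<inter> {fst (I j)<..<snd (I j)} = {}"
        if "i \<in> {..<m}" "j \<in> {..<m}" "i \<noteq> j" for i j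
        using no that unfolding nonoverlapping_def by (metis lessThan_iff)
      show "(\<lambda>x. norm (f x) - g n x) integrable_on {a..b}"
        by (intro integrable_diff nfi gi)
    qed (use uv small M in \<open>auto simp: g_def\<close>)
    also have "M * (e / (2 * M)) = e / 2" using M by simp
    finally show "(\<Sum>k<m. norm (integral {a..snd (I k)} f - integral {a..fst (I k)} f)) < e"
      using n by simp
  qed
qed

section \<open>Caratheodory solutions of the second-order equation\<close>

lemma abs_cont_on_nonpos_derivative:
  fixes f :: "real \<Rightarrow> real"
  assumes ac: "abs_cont_on a b f"
    and der: "AE x in lborel. x \<in> {a..b} \<longrightarrow> (f has_vector_derivative f' x) (at x within {a..b})"
    and np: "AE x in lborel. x \<in> {a..b} \<longrightarrow> f' x \<le> 0"
    and x: "x \<in> {a..b}"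
  shows "f x \<le> f a"
proof -
  have sub: "{a..x} \<subseteq> {a..b}" using x by auto
  \<comment> \<open>\<open>min 0 (f' t)\<close> agrees with \<open>f' t\<close> almost everywhere
    and is nonpositive at every point, as the comparison of integrals requires.\<close>
  have "AE t in lborel. t \<in> {a..x} \<longrightarrow> (f has_vector_derivative min 0 (f' t)) (at t within {a..x})"
    using der np
  proof eventually_elim
    case (elim t)
    then show ?case
      using sub by (auto simp: min_def intro: has_vector_derivative_within_subset)
  qed
  then have "((\<lambda>t. min 0 (f' t)) has_integral (f x - f a)) {a..x}"
    using x abs_cont_on_subinterval[OF ac, of a x] by (intro abs_cont_on_has_integral_derivative) auto
  then have "f x - f a \<le> 0"
    using has_integral_le[of "\<lambda>t. min 0 (f' t)" "f x - f a" "{a..x}" "\<lambda>t. 0" 0] by (auto simp: has_integral_0)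
  then show ?thesis by simp
qed

lemma exp_lipschitz:
  fixes s t :: real
  assumes "s \<le> M" "t \<le> M"
  shows "\<bar>exp s - exp t\<bar> \<le> exp M * \<bar>s - t\<bar>"
proof (rule field_differentiable_bound[of "{..M}" exp exp "exp M" s t, unfolded real_norm_def])
  show "(exp has_field_derivative exp z) (at z within {..M})" for z :: real
    by (auto intro!: derivative_eq_intros)
qed (use assms in auto)

text \<open>The integrating factor \<open>exp (- K x)\<close> makes its product with
  \<open>R\<close> nonincreasing. It is absolutely continuous because \<open>K\<close> is bounded
  and \<open>exp\<close> is Lipschitz below any bound.\<close>

lemma abs_cont_on_gronwall:
  fixes R k :: "real \<Rightarrow> real"
  assumes ac: "abs_cont_on a b R" and k: "k absolutely_integrable_on {a..b}"
    and der: "AE x in lborel. x \<in> {a..b} \<longrightarrow> (R has_vector_derivative R' x) (at x within {a..b})"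
    and le: "AE x in lborel. x \<in> {a..b} \<longrightarrow> R' x \<le> k x * R x"
    and x: "x \<in> {a..b}"
  shows "R x \<le> R a * exp (integral {a..x} k)"
proof -
  define K where "K x = integral {a..x} k" for x
  have ki: "k integrable_on {a..b}" using k by (auto simp: absolutely_integrable_on_def)
  have Kac: "abs_cont_on a b K"
    unfolding K_def by (rule abs_cont_on_integral[OF k])
  have Kder: "AE x in lborel. x \<in> {a..b} \<longrightarrow> (K has_vector_derivative k x) (at x within {a..b})"
    unfolding K_def by (rule lebesgue_differentiation[OF ki])
  obtain M where M: "\<And>x. x \<in> {a..b} \<Longrightarrow> norm (K x) \<le> M"
    using continuous_on_Icc_bound[OF abs_cont_on_imp_continuous_on[OF Kac]] by metis
  define E where "E x = exp (- K x)" for x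
  have Eac: "abs_cont_on a b E"
    unfolding E_def
  proof (rule abs_cont_on_compose_lipschitz[OF Kac, where M = "exp M"])
    fix u v assume "u \<in> {a..b}" "v \<in> {a..b}"
    then have "- K v \<le> M" "- K u \<le> M" using M[of u] M[of v] by auto
    from exp_lipschitz[OF this] show "norm (exp (- K v) - exp (- K u)) \<le> exp M * norm (K v - K u)"
      by (simp add: abs_minus_commute)
  qed
  have "R x * E x \<le> R a * E a"
  proof (rule abs_cont_on_nonpos_derivative[OF abs_cont_on_mult[OF ac Eac] _ _ x])
    show "AE x in lborel. x \<in> {a..b} \<longrightarrow>
      ((\<lambda>x. R x * E x) has_vector_derivative (R' x - k x * R x) * E x) (at x within {a..b})"
      using der Kder
    proof eventually_elim
      case (elim t)
      show ?case
      proof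
        assume t: "t \<in> {a..b}"
        have R: "(R has_field_derivative R' t) (at t within {a..b})"
          and K: "(K has_field_derivative k t) (at t within {a..b})"
          using elim t by (auto simp: has_real_derivative_iff_has_vector_derivative)
        have "((\<lambda>x. R x * E x) has_field_derivative (R' t - k t * R t) * E t) (at t within {a..b})"
          unfolding E_def using R K by (auto intro!: derivative_eq_intros simp: algebra_simps)
        then show "((\<lambda>x. R x * E x) has_vector_derivative (R' t - k t * R t) * E t) (at t within {a..b})"
          by (simp add: has_real_derivative_iff_has_vector_derivative)
      qed
    qed
    show "AE x in lborel. x \<in> {a..b} \<longrightarrow> (R' x - k x * R x) * E x \<le> 0"
      using le by eventually_elim (auto simp: E_def mult_le_0_iff)
  qed
  then show ?thesis
    by (simp add: E_def K_def exp_minus field_simps)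
qed

text \<open>Caratheodory solutions of \<open>y'' = p y\<close>, with \<open>y1\<close> as the
  derivative. The whole potential is one complex function, so conjugation, reflection and a change
  of the spectral parameter are all changes of \<open>p\<close>. Absolute continuity of
  \<open>y\<close> follows, since \<open>y1\<close> is continuous.\<close>

definition sol :: "real \<Rightarrow> real \<Rightarrow> (real \<Rightarrow> complex) \<Rightarrow> (real \<Rightarrow> complex) \<Rightarrow> (real \<Rightarrow> complex) \<Rightarrow> bool" where
  "sol a b p y y1 \<longleftrightarrow> abs_cont_on a b y1 \<and>
     (\<forall>x\<in>{a..b}. (y has_vector_derivative y1 x) (at x within {a..b})) \<and>
     (AE x in lborel. x \<in> {a..b} \<longrightarrow> (y1 has_vector_derivative p x * y x) (at x within {a..b}))"

lemma abs_cont_on_C1: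
  fixes y :: "real \<Rightarrow> 'a::real_normed_vector"
  assumes "\<And>x. x \<in> {a..b} \<Longrightarrow> (y has_vector_derivative y1 x) (at x within {a..b})"
    and "continuous_on {a..b} y1"
  shows "abs_cont_on a b y"
proof -
  obtain M where M: "\<And>x. x \<in> {a..b} \<Longrightarrow> norm (y1 x) \<le> M"
    using continuous_on_Icc_bound[OF assms(2)] by metis
  show ?thesis
  proof (rule abs_cont_on_lipschitz[where M = M])
    fix u v assume uv: "a \<le> u" "u \<le> v" "v \<le> b"
    have "norm (y v - y u) \<le> M * norm (v - u)"
    proof (rule differentiable_bound[of "{a..b}" y "\<lambda>x h. h *\<^sub>R y1 x"])
      fix x assume x: "x \<in> {a..b}"
      show "(y has_derivative (\<lambda>h. h *\<^sub>R y1 x)) (at x within {a..b})"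
        using assms(1)[OF x] by (simp add: has_vector_derivative_def)
      show "onorm (\<lambda>h. h *\<^sub>R y1 x) \<le> M"
      proof (rule onorm_bound)
        show "0 \<le> M" using M[OF x] norm_ge_zero[of "y1 x"] by linarith
        show "norm (h *\<^sub>R y1 x) \<le> M * norm h" for h :: real
          using mult_right_mono[OF M[OF x], of "\<bar>h\<bar>"] by (simp add: mult.commute)
      qed
    qed (use uv in auto)
    then show "norm (y v - y u) \<le> M * (v - u)" using uv by simp
  qed
qed

lemma solD:
  assumes "sol a b p y y1"
  shows "abs_cont_on a b y1" "abs_cont_on a b y" "continuous_on {a..b} y" "continuous_on {a..b} y1"
    "\<And>x. x \<in> {a..b} \<Longrightarrow> (y has_vector_derivative y1 x) (at x within {a..b})"
    "AE x in lborel. x \<in> {a..b} \<longrightarrow> (y1 has_vector_derivative p x * y x) (at x within {a..b})"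
proof -
  show 1: "abs_cont_on a b y1"
    and 2: "\<And>x. x \<in> {a..b} \<Longrightarrow> (y has_vector_derivative y1 x) (at x within {a..b})"
    and "AE x in lborel. x \<in> {a..b} \<longrightarrow> (y1 has_vector_derivative p x * y x) (at x within {a..b})"
    using assms by (auto simp: sol_def)
  show 3: "continuous_on {a..b} y1" using 1 by (rule abs_cont_on_imp_continuous_on)
  show 4: "abs_cont_on a b y" using 2 3 by (rule abs_cont_on_C1)
  show "continuous_on {a..b} y" using 4 by (rule abs_cont_on_imp_continuous_on)
qed

text \<open>\<open>L\<close> is linear over the reals, so this covers conjugation as well as complex
  multiples; the new potential \<open>r\<close> records how \<open>L\<close> passes through
  multiplication by \<open>p\<close>.\<close>

lemma sol_linear:
  assumes "sol a b p y y1" "bounded_linear L"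
    and "AE x in lborel. x \<in> {a..b} \<longrightarrow> L (p x * y x) = r x * L (y x)"
  shows "sol a b r (\<lambda>x. L (y x)) (\<lambda>x. L (y1 x))"
proof -
  note S = solD[OF assms(1)]
  have "AE x in lborel. x \<in> {a..b} \<longrightarrow> ((\<lambda>x. L (y1 x)) has_vector_derivative r x * L (y x)) (at x within {a..b})"
    using S(6) assms(3)
    by eventually_elim (metis bounded_linear.has_vector_derivative[OF assms(2)])
  then show ?thesis
    unfolding sol_def
    using S(1,5) assms(2) by (auto intro: abs_cont_on_linear bounded_linear.has_vector_derivative)
qed

lemma sol_mult: "sol a b p y y1 \<Longrightarrow> sol a b p (\<lambda>x. c * y x) (\<lambda>x. c * y1 x)"
  by (rule sol_linear[where L = "\<lambda>z. c * z"]) (auto intro: bounded_linear_mult_right)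

lemma sol_cnj: "sol a b p y y1 \<Longrightarrow> sol a b (\<lambda>x. cnj (p x)) (\<lambda>x. cnj (y x)) (\<lambda>x. cnj (y1 x))"
  by (rule sol_linear[where L = cnj]) (auto intro: bounded_linear_cnj)

lemma sol_add:
  assumes "sol a b p y y1" "sol a b p z z1"
  shows "sol a b p (\<lambda>x. y x + z x) (\<lambda>x. y1 x + z1 x)"
proof -
  note S = solD[OF assms(1)] and T = solD[OF assms(2)]
  have "AE x in lborel. x \<in> {a..b} \<longrightarrow> ((\<lambda>x. y1 x + z1 x) has_vector_derivative p x * (y x + z x)) (at x within {a..b})"
    using S(6) T(6) by eventually_elim (auto simp: distrib_left intro: has_vector_derivative_add)
  then show ?thesis
    unfolding sol_def using S T by (auto intro: abs_cont_on_add has_vector_derivative_add)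
qed

lemma sol_cong_potential:
  assumes "sol a b p y y1" "AE x in lborel. x \<in> {a..b} \<longrightarrow> p x = r x"
  shows "sol a b r y y1"
proof -
  have "AE x in lborel. x \<in> {a..b} \<longrightarrow> (y1 has_vector_derivative r x * y x) (at x within {a..b})"
    using solD(6)[OF assms(1)] assms(2) by eventually_elim auto
  then show ?thesis using assms(1) by (simp add: sol_def)
qed

lemma sol_subinterval:
  assumes "sol a b p y y1" "a \<le> c" "d \<le> b"
  shows "sol c d p y y1"
proof -
  have sub: "{c..d} \<subseteq> {a..b}" using assms by auto
  note S = solD[OF assms(1)]
  have "AE x in lborel. x \<in> {c..d} \<longrightarrow> (y1 has_vector_derivative p x * y x) (at x within {c..d})"
    using S(6)
    by eventually_elim (use sub in \<open>blast intro: has_vector_derivative_within_subset[OF _ sub]\<close>)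
  then show ?thesis
    unfolding sol_def
    using abs_cont_on_subinterval[OF S(1) assms(2,3)] S(5) sub
    by (blast intro: has_vector_derivative_within_subset[OF _ sub])
qed

lemma has_vector_derivative_reflect:
  assumes "(f has_vector_derivative f') (at (- x) within {a..b})"
  shows "((\<lambda>t. f (- t)) has_vector_derivative - f') (at x within {-b..-a})"
proof -
  have im: "uminus ` {- b..- a} = {a..b}"
    by (simp add: image_uminus_atLeastAtMost)
  have "(uminus has_vector_derivative (-1::real)) (at x within {-b..-a})"
    by (auto intro!: derivative_eq_intros)
  from vector_diff_chain_within[OF this, of f f'] assms show ?thesis
    by (simp add: im o_def)
qed

lemma AE_lborel_reflect:
  fixes P :: "real \<Rightarrow> bool"
  assumes "AE x in lborel. P x"
  shows "AE x in lborel. P (- x)"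
proof -
  obtain N where N: "negligible N" "\<And>x. x \<notin> N \<Longrightarrow> P x"
    using assms unfolding AE_lborel_iff_negligible by blast
  have "negligible (uminus ` N)"
    using N(1) by (intro negligible_differentiable_image_negligible) (auto intro!: derivative_intros)
  moreover have "P (- x)" if "x \<notin> uminus ` N" for x
    using that by (intro N(2)) force
  ultimately show ?thesis unfolding AE_lborel_iff_negligible by blast
qed

text \<open>Two differentiations of \<open>y (- x)\<close> restore the sign, so in the potential
  only the argument changes, while the first derivative is negated.\<close>

lemma sol_reflect:
  assumes "sol a b p y y1"
  shows "sol (-b) (-a) (\<lambda>x. p (- x)) (\<lambda>x. y (- x)) (\<lambda>x. - y1 (- x))"
  unfolding sol_def
proof (intro conjI ballI)
  note S = solD[OF assms]
  show "abs_cont_on (-b) (-a) (\<lambda>x. - y1 (- x))"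
    by (intro abs_cont_on_minus abs_cont_on_reflect S)
  show "((\<lambda>x. y (- x)) has_vector_derivative - y1 (- x)) (at x within {-b..-a})" if "x \<in> {-b..-a}" for x
    using that by (intro has_vector_derivative_reflect S) auto
  show "AE x in lborel. x \<in> {-b..-a} \<longrightarrow>
      ((\<lambda>x. - y1 (- x)) has_vector_derivative p (- x) * y (- x)) (at x within {-b..-a})"
    using AE_lborel_reflect[OF S(6)]
  proof eventually_elim
    case (elim x)
    show ?case
    proof
      assume "x \<in> {-b..-a}"
      then have "(y1 has_vector_derivative p (-x) * y (-x)) (at (-x) within {a..b})"
        using elim by auto
      from has_vector_derivative_minus[OF has_vector_derivative_reflect[OF this]]
      show "((\<lambda>x. - y1 (- x)) has_vector_derivative p (- x) * y (- x)) (at x within {-b..-a})"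
        by simp
    qed
  qed
qed

text \<open>Gronwall's inequality for the squared distance of \<open>(y, y1)\<close> from
  \<open>(z, z1)\<close>. Taking \<open>\<delta> = 0\<close> gives uniqueness; taking
  \<open>\<delta>\<close> to be the change of the spectral parameter gives continuous
  dependence.\<close>

lemma sol_stability:
  assumes y: "sol a b p y y1" and z: "sol a b r z z1"
    and init: "y a = z a" "y1 a = z1 a"
    and M: "\<And>x. x \<in> {a..b} \<Longrightarrow> norm (z x) \<le> M"
    and m: "m absolutely_integrable_on {a..b}" "\<And>x. x \<in> {a..b} \<Longrightarrow> norm (p x) \<le> m x"
    and k: "k absolutely_integrable_on {a..b}" "\<And>x. x \<in> {a..b} \<Longrightarrow> k x \<ge> 0"
    and \<delta>: "\<delta> \<ge> 0" "\<And>x. x \<in> {a..b} \<Longrightarrow> norm (p x - r x) \<le> \<delta> * k x"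
    and x: "x \<in> {a..b}"
  shows "(norm (y x - z x))\<^sup>2 + (norm (y1 x - z1 x))\<^sup>2
    \<le> \<delta> * M\<^sup>2 * exp (integral {a..x} (\<lambda>t. 1 + m t + (1 + \<delta>) * k t))"
proof -
  note Y = solD[OF y] and Z = solD[OF z]
  define d where "d x = y x - z x" for x
  define d1 where "d1 x = y1 x - z1 x" for x
  \<comment> \<open>The constant offset absorbs the inhomogeneous term \<open>(p - r) z\<close>, so
    that \<open>R\<close> obeys a homogeneous differential inequality.\<close>
  define R where "R x = d x \<bullet> d x + d1 x \<bullet> d1 x + \<delta> * M\<^sup>2" for x
  define h where "h x = p x * d x + (p x - r x) * z x" for x
  have dac: "abs_cont_on a b d" "abs_cont_on a b d1"
    unfolding d_def d1_def by (intro abs_cont_on_diff Y Z)+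
  have Rac: "abs_cont_on a b R"
    unfolding R_def
    by (intro abs_cont_on_add abs_cont_on_const abs_cont_on_bilinear[OF bounded_bilinear_inner] dac)
  have dder: "(d has_vector_derivative d1 x) (at x within {a..b})" if "x \<in> {a..b}" for x
    unfolding d_def d1_def using that by (intro has_vector_derivative_diff Y Z)
  have d1der: "AE x in lborel. x \<in> {a..b} \<longrightarrow> (d1 has_vector_derivative h x) (at x within {a..b})"
    using Y(6) Z(6)
  proof eventually_elim
    case (elim t)
    show ?case
    proof
      assume "t \<in> {a..b}"
      then have "(d1 has_vector_derivative p t * y t - r t * z t) (at t within {a..b})"
        unfolding d1_def using elim by (intro has_vector_derivative_diff) auto
      moreover have "p t * y t - r t * z t = h t" by (simp add: h_def d_def algebra_simps)
      ultimately show "(d1 has_vector_derivative h t) (at t within {a..b})" by simp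
    qed
  qed
  have Rder: "AE x in lborel. x \<in> {a..b} \<longrightarrow>
    (R has_vector_derivative 2 * (d x \<bullet> d1 x) + 2 * (d1 x \<bullet> h x)) (at x within {a..b})"
    using d1der
  proof eventually_elim
    case (elim t)
    show ?case
    proof
      assume t: "t \<in> {a..b}"
      note D = bounded_bilinear.has_vector_derivative[OF bounded_bilinear_inner]
      have "(R has_vector_derivative (d t \<bullet> d1 t + d1 t \<bullet> d t) + (d1 t \<bullet> h t + h t \<bullet> d1 t) + 0) (at t within {a..b})"
        unfolding R_def using elim t dder[OF t]
        by (intro has_vector_derivative_add D has_vector_derivative_const) auto
      then show "(R has_vector_derivative 2 * (d t \<bullet> d1 t) + 2 * (d1 t \<bullet> h t)) (at t within {a..b})"
        by (simp add: inner_commute)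
    qed
  qed
  have bnd: "2 * (d t \<bullet> d1 t) + 2 * (d1 t \<bullet> h t) \<le> (1 + m t + (1 + \<delta>) * k t) * R t" if t: "t \<in> {a..b}" for t
  proof -
    define A where "A = norm (d t)"
    define B where "B = norm (d1 t)"
    have AB: "A \<ge> 0" "B \<ge> 0" by (auto simp: A_def B_def)
    have M0: "M \<ge> 0" using M[OF t] norm_ge_zero order_trans by blast
    have m0: "m t \<ge> 0" using m(2)[OF t] norm_ge_zero[of "p t"] by linarith
    have AM: "2 * (u * v) \<le> u\<^sup>2 + v\<^sup>2" for u v :: real
      using sum_squares_bound[of u v] by (simp add: mult.assoc)
    have "norm (h t) \<le> m t * A + (\<delta> * k t) * M"
      unfolding h_def A_def
      using m(2)[OF t] \<delta>(2)[OF t] M[OF t] m0 M0 \<delta>(1) k(2)[OF t]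
      by (intro norm_triangle_mono) (auto simp: norm_mult intro!: mult_mono)
    then have "d1 t \<bullet> h t \<le> B * (m t * A + (\<delta> * k t) * M)"
      using order_trans[OF norm_cauchy_schwarz mult_left_mono[OF _ norm_ge_zero]] by (simp add: B_def)
    moreover have "d t \<bullet> d1 t \<le> A * B" using norm_cauchy_schwarz[of "d t" "d1 t"] by (simp add: A_def B_def)
    ultimately have "2 * (d t \<bullet> d1 t) + 2 * (d1 t \<bullet> h t)
        \<le> (1 + m t) * (2 * (A * B)) + \<delta> * k t * (2 * (M * B))"
      by (simp add: algebra_simps)
    also have "\<dots> \<le> (1 + m t) * (A\<^sup>2 + B\<^sup>2) + \<delta> * k t * (M\<^sup>2 + B\<^sup>2)"
      using m0 \<delta> k(2)[OF t] by (intro add_mono mult_left_mono AM) auto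
    \<comment> \<open>In the new factor the summand \<open>\<delta> * k t\<close> takes up the term
      in \<open>B\<close>, and the summand \<open>k t\<close>, multiplied by the offset
      \<open>\<delta> * M\<^sup>2\<close>, takes up the term in \<open>M\<close>.\<close>
    also have "\<dots> \<le> (1 + m t + (1 + \<delta>) * k t) * (A\<^sup>2 + B\<^sup>2 + \<delta> * M\<^sup>2)"
    proof -
      have "0 \<le> (1 + m t) * (\<delta> * M\<^sup>2) + k t * (A\<^sup>2 + B\<^sup>2) + \<delta> * k t * A\<^sup>2 + \<delta> * k t * (\<delta> * M\<^sup>2)"
        using m0 \<delta>(1) k(2)[OF t] by (intro add_nonneg_nonneg mult_nonneg_nonneg) auto
      then show ?thesis by (simp add: algebra_simps)
    qed
    also have "A\<^sup>2 + B\<^sup>2 + \<delta> * M\<^sup>2 = R t"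
      by (simp add: R_def A_def B_def power2_norm_eq_inner)
    finally show ?thesis .
  qed
  have "R x \<le> R a * exp (integral {a..x} (\<lambda>t. 1 + m t + (1 + \<delta>) * k t))"
  proof (rule abs_cont_on_gronwall[OF Rac _ Rder _ x])
    show "(\<lambda>t. 1 + m t + (1 + \<delta>) * k t) absolutely_integrable_on {a..b}"
      by (intro set_integral_add set_integrable_mult_right absolutely_integrable_on_const m k) auto
  qed (use bnd in auto)
  moreover have "R a = \<delta> * M\<^sup>2" using init by (simp add: R_def d_def d1_def)
  moreover have "(norm (y x - z x))\<^sup>2 + (norm (y1 x - z1 x))\<^sup>2 \<le> R x"
    using \<delta>(1) by (simp add: R_def d_def d1_def power2_norm_eq_inner)
  ultimately show ?thesis by simp
qed

lemma sol_unique: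
  assumes y: "sol a b p y y1" and z: "sol a b p z z1"
    and init: "y a = z a" "y1 a = z1 a"
    and p: "p absolutely_integrable_on {a..b}" and x: "x \<in> {a..b}"
  shows "y x = z x" "y1 x = z1 x"
proof -
  obtain M where M: "\<And>x. x \<in> {a..b} \<Longrightarrow> norm (z x) \<le> M"
    using continuous_on_Icc_bound[OF solD(3)[OF z]] by metis
  have "(\<lambda>x. norm (p x)) absolutely_integrable_on {a..b}"
    using absolutely_integrable_norm[OF p] by (simp add: o_def)
  then have "(norm (y x - z x))\<^sup>2 + (norm (y1 x - z1 x))\<^sup>2 \<le> 0"
    using sol_stability[OF y z init M, of "\<lambda>x. norm (p x)" "\<lambda>x. 0" 0 x] x by simp
  then show "y x = z x" "y1 x = z1 x"
    by (auto simp: sum_power2_le_zero_iff)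
qed

lemma absolutely_integrable_mult_continuous:
  fixes p :: "real \<Rightarrow> 'a::{euclidean_space, real_normed_algebra}"
  assumes p: "p absolutely_integrable_on {a..b}" and g: "continuous_on {a..b} g"
  shows "(\<lambda>x. p x * g x) absolutely_integrable_on {a..b}"
proof (rule absolutely_integrable_bounded_measurable_product[where h = "\<lambda>x y. y * x"])
  show "bilinear (\<lambda>x y::'a. y * x)"
    using bilinear_conv_bounded_bilinear bounded_bilinear.flip[OF bounded_bilinear_mult] by blast
  show "bounded (g ` {a..b})"
    by (rule compact_imp_bounded[OF compact_continuous_image[OF g compact_Icc]])
qed (use p g in \<open>auto intro: continuous_imp_measurable_on_sets_lebesgue\<close>)

text \<open>Each Picard step integrates such a power, raising the exponent by one and dividing by
  it; this produces the factorial in the estimate.\<close>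

lemma integral_power_indefinite:
  fixes k :: "real \<Rightarrow> real"
  assumes k: "k absolutely_integrable_on {a..b}" and x: "x \<in> {a..b}"
  defines "K \<equiv> \<lambda>x. integral {a..x} k"
  shows "((\<lambda>t. k t * K t ^ n) has_integral K x ^ Suc n / real (Suc n)) {a..x}"
proof -
  have ki: "k integrable_on {a..b}" using k by (auto simp: absolutely_integrable_on_def)
  have sub: "{a..x} \<subseteq> {a..b}" using x by auto
  have ac: "abs_cont_on a b (\<lambda>x. K x ^ n)" for n
  proof (induction n)
    case (Suc n)
    then show ?case
      using abs_cont_on_mult[OF abs_cont_on_integral[OF k] Suc] by (simp add: K_def)
  qed (simp add: abs_cont_on_const)
  have "AE t in lborel. t \<in> {a..x} \<longrightarrow>
      ((\<lambda>t. K t ^ Suc n / real (Suc n)) has_vector_derivative k t * K t ^ n) (at t within {a..x})"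
    using lebesgue_differentiation[OF ki]
  proof eventually_elim
    case (elim t)
    show ?case
    proof
      assume t: "t \<in> {a..x}"
      then have "(K has_real_derivative k t) (at t within {a..x})"
        using elim sub unfolding K_def has_real_derivative_iff_has_vector_derivative
        by (blast intro: has_vector_derivative_within_subset[OF _ sub])
      from DERIV_cdivide[OF DERIV_power_Suc[OF this, of n], of "real (Suc n)"]
      show "((\<lambda>t. K t ^ Suc n / real (Suc n)) has_vector_derivative k t * K t ^ n) (at t within {a..x})"
        by (simp add: has_real_derivative_iff_has_vector_derivative[symmetric])
    qed
  qed
  from abs_cont_on_has_integral_derivative[OF _ _ this]
  show ?thesis
    using x abs_cont_on_subinterval[OF abs_cont_on_linear[OF ac bounded_linear_divide, of "Suc n" "real (Suc n)"], of a x]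
    by (simp add: K_def)
qed

text \<open>Picard iteration for the integrated equation
  \<open>y x = c0 + c1 x + (\<integral>\<^sub>0\<^sup>x (\<integral>\<^sub>0\<^sup>t p y) dt)\<close>;
  consecutive iterates differ by at most \<open>M P\<^sup>n / n!\<close> where \<open>P x = \<integral>\<^sub>0\<^sup>x |p|\<close>.\<close>

lemma sol_exists:
  fixes p :: "real \<Rightarrow> complex"
  assumes p: "p absolutely_integrable_on {0..1}"
  shows "\<exists>y y1. sol 0 1 p y y1 \<and> y 0 = c0 \<and> y1 0 = c1"
proof -
  let ?I = "{0..1::real}"
  define P where "P x = integral {0..x} (\<lambda>t. norm (p t))" for x
  have np: "(\<lambda>t. norm (p t)) absolutely_integrable_on ?I"
    using absolutely_integrable_norm[OF p] by (simp add: o_def)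
  have npi: "(\<lambda>t. norm (p t)) integrable_on {0..x}" if "x \<in> ?I" for x
    using np that integrable_subinterval_real[of "\<lambda>t. norm (p t)" 0 1 0 x] by (auto simp: absolutely_integrable_on_def)
  have Pmono: "P t \<le> P x" if "0 \<le> t" "t \<le> x" "x \<le> 1" for t x
    unfolding P_def using that by (intro integral_subset_le npi) auto
  have P0: "P x \<ge> 0" if "x \<in> ?I" for x
    unfolding P_def by (intro integral_nonneg npi that) auto
  \<comment> \<open>\<open>V g\<close> has zero data at 0, derivative \<open>W g\<close>, and second
    derivative \<open>p g\<close> almost everywhere. The solution is the fixed point of
    \<open>V\<close> plus the affine function of the initial data.\<close>
  define W where "W g t = integral {0..t} (\<lambda>s. p s * g s)" for g t
  define V where "V g x = integral {0..x} (W g)" for g x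
  have pg: "(\<lambda>s. p s * g s) absolutely_integrable_on ?I" if "continuous_on ?I g" for g
    by (rule absolutely_integrable_mult_continuous[OF p that])
  have pgi: "(\<lambda>s. p s * g s) integrable_on {0..x}" if "continuous_on ?I g" "x \<in> ?I" for g x
    using pg[OF that(1)] that(2) integrable_subinterval_real[of "\<lambda>s. p s * g s" 0 1 0 x]
    by (auto simp: absolutely_integrable_on_def)
  have Wac: "abs_cont_on 0 1 (W g)" if "continuous_on ?I g" for g
    unfolding W_def by (rule abs_cont_on_integral[OF pg[OF that]])
  have Wc: "continuous_on ?I (W g)" if "continuous_on ?I g" for g
    by (rule abs_cont_on_imp_continuous_on[OF Wac[OF that]])
  have Wi: "W g integrable_on {0..x}" if "continuous_on ?I g" "x \<in> ?I" for g x
    using that by (intro integrable_continuous_real continuous_on_subset[OF Wc]) auto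
  have Vder: "(V g has_vector_derivative W g x) (at x within ?I)" if "continuous_on ?I g" "x \<in> ?I" for g x
    unfolding V_def by (rule integral_has_vector_derivative[OF Wc[OF that(1)] that(2)])
  have Vc: "continuous_on ?I (V g)" if "continuous_on ?I g" for g
    unfolding V_def by (intro indefinite_integral_continuous_1 Wi that) auto
  have Wdiff: "W g t - W h t = W (\<lambda>x. g x - h x) t" if "continuous_on ?I g" "continuous_on ?I h" "t \<in> ?I" for g h t
    unfolding W_def using pgi that by (simp add: integral_diff[symmetric] right_diff_distrib)
  have Vdiff: "V g t - V h t = V (\<lambda>x. g x - h x) t" if "continuous_on ?I g" "continuous_on ?I h" "t \<in> ?I" for g h t
  proof -
    have "V g t - V h t = integral {0..t} (\<lambda>s. W g s - W h s)"
      unfolding V_def by (intro integral_diff[symmetric] Wi that)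
    also have "\<dots> = V (\<lambda>x. g x - h x) t"
      unfolding V_def using that by (intro integral_cong Wdiff) auto
    finally show ?thesis .
  qed
  have Vbound: "norm (V g x) \<le> B" if g: "continuous_on ?I g" and x: "x \<in> ?I"
    and B: "\<And>s. s \<in> {0..x} \<Longrightarrow> norm (g s) \<le> b s"
      "((\<lambda>s. norm (p s) * b s) has_integral B) {0..x}" for g x b B
  proof -
    have WB: "norm (W g t) \<le> B" if t: "t \<in> {0..x}" for t
    proof -
      have "norm (W g t) \<le> integral {0..t} (\<lambda>s. norm (p s) * b s)"
        unfolding W_def
      proof (rule Henstock_Kurzweil_Integration.integral_norm_bound_integral)
        show "(\<lambda>s. norm (p s) * b s) integrable_on {0..t}"
          using B(2) t integrable_subinterval_real[of "\<lambda>s. norm (p s) * b s" 0 x 0 t] by auto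
        show "norm (p s * g s) \<le> norm (p s) * b s" if "s \<in> {0..t}" for s
          using B(1)[of s] that t by (simp add: norm_mult mult_left_mono)
      qed (use pgi g t x in auto)
      also have "\<dots> \<le> integral {0..x} (\<lambda>s. norm (p s) * b s)"
      proof (rule integral_subset_le)
        show "\<forall>s\<in>{0..x}. 0 \<le> norm (p s) * b s"
        proof
          fix s assume "s \<in> {0..x}"
          from B(1)[OF this] have "0 \<le> b s" using norm_ge_zero[of "g s"] by linarith
          then show "0 \<le> norm (p s) * b s" by simp
        qed
        show "(\<lambda>s. norm (p s) * b s) integrable_on {0..t}"
          using B(2) t integrable_subinterval_real[of "\<lambda>s. norm (p s) * b s" 0 x 0 t] by auto
      qed (use B(2) t in auto)
      also have "\<dots> = B" using B(2) by (rule integral_unique)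
      finally show ?thesis .
    qed
    have "norm (V g x) \<le> integral {0..x} (\<lambda>t. B)"
      unfolding V_def by (intro Henstock_Kurzweil_Integration.integral_norm_bound_integral Wi g x WB) auto
    also have "\<dots> = x * B" using x by simp
    \<comment> \<open>The interval has length at most 1, so the outer integration costs no
      factor.\<close>
    also have "\<dots> \<le> 1 * B"
    proof (rule mult_right_mono)
      have "norm (W g 0) \<le> B" using x by (intro WB) auto
      then show "0 \<le> B" using norm_ge_zero[of "W g 0"] by linarith
    qed (use x in auto)
    finally show ?thesis by simp
  qed
  \<comment> \<open>The iteration starts at the zero function, so the differences telescope to
    \<open>S n\<close> and the first of them is the affine function of the initial data.\<close>
  define S where "S = rec_nat (\<lambda>x. 0) (\<lambda>n g x. c0 + of_real x * c1 + V g x)"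
  have S0: "S 0 = (\<lambda>x. 0)" and SS: "S (Suc n) = (\<lambda>x. c0 + of_real x * c1 + V (S n) x)" for n
    by (simp_all add: S_def)
  have Sc: "continuous_on ?I (S n)" for n
  proof (induction n)
    case (Suc n)
    then show ?case unfolding SS by (intro continuous_intros Vc)
  qed (simp add: S0)
  define M where "M = norm c0 + norm c1"
  have M0: "M \<ge> 0" by (simp add: M_def)
  have step: "norm (S (Suc n) x - S n x) \<le> M * P x ^ n / fact n" if "x \<in> ?I" for n x
    using that
  proof (induction n arbitrary: x)
    case 0
    have "W (\<lambda>x. 0) = (\<lambda>t. 0)" by (simp add: W_def fun_eq_iff)
    then have "V (S 0) x = 0" by (simp add: S0 V_def)
    then have "S (Suc 0) x - S 0 x = c0 + of_real x * c1" by (simp add: SS S0)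
    also have "norm \<dots> \<le> norm c0 + norm (of_real x * c1)" by (rule norm_triangle_ineq)
    also have "norm (of_real x * c1) \<le> 1 * norm c1"
      using 0 unfolding norm_mult by (intro mult_right_mono) auto
    finally show ?case by (simp add: M_def)
  next
    case (Suc n)
    have "S (Suc (Suc n)) x - S (Suc n) x = V (S (Suc n)) x - V (S n) x"
      by (simp add: SS[of "Suc n"] SS[of n])
    also have "\<dots> = V (\<lambda>x. S (Suc n) x - S n x) x" by (intro Vdiff Sc Suc)
    also have "norm \<dots> \<le> M / fact n * (P x ^ Suc n / real (Suc n))"
    proof (rule Vbound)
      show "continuous_on ?I (\<lambda>x. S (Suc n) x - S n x)" by (intro continuous_intros Sc)
      show "norm (S (Suc n) s - S n s) \<le> M / fact n * P s ^ n" if "s \<in> {0..x}" for s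
        using Suc.IH[of s] that Suc.prems by simp
      show "((\<lambda>s. norm (p s) * (M / fact n * P s ^ n)) has_integral M / fact n * (P x ^ Suc n / real (Suc n))) {0..x}"
        using has_integral_mult_right[OF integral_power_indefinite[OF np Suc.prems, of n], of "M / fact n"]
        by (simp add: P_def mult_ac)
    qed (rule Suc.prems)
    also have "\<dots> = M * P x ^ Suc n / fact (Suc n)" by simp
    finally show ?case .
  qed
  have "uniform_limit ?I (\<lambda>n x. \<Sum>i<n. S (Suc i) x - S i x) (\<lambda>x. \<Sum>i. S (Suc i) x - S i x) sequentially"
  proof (rule Weierstrass_m_test)
    show "norm (S (Suc n) x - S n x) \<le> M * (P 1 ^ n /\<^sub>R fact n)" if "x \<in> ?I" for n x
    proof -
      have "norm (S (Suc n) x - S n x) \<le> M * P x ^ n / fact n" by (rule step[OF that])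
      also have "\<dots> \<le> M * P 1 ^ n / fact n"
        using that M0 P0[OF that] Pmono[of x 1] by (intro divide_right_mono mult_left_mono power_mono) auto
      finally show ?thesis by (simp add: divide_inverse mult_ac)
    qed
    show "summable (\<lambda>n. M * (P 1 ^ n /\<^sub>R fact n))"
      by (intro summable_mult summable_exp_generic)
  qed
  then obtain y where "uniform_limit ?I (\<lambda>n x. \<Sum>i<n. S (Suc i) x - S i x) y sequentially" by blast
  moreover have "(\<Sum>i<n. S (Suc i) x - S i x) = S n x" for n x
    using sum_lessThan_telescope[of "\<lambda>i. S i x" n] by (simp add: S0)
  ultimately have lim: "uniform_limit ?I S y sequentially" by simp
  have yc: "continuous_on ?I y"
    by (rule uniform_limit_theorem[OF _ lim]) (auto simp: Sc)
  have yeq: "y x = c0 + of_real x * c1 + V y x" if x: "x \<in> ?I" for x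
  proof -
    have "(\<lambda>n. S n x) \<longlonglongrightarrow> y x" by (rule tendsto_uniform_limitI[OF lim x])
    then have 1: "(\<lambda>n. S (Suc n) x) \<longlonglongrightarrow> y x" by (rule LIMSEQ_Suc)
    have "(\<lambda>n. V (S n) x) \<longlonglongrightarrow> V y x"
    proof (rule tendstoI)
      fix e :: real assume e: "e > 0"
      define e' where "e' = e / (P x + 1)"
      have e': "e' > 0" using e P0[OF x] by (simp add: e'_def)
      show "\<forall>\<^sub>F n in sequentially. dist (V (S n) x) (V y x) < e"
        using uniform_limitD[OF lim e']
      proof eventually_elim
        case (elim n)
        have "dist (V (S n) x) (V y x) = norm (V (\<lambda>t. S n t - y t) x)"
          using Vdiff[OF Sc yc x] by (simp add: dist_norm)
        also have "\<dots> \<le> P x * e'"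
        proof (rule Vbound[OF _ x])
          show "norm (S n s - y s) \<le> e'" if "s \<in> {0..x}" for s
            using elim that x by (fastforce simp: dist_norm intro: less_imp_le)
          show "((\<lambda>s. norm (p s) * e') has_integral P x * e') {0..x}"
            unfolding P_def by (intro has_integral_mult_left integrable_integral npi x)
        qed (intro continuous_intros Sc yc)
        also have "\<dots> < (P x + 1) * e'" using e' by simp
        also have "\<dots> = e" using P0[OF x] by (simp add: e'_def)
        finally show ?case .
      qed
    qed
    then have "(\<lambda>n. S (Suc n) x) \<longlonglongrightarrow> c0 + of_real x * c1 + V y x"
      unfolding SS by (intro tendsto_intros)
    with 1 show ?thesis by (rule LIMSEQ_unique)
  qed
  define y1 where "y1 x = c1 + W y x" for x
  have "sol 0 1 p y y1"
    unfolding sol_def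
  proof (intro conjI ballI)
    show "abs_cont_on 0 1 y1"
      unfolding y1_def by (intro abs_cont_on_add abs_cont_on_const Wac yc)
    fix x assume x: "x \<in> ?I"
    have lin: "((\<lambda>x. c0 + of_real x * c1) has_vector_derivative c1) (at x within ?I)"
      by (auto intro!: derivative_eq_intros simp: scaleR_conv_of_real[symmetric])
    have "((\<lambda>x. (c0 + of_real x * c1) + V y x) has_vector_derivative y1 x) (at x within ?I)"
      unfolding y1_def using has_vector_derivative_add[OF lin Vder[OF yc x]] by simp
    then show "(y has_vector_derivative y1 x) (at x within ?I)"
      by (rule has_vector_derivative_transform[OF x _, rotated]) (simp add: yeq)
  next
    have "(\<lambda>s. p s * y s) integrable_on ?I" using pgi[OF yc, of 1] by simp
    from lebesgue_differentiation[OF this]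
    show "AE x in lborel. x \<in> ?I \<longrightarrow> (y1 has_vector_derivative p x * y x) (at x within ?I)"
    proof eventually_elim
      case (elim x)
      then show ?case
        unfolding y1_def W_def
        using has_vector_derivative_add[OF has_vector_derivative_const] by fastforce
    qed
  qed
  moreover have "y 0 = c0" using yeq[of 0] by (simp add: V_def)
  moreover have "y1 0 = c1" by (simp add: y1_def W_def)
  ultimately show ?thesis by blast
qed

section \<open>Gluing and fundamental solutions\<close>

text \<open>The glued function equals \<open>f (min x c) + g (max x c) - f c\<close>, a combination
  of two compositions with clamping maps.\<close>

lemma abs_cont_on_glue:
  fixes f g :: "real \<Rightarrow> 'a::real_normed_vector"
  assumes f: "abs_cont_on a c f" and g: "abs_cont_on c b g" and eq: "f c = g c" and le: "a \<le> c" "c \<le> b"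
  shows "abs_cont_on a b (\<lambda>x. if x \<le> c then f x else g x)"
proof -
  have "abs_cont_on a b (\<lambda>x. f (min x c))" "abs_cont_on a b (\<lambda>x. g (max x c))"
    by (rule abs_cont_on_compose_clamp[OF f] abs_cont_on_compose_clamp[OF g]; use le in auto)+
  then have "abs_cont_on a b (\<lambda>x. f (min x c) + g (max x c) - f c)"
    by (intro abs_cont_on_diff abs_cont_on_add abs_cont_on_const)
  also have "(\<lambda>x. f (min x c) + g (max x c) - f c) = (\<lambda>x. if x \<le> c then f x else g x)"
    by (auto simp: fun_eq_iff eq min_def max_def)
  finally show ?thesis .
qed

lemma has_vector_derivative_glue:
  assumes x: "x \<in> {a..b}" and le: "a \<le> c" "c \<le> b"
    and f: "x \<le> c \<Longrightarrow> (f has_vector_derivative f') (at x within {a..c})"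
    and g: "c \<le> x \<Longrightarrow> (g has_vector_derivative g') (at x within {c..b})"
    and eq: "f c = g c" "x = c \<Longrightarrow> f' = g'"
  shows "((\<lambda>t. if t \<le> c then f t else g t) has_vector_derivative (if x \<le> c then f' else g')) (at x within {a..b})"
proof -
  have cl: "closure {a..c} \<inter> closure {c..b} = {c}" using le by auto
  have un: "{a..c} \<union> {c} = {a..c}" "{c..b} \<union> {c} = {c..b}" using le by auto
  have "((\<lambda>t. if t \<in> {a..c} then f t else g t) has_vector_derivative (if x \<in> {a..c} then f' else g'))
    (at x within {a..b})"
    by (rule has_vector_derivative_If_within_closures[where S = "{a..c}" and T = "{c..b}"
          and f' = "\<lambda>_. f'" and g' = "\<lambda>_. g'"])
       (unfold cl un, use x le f g eq in auto)
  then have "((\<lambda>t. if t \<in> {a..c} then f t else g t) has_vector_derivative (if x \<le> c then f' else g'))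
    (at x within {a..b})"
    using x by simp
  then show ?thesis
    by (rule has_vector_derivative_transform[OF x, rotated]) auto
qed

text \<open>Matching values and first derivatives suffice: at the junction, both one-sided second
  derivatives, where the equation holds, equal \<open>p c * y c\<close>.\<close>

lemma sol_glue:
  assumes y: "sol a c p y y1" and z: "sol c b p z z1" and eq: "y c = z c" "y1 c = z1 c" and le: "a \<le> c" "c \<le> b"
  shows "sol a b p (\<lambda>x. if x \<le> c then y x else z x) (\<lambda>x. if x \<le> c then y1 x else z1 x)"
  unfolding sol_def
proof (intro conjI ballI)
  note Y = solD[OF y] and Z = solD[OF z]
  show "abs_cont_on a b (\<lambda>x. if x \<le> c then y1 x else z1 x)"
    by (rule abs_cont_on_glue[OF Y(1) Z(1) eq(2) le])
  show "((\<lambda>x. if x \<le> c then y x else z x) has_vector_derivative (if x \<le> c then y1 x else z1 x)) (at x within {a..b})"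
    if x: "x \<in> {a..b}" for x
    using x eq by (intro has_vector_derivative_glue le Y Z) auto
  show "AE x in lborel. x \<in> {a..b} \<longrightarrow> ((\<lambda>x. if x \<le> c then y1 x else z1 x)
      has_vector_derivative p x * (if x \<le> c then y x else z x)) (at x within {a..b})"
    using Y(6) Z(6)
  proof eventually_elim
    case (elim x)
    show ?case
    proof
      assume x: "x \<in> {a..b}"
      have "((\<lambda>x. if x \<le> c then y1 x else z1 x) has_vector_derivative
        (if x \<le> c then p x * y x else p x * z x)) (at x within {a..b})"
        using elim x eq by (intro has_vector_derivative_glue le) auto
      then show "((\<lambda>x. if x \<le> c then y1 x else z1 x)
          has_vector_derivative p x * (if x \<le> c then y x else z x)) (at x within {a..b})"
        by (simp add: if_distrib)
    qed
  qed
qed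

definition pot :: "(real \<Rightarrow> real) \<Rightarrow> (real \<Rightarrow> real) \<Rightarrow> complex \<Rightarrow> real \<Rightarrow> complex" where
  "pot q w l x = of_real (q x) - l * of_real (w x)"

lemma is_eigenvalue_iff_sol:
  "is_eigenvalue q w l \<longleftrightarrow> (\<exists>y y1. sol (-1) 1 (pot q w l) y y1 \<and>
     (\<exists>x\<in>{-1..1}. y x \<noteq> 0) \<and> y (-1) = 0 \<and> y 1 = 0)"
proof
  assume "is_eigenvalue q w l"
  then obtain y y1 y2 where y: "\<exists>x\<in>{-1..1}. y x \<noteq> 0" "abs_cont_on (-1) 1 y1"
      "\<And>x. x\<in>{-1..1} \<Longrightarrow> (y has_vector_derivative y1 x) (at x within {-1..1})"
      "AE x in lborel. x \<in> {-1..1} \<longrightarrow>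
            (y1 has_vector_derivative y2 x) (at x within {-1..1}) \<and>
            - y2 x + complex_of_real (q x) * y x = l * complex_of_real (w x) * y x"
      "y (-1) = 0" "y 1 = 0"
    unfolding is_eigenvalue_def by blast
  have "AE x in lborel. x \<in> {-1..1} \<longrightarrow> (y1 has_vector_derivative pot q w l x * y x) (at x within {-1..1})"
    using y(4)
  proof eventually_elim
    case (elim x)
    show ?case
    proof
      assume "x \<in> {-1..1}"
      with elim have d: "(y1 has_vector_derivative y2 x) (at x within {-1..1})"
        and e: "- y2 x + complex_of_real (q x) * y x = l * complex_of_real (w x) * y x" by auto
      from e have "y2 x = pot q w l x * y x" by (simp add: pot_def algebra_simps)
      with d show "(y1 has_vector_derivative pot q w l x * y x) (at x within {-1..1})" by simp
    qed
  qed
  then have "sol (-1) 1 (pot q w l) y y1" using y(2,3) by (simp add: sol_def)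
  then show "\<exists>y y1. sol (-1) 1 (pot q w l) y y1 \<and> (\<exists>x\<in>{-1..1}. y x \<noteq> 0) \<and> y (-1) = 0 \<and> y 1 = 0"
    using y by blast
next
  assume "\<exists>y y1. sol (-1) 1 (pot q w l) y y1 \<and> (\<exists>x\<in>{-1..1}. y x \<noteq> 0) \<and> y (-1) = 0 \<and> y 1 = 0"
  then obtain y y1 where s: "sol (-1) 1 (pot q w l) y y1"
    and y: "\<exists>x\<in>{-1..1}. y x \<noteq> 0" "y (-1) = 0" "y 1 = 0" by blast
  have "AE x in lborel. x \<in> {-1..1} \<longrightarrow>
            (y1 has_vector_derivative pot q w l x * y x) (at x within {-1..1}) \<and>
            - (pot q w l x * y x) + complex_of_real (q x) * y x = l * complex_of_real (w x) * y x"
    using solD(6)[OF s] by eventually_elim (auto simp: pot_def algebra_simps)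
  then show "is_eigenvalue q w l"
    unfolding is_eigenvalue_def using solD(1,2,5)[OF s] y
    by (intro exI[of _ y] exI[of _ y1] exI[of _ "\<lambda>x. pot q w l x * y x"]) auto
qed

text \<open>Integrates the derivative of \<open>y1 * cnj z\<close>. With \<open>z = y\<close> the
  real part is the energy identity; exchanging two solutions, with the partner conjugated, and
  subtracting gives the Wronskian identity.\<close>

lemma has_integral_sesquilinear:
  assumes y: "sol a b p y y1" and z: "sol a b r z z1" and ab: "a \<le> b"
  shows "((\<lambda>x. y1 x * cnj (z1 x) + p x * y x * cnj (z x)) has_integral (y1 b * cnj (z b) - y1 a * cnj (z a))) {a..b}"
proof (rule abs_cont_on_has_integral_derivative[OF ab])
  note Y = solD[OF y] and Z = solD[OF sol_cnj[OF z]]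
  show "abs_cont_on a b (\<lambda>x. y1 x * cnj (z x))" by (intro abs_cont_on_mult Y Z)
  show "AE x in lborel. x \<in> {a..b} \<longrightarrow> ((\<lambda>x. y1 x * cnj (z x)) has_vector_derivative
      y1 x * cnj (z1 x) + p x * y x * cnj (z x)) (at x within {a..b})"
    using Y(6)
    by eventually_elim (auto intro!: has_vector_derivative_mult Z(5))
qed

lemma has_integral_wronskian:
  assumes y: "sol a b p y y1" and z: "sol a b r z z1" and ab: "a \<le> b"
  shows "((\<lambda>x. (p x - r x) * y x * z x) has_integral
    ((y1 b * z b - y b * z1 b) - (y1 a * z a - y a * z1 a))) {a..b}"
  using has_integral_diff[OF has_integral_sesquilinear[OF y sol_cnj[OF z] ab] has_integral_sesquilinear[OF z sol_cnj[OF y] ab]]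
  by (simp add: algebra_simps)

section \<open>Fundamental solutions on \<open>[0, 1]\<close> and their dependence on the
  parameter\<close>

locale half_problem =
  fixes q w :: "real \<Rightarrow> real"
  assumes q_int: "q absolutely_integrable_on {0..1}" and w_int: "w absolutely_integrable_on {0..1}"
begin

lemma pot_int: "pot q w l absolutely_integrable_on {0..1}"
proof -
  have "(\<lambda>x. complex_of_real (q x)) absolutely_integrable_on {0..1}"
    "(\<lambda>x. complex_of_real (w x)) absolutely_integrable_on {0..1}"
    using absolutely_integrable_linear[OF q_int bounded_linear_of_real]
      absolutely_integrable_linear[OF w_int bounded_linear_of_real] by (simp_all add: o_def)
  then show ?thesis
    unfolding pot_def[abs_def] by (intro set_integral_diff(1) set_integrable_mult_right) auto
qed

text \<open>A solution chosen for each initial datum and paired with its derivative. Keeping the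
  data as arguments lets continuity in the parameter be proved once for \<open>\<phi>\<close>,
  \<open>\<psi>\<close> and their derivatives.\<close>

definition fund :: "complex \<Rightarrow> complex \<Rightarrow> complex \<Rightarrow> (real \<Rightarrow> complex) \<times> (real \<Rightarrow> complex)" where
  "fund c0 c1 l = (SOME Y. sol 0 1 (pot q w l) (fst Y) (snd Y) \<and> fst Y 0 = c0 \<and> snd Y 0 = c1)"

lemma fund: "sol 0 1 (pot q w l) (fst (fund c0 c1 l)) (snd (fund c0 c1 l))"
  "fst (fund c0 c1 l) 0 = c0" "snd (fund c0 c1 l) 0 = c1"
proof -
  have "\<exists>Y. sol 0 1 (pot q w l) (fst Y) (snd Y) \<and> fst Y 0 = c0 \<and> snd Y 0 = c1"
    using sol_exists[OF pot_int, of l c0 c1] by auto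
  from someI_ex[OF this] show "sol 0 1 (pot q w l) (fst (fund c0 c1 l)) (snd (fund c0 c1 l))"
    "fst (fund c0 c1 l) 0 = c0" "snd (fund c0 c1 l) 0 = c1"
    unfolding fund_def[symmetric] by auto
qed

definition "\<phi> l = fst (fund 1 0 l)"
definition "\<phi>1 l = snd (fund 1 0 l)"
definition "\<psi> l = fst (fund 0 1 l)"
definition "\<psi>1 l = snd (fund 0 1 l)"

lemma phi: "sol 0 1 (pot q w l) (\<phi> l) (\<phi>1 l)" "\<phi> l 0 = 1" "\<phi>1 l 0 = 0"
  and psi: "sol 0 1 (pot q w l) (\<psi> l) (\<psi>1 l)" "\<psi> l 0 = 0" "\<psi>1 l 0 = 1"
  by (simp_all add: \<phi>_def \<phi>1_def \<psi>_def \<psi>1_def fund)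

lemma sol_comb: "sol 0 1 (pot q w l) (\<lambda>x. c * \<phi> l x + d * \<psi> l x) (\<lambda>x. c * \<phi>1 l x + d * \<psi>1 l x)"
  by (intro sol_add sol_mult phi psi)

lemma sol_repr:
  assumes "sol 0 1 (pot q w l) y y1" "x \<in> {0..1}"
  shows "y x = y 0 * \<phi> l x + y1 0 * \<psi> l x" "y1 x = y 0 * \<phi>1 l x + y1 0 * \<psi>1 l x"
  using sol_unique[OF assms(1) sol_comb _ _ pot_int assms(2), of "y 0" "y1 0"]
  by (auto simp: phi psi)

lemma wronskian:
  assumes x: "x \<in> {0..1}"
  shows "\<phi> l x * \<psi>1 l x - \<phi>1 l x * \<psi> l x = 1"
proof -
  have "sol 0 x (pot q w l) (\<phi> l) (\<phi>1 l)" "sol 0 x (pot q w l) (\<psi> l) (\<psi>1 l)"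
    using x by (auto intro: sol_subinterval[OF phi(1)] sol_subinterval[OF psi(1)])
  from has_integral_wronskian[OF this] x have
    "((\<lambda>x. 0::complex) has_integral (\<phi>1 l x * \<psi> l x - \<phi> l x * \<psi>1 l x) - (0 - 1)) {0..x}"
    by (simp add: phi psi)
  then have "(\<phi>1 l x * \<psi> l x - \<phi> l x * \<psi>1 l x) - (0 - 1) = 0"
    by (metis has_integral_0_eq)
  then show ?thesis by (simp add: algebra_simps)
qed

lemma pot_cnj: "cnj (pot q w l x) = pot q w (cnj l) x"
  by (simp add: pot_def)

lemma fund_real:
  assumes "l \<in> \<real>" "x \<in> {0..1}"
  shows "\<phi> l x \<in> \<real>" "\<phi>1 l x \<in> \<real>" "\<psi> l x \<in> \<real>" "\<psi>1 l x \<in> \<real>"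
proof -
  have c: "cnj l = l" using assms(1) by (simp add: Reals_cnj_iff)
  have s1: "sol 0 1 (pot q w l) (\<lambda>x. cnj (\<phi> l x)) (\<lambda>x. cnj (\<phi>1 l x))"
    using sol_cnj[OF phi(1)[of l]] by (simp add: pot_cnj c)
  have s2: "sol 0 1 (pot q w l) (\<lambda>x. cnj (\<psi> l x)) (\<lambda>x. cnj (\<psi>1 l x))"
    using sol_cnj[OF psi(1)[of l]] by (simp add: pot_cnj c)
  show "\<phi> l x \<in> \<real>" "\<phi>1 l x \<in> \<real>" "\<psi> l x \<in> \<real>" "\<psi>1 l x \<in> \<real>"
    using sol_repr[OF s1 assms(2)] sol_repr[OF s2 assms(2)]
    by (simp_all add: phi psi Reals_cnj_iff)
qed

text \<open>Stability with \<open>\<delta> = norm (l - l0)\<close> and \<open>k\<close> the modulus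
  of \<open>w\<close>. Distance at most 1 bounds \<open>norm l\<close> by \<open>norm l0 + 1\<close>
  and \<open>1 + \<delta>\<close> by 2, so the constant depends neither on \<open>l\<close> nor on
  \<open>x\<close>.\<close>

lemma fund_stability:
  "\<exists>C\<ge>0. \<forall>l x. norm (l - l0) \<le> 1 \<longrightarrow> x \<in> {0..1} \<longrightarrow>
     (norm (fst (fund c0 c1 l) x - fst (fund c0 c1 l0) x))\<^sup>2
     + (norm (snd (fund c0 c1 l) x - snd (fund c0 c1 l0) x))\<^sup>2 \<le> C * norm (l - l0)"
proof -
  obtain M where M: "\<And>x. x \<in> {0..1} \<Longrightarrow> norm (fst (fund c0 c1 l0) x) \<le> M"
    using continuous_on_Icc_bound[OF solD(3)[OF fund(1)]] by metis
  define m where "m x = \<bar>q x\<bar> + (norm l0 + 1) * \<bar>w x\<bar>" for x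
  have aw: "(\<lambda>x. \<bar>w x\<bar>) absolutely_integrable_on {0..1}" and aq: "(\<lambda>x. \<bar>q x\<bar>) absolutely_integrable_on {0..1}"
    using absolutely_integrable_norm[OF w_int] absolutely_integrable_norm[OF q_int] by (simp_all add: o_def)
  have m: "m absolutely_integrable_on {0..1}"
    unfolding m_def[abs_def] by (intro set_integral_add set_integrable_mult_right aw aq)
  define J where "J = integral {0..1} (\<lambda>t. 1 + m t + 2 * \<bar>w t\<bar>)"
  show ?thesis
  proof (intro exI[of _ "M\<^sup>2 * exp J"] conjI allI impI)
    show "0 \<le> M\<^sup>2 * exp J" by simp
    fix l x assume l: "norm (l - l0) \<le> 1" and x: "x \<in> {0..1::real}"
    define \<delta> where "\<delta> = norm (l - l0)"
    have nl: "norm l \<le> norm l0 + 1" using l norm_triangle_sub[of l l0] by simp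
    have "(norm (fst (fund c0 c1 l) x - fst (fund c0 c1 l0) x))\<^sup>2
      + (norm (snd (fund c0 c1 l) x - snd (fund c0 c1 l0) x))\<^sup>2
      \<le> \<delta> * M\<^sup>2 * exp (integral {0..x} (\<lambda>t. 1 + m t + (1 + \<delta>) * \<bar>w t\<bar>))"
    proof (rule sol_stability[OF fund(1) fund(1) _ _ M m _ aw _ _ _ x])
      fix t :: real
      have "norm (pot q w l t) \<le> norm (complex_of_real (q t)) + norm (l * of_real (w t))"
        unfolding pot_def by (rule norm_triangle_ineq4)
      also have "\<dots> \<le> m t"
        unfolding m_def using nl by (auto simp: norm_mult intro: mult_right_mono)
      finally show "norm (pot q w l t) \<le> m t" .
      have "pot q w l t - pot q w l0 t = (l0 - l) * of_real (w t)" by (simp add: pot_def algebra_simps)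
      then show "norm (pot q w l t - pot q w l0 t) \<le> \<delta> * \<bar>w t\<bar>"
        by (simp add: norm_mult \<delta>_def norm_minus_commute)
    qed (auto simp: fund \<delta>_def)
    also have "\<dots> \<le> \<delta> * M\<^sup>2 * exp J"
    proof (intro mult_left_mono, subst exp_le_cancel_iff)
      have I: "(\<lambda>t. 1 + m t + c * \<bar>w t\<bar>) integrable_on {0..y}" if "y \<in> {0..1}" for y c
      proof -
        have "(\<lambda>t. 1 + m t + c * \<bar>w t\<bar>) absolutely_integrable_on {0..1}"
          by (intro set_integral_add set_integrable_mult_right absolutely_integrable_on_const m aw) auto
        then show ?thesis using that integrable_subinterval_real[of "\<lambda>t. 1 + m t + c * \<bar>w t\<bar>" 0 1 0 y]
          by (auto simp: absolutely_integrable_on_def)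
      qed
      have "integral {0..x} (\<lambda>t. 1 + m t + (1 + \<delta>) * \<bar>w t\<bar>) \<le> integral {0..x} (\<lambda>t. 1 + m t + 2 * \<bar>w t\<bar>)"
        using l by (intro integral_le I x add_mono mult_right_mono) (auto simp: \<delta>_def)
      also have "\<dots> \<le> J"
        unfolding J_def using x by (intro integral_subset_le I) (auto simp: m_def intro!: add_nonneg_nonneg)
      finally show "integral {0..x} (\<lambda>t. 1 + m t + (1 + \<delta>) * \<bar>w t\<bar>) \<le> J" .
    qed (auto simp: \<delta>_def)
    finally show "(norm (fst (fund c0 c1 l) x - fst (fund c0 c1 l0) x))\<^sup>2
      + (norm (snd (fund c0 c1 l) x - snd (fund c0 c1 l0) x))\<^sup>2 \<le> M\<^sup>2 * exp J * norm (l - l0)"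
      by (simp add: \<delta>_def mult_ac)
  qed
qed

text \<open>Continuity is joint because the search for zeros runs over compact sets of pairs of a
  parameter and a point. The difference splits into a change of \<open>l\<close>, estimated
  uniformly in \<open>x\<close>, and a change of \<open>x\<close> at the fixed parameter
  \<open>l0\<close>.\<close>

lemma fund_continuous:
  "continuous_on (UNIV \<times> {0..1}) (\<lambda>(l, x). fst (fund c0 c1 l) x)"
  "continuous_on (UNIV \<times> {0..1}) (\<lambda>(l, x). snd (fund c0 c1 l) x)"
proof -
  have main: "continuous_on (UNIV \<times> {0..1}) (\<lambda>(l, x). f l x)"
    if c: "\<And>l. continuous_on {0..1} (f l)"
      and st: "\<And>l0. \<exists>C\<ge>0. \<forall>l x. norm (l - l0) \<le> 1 \<longrightarrow> x \<in> {0..1} \<longrightarrow> (norm (f l x - f l0 x))\<^sup>2 \<le> C * norm (l - l0)"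
    for f :: "complex \<Rightarrow> real \<Rightarrow> complex"
    unfolding continuous_on_def
  proof (safe)
    fix l0 :: complex and x0 :: real assume x0: "x0 \<in> {0..1}"
    let ?F = "at (l0, x0) within UNIV \<times> {0..1}"
    obtain C where C: "C \<ge> 0" "\<And>l x. norm (l - l0) \<le> 1 \<Longrightarrow> x \<in> {0..1} \<Longrightarrow> (norm (f l x - f l0 x))\<^sup>2 \<le> C * norm (l - l0)"
      using st[of l0] by blast
    have tl: "(fst \<longlongrightarrow> l0) ?F" and tx: "(snd \<longlongrightarrow> x0) ?F"
      by (auto intro!: tendsto_eq_intros)
    have ev: "\<forall>\<^sub>F p in ?F. snd p \<in> {0..1}"
      unfolding eventually_at_filter by (rule always_eventually) auto
    have "((\<lambda>p. f l0 (snd p)) \<longlongrightarrow> f l0 x0) ?F"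
      by (rule continuous_on_tendsto_compose[OF c[of l0] tx x0 ev])
    moreover have "((\<lambda>p. f (fst p) (snd p) - f l0 (snd p)) \<longlongrightarrow> 0) ?F"
    proof (rule Lim_null_comparison)
      have "\<forall>\<^sub>F p in ?F. dist (fst p) l0 < 1" using tl by (rule tendstoD) simp
      then show "\<forall>\<^sub>F p in ?F. norm (f (fst p) (snd p) - f l0 (snd p)) \<le> sqrt (C * norm (fst p - l0))"
        using ev by eventually_elim (rule real_le_rsqrt, rule C(2), auto simp: dist_norm)
      have "((\<lambda>p. sqrt (C * norm (fst p - l0))) \<longlongrightarrow> sqrt (C * norm (l0 - l0))) ?F"
        by (intro tendsto_intros tl)
      then show "((\<lambda>p. sqrt (C * norm (fst p - l0))) \<longlongrightarrow> 0) ?F" by simp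
    qed
    ultimately have "((\<lambda>p. f l0 (snd p) + (f (fst p) (snd p) - f l0 (snd p))) \<longlongrightarrow> f l0 x0 + 0) ?F"
      by (rule tendsto_add)
    then show "((\<lambda>(l, x). f l x) \<longlongrightarrow> f l0 x0) ?F"
      by (simp add: case_prod_unfold)
  qed
  show "continuous_on (UNIV \<times> {0..1}) (\<lambda>(l, x). fst (fund c0 c1 l) x)"
  proof (rule main)
    show "continuous_on {0..1} (fst (fund c0 c1 l))" for l by (rule solD[OF fund(1)])
    show "\<exists>C\<ge>0. \<forall>l x. norm (l - l0) \<le> 1 \<longrightarrow> x \<in> {0..1} \<longrightarrow> (norm (fst (fund c0 c1 l) x - fst (fund c0 c1 l0) x))\<^sup>2 \<le> C * norm (l - l0)" for l0
      using fund_stability[of l0 c0 c1] by (smt (verit) zero_le_power2)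
  qed
  show "continuous_on (UNIV \<times> {0..1}) (\<lambda>(l, x). snd (fund c0 c1 l) x)"
  proof (rule main)
    show "continuous_on {0..1} (snd (fund c0 c1 l))" for l by (rule solD[OF fund(1)])
    show "\<exists>C\<ge>0. \<forall>l x. norm (l - l0) \<le> 1 \<longrightarrow> x \<in> {0..1} \<longrightarrow> (norm (snd (fund c0 c1 l) x - snd (fund c0 c1 l0) x))\<^sup>2 \<le> C * norm (l - l0)" for l0
      using fund_stability[of l0 c0 c1] by (smt (verit) zero_le_power2)
  qed
qed

lemma continuous_on_fund:
  assumes "continuous_on S f" "continuous_on S g" "\<And>x. x \<in> S \<Longrightarrow> g x \<in> {0..1}"
  shows "continuous_on S (\<lambda>x. \<phi> (f x) (g x))" "continuous_on S (\<lambda>x. \<phi>1 (f x) (g x))"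
    "continuous_on S (\<lambda>x. \<psi> (f x) (g x))" "continuous_on S (\<lambda>x. \<psi>1 (f x) (g x))"
proof -
  have pair: "continuous_on S (\<lambda>x. (f x, g x))" "(\<lambda>x. (f x, g x)) ` S \<subseteq> UNIV \<times> {0..1}"
    using assms by (auto intro: continuous_on_Pair)
  show "continuous_on S (\<lambda>x. \<phi> (f x) (g x))" "continuous_on S (\<lambda>x. \<phi>1 (f x) (g x))"
    "continuous_on S (\<lambda>x. \<psi> (f x) (g x))" "continuous_on S (\<lambda>x. \<psi>1 (f x) (g x))"
    using continuous_on_compose2[OF fund_continuous(1) pair] continuous_on_compose2[OF fund_continuous(2) pair]
    by (simp_all add: \<phi>_def \<phi>1_def \<psi>_def \<psi>1_def)
qed

end

section \<open>The spectral hypothesis\<close>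

text \<open>For \<open>pot q w (\<i> * of_real a)\<close> the real part of the potential is
  \<open>q\<close>, so the weight leaves the energy; for a real parameter \<open>s\<close> and unit
  weight it is \<open>q - s\<close>.\<close>

lemma has_integral_energy:
  assumes y: "sol a b p y y1" and ab: "a \<le> b"
  shows "((\<lambda>x. (norm (y1 x))\<^sup>2 + Re (p x) * (norm (y x))\<^sup>2) has_integral (y1 b \<bullet> y b - y1 a \<bullet> y a)) {a..b}"
proof -
  have "Re (y1 x * cnj (y1 x) + p x * y x * cnj (y x)) = (norm (y1 x))\<^sup>2 + Re (p x) * (norm (y x))\<^sup>2" for x
    unfolding cmod_power2 by (simp add: power2_eq_square algebra_simps)
  then show ?thesis
    using has_integral_linear[OF has_integral_sesquilinear[OF y y ab] bounded_linear_Re]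
    by (simp add: o_def inner_complex_def)
qed

lemma sol_Re:
  assumes "sol a b (\<lambda>x. of_real (r x)) y y1"
  shows "abs_cont_on a b (\<lambda>x. Re (y1 x))"
    "\<And>x. x \<in> {a..b} \<Longrightarrow> ((\<lambda>x. Re (y x)) has_vector_derivative Re (y1 x)) (at x within {a..b})"
    "AE x in lborel. x \<in> {a..b} \<longrightarrow> ((\<lambda>x. Re (y1 x)) has_vector_derivative r x * Re (y x)) (at x within {a..b})"
proof -
  note Y = solD[OF assms]
  note L = bounded_linear.has_vector_derivative[OF bounded_linear_Re]
  show "abs_cont_on a b (\<lambda>x. Re (y1 x))" by (rule abs_cont_on_linear[OF Y(1) bounded_linear_Re])
  show "((\<lambda>x. Re (y x)) has_vector_derivative Re (y1 x)) (at x within {a..b})" if "x \<in> {a..b}" for x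
    by (rule L[OF Y(5)[OF that]])
  show "AE x in lborel. x \<in> {a..b} \<longrightarrow> ((\<lambda>x. Re (y1 x)) has_vector_derivative r x * Re (y x)) (at x within {a..b})"
    using Y(6)
  proof eventually_elim
    case (elim x)
    then show ?case using L[of y1 "of_real (r x) * y x"] by auto
  qed
qed

text \<open>Jacobi's identity: with a positive solution \<open>t\<close> the quadratic form becomes the square of
  \<open>s' - (t'/t) s\<close> up to boundary terms.\<close>

lemma has_integral_picone:
  fixes t t1 q :: "real \<Rightarrow> real" and s s1 :: "real \<Rightarrow> complex"
  assumes ab: "a \<le> b" and t1: "abs_cont_on a b t1"
    and t: "\<And>x. x \<in> {a..b} \<Longrightarrow> (t has_vector_derivative t1 x) (at x within {a..b})"
    and tq: "AE x in lborel. x \<in> {a..b} \<longrightarrow> (t1 has_vector_derivative q x * t x) (at x within {a..b})"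
    and pos: "\<And>x. x \<in> {a..b} \<Longrightarrow> t x > 0"
    and s: "\<And>x. x \<in> {a..b} \<Longrightarrow> (s has_vector_derivative s1 x) (at x within {a..b})"
    and s1: "continuous_on {a..b} s1"
  defines "k \<equiv> \<lambda>x. (norm (s1 x - (t1 x / t x) *\<^sub>R s x))\<^sup>2"
  shows "((\<lambda>x. (norm (s1 x))\<^sup>2 + q x * (norm (s x))\<^sup>2) has_integral
      integral {a..b} k + (t1 b / t b * (norm (s b))\<^sup>2 - t1 a / t a * (norm (s a))\<^sup>2)) {a..b}"
    and "continuous_on {a..b} k"
proof -
  have t1c: "continuous_on {a..b} t1" by (rule abs_cont_on_imp_continuous_on[OF t1])
  have tc: "continuous_on {a..b} t"
    by (rule abs_cont_on_imp_continuous_on[OF abs_cont_on_C1[OF t t1c]])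
  have sac: "abs_cont_on a b s" by (rule abs_cont_on_C1[OF s s1])
  have sc: "continuous_on {a..b} s" by (rule abs_cont_on_imp_continuous_on[OF sac])
  have ne: "t x \<noteq> 0" if "x \<in> {a..b}" for x using pos[OF that] by simp
  show kc: "continuous_on {a..b} k"
    unfolding k_def by (intro continuous_intros s1 t1c tc sc) (use ne in blast)
  define i where "i x = inverse (t x)" for x
  have ider: "(i has_vector_derivative - t1 x * (i x)\<^sup>2) (at x within {a..b})" if x: "x \<in> {a..b}" for x
    unfolding i_def has_real_derivative_iff_has_vector_derivative[symmetric]
    using t[OF x] ne[OF x] unfolding has_real_derivative_iff_has_vector_derivative[symmetric]
    by (auto intro!: derivative_eq_intros simp: power2_eq_square)
  have iac: "abs_cont_on a b i"
    by (rule abs_cont_on_C1[OF ider]) (auto simp: i_def ne intro!: continuous_intros tc t1c)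
  \<comment> \<open>The integrand is the derivative of the boundary expression
    \<open>t1 * i * (s \<bullet> s)\<close>: the equation for \<open>t1\<close> supplies the term in
    \<open>q\<close>, and the other terms complete the square \<open>k\<close>.\<close>
  have "((\<lambda>x. (norm (s1 x))\<^sup>2 + q x * (norm (s x))\<^sup>2 - k x) has_integral
     (t1 b * i b * (s b \<bullet> s b) - t1 a * i a * (s a \<bullet> s a))) {a..b}"
  proof (rule abs_cont_on_has_integral_derivative[OF ab])
    show "abs_cont_on a b (\<lambda>x. t1 x * i x * (s x \<bullet> s x))"
      by (intro abs_cont_on_mult t1 iac abs_cont_on_bilinear[OF bounded_bilinear_inner] sac)
    show "AE x in lborel. x \<in> {a..b} \<longrightarrow> ((\<lambda>x. t1 x * i x * (s x \<bullet> s x)) has_vector_derivative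
       (norm (s1 x))\<^sup>2 + q x * (norm (s x))\<^sup>2 - k x) (at x within {a..b})"
      using tq
    proof eventually_elim
      case (elim x)
      show ?case
      proof
        assume x: "x \<in> {a..b}"
        have "((\<lambda>x. t1 x * i x * (s x \<bullet> s x)) has_vector_derivative
          t1 x * i x * (s x \<bullet> s1 x + s1 x \<bullet> s x) + (t1 x * (- t1 x * (i x)\<^sup>2) + q x * t x * i x) * (s x \<bullet> s x)) (at x within {a..b})"
          using elim x
          by (intro has_vector_derivative_mult bounded_bilinear.has_vector_derivative[OF bounded_bilinear_inner] ider s) auto
        moreover have "t1 x * i x * (s x \<bullet> s1 x + s1 x \<bullet> s x) + (t1 x * (- t1 x * (i x)\<^sup>2) + q x * t x * i x) * (s x \<bullet> s x)
          = (norm (s1 x))\<^sup>2 + q x * (norm (s x))\<^sup>2 - k x"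
          using ne[OF x] unfolding k_def i_def power2_norm_eq_inner
          by (simp add: inner_diff_left inner_diff_right inner_commute divide_inverse power2_eq_square algebra_simps)
        ultimately show "((\<lambda>x. t1 x * i x * (s x \<bullet> s x)) has_vector_derivative
          (norm (s1 x))\<^sup>2 + q x * (norm (s x))\<^sup>2 - k x) (at x within {a..b})" by simp
      qed
    qed
  qed
  from has_integral_add[OF this integrable_integral[OF integrable_continuous_real[OF kc]]]
  show "((\<lambda>x. (norm (s1 x))\<^sup>2 + q x * (norm (s x))\<^sup>2) has_integral
      integral {a..b} k + (t1 b / t b * (norm (s b))\<^sup>2 - t1 a / t a * (norm (s a))\<^sup>2)) {a..b}"
    by (simp add: i_def divide_inverse power2_norm_eq_inner add.commute)
qed

text \<open>The left half of the eigenfunction is \<open>L (y (- x))\<close>. Reflection negates the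
  first derivative, so a smooth junction at 0 asks \<open>L\<close> to fix \<open>y 0\<close> and to
  negate \<open>y1 0\<close>. The identity and negation give even and odd eigenfunctions;
  \<open>cnj\<close> serves for imaginary parameters.\<close>

lemma (in half_problem) eigenvalue_from_half:
  assumes y: "sol 0 1 (pot q w l) y y1" "y 1 = 0" "\<exists>x\<in>{0..1}. y x \<noteq> 0"
    and L: "bounded_linear L" "L (y 0) = y 0" "L (y1 0) = - y1 0"
    and p: "AE x in lborel. x \<in> {0..1} \<longrightarrow> (\<forall>z. L (pot q w l x * z) = pot q w l (- x) * L z)"
  shows "is_eigenvalue q w l"
proof -
  have "sol 0 1 (\<lambda>x. pot q w l (- x)) (\<lambda>x. L (y x)) (\<lambda>x. L (y1 x))"
    by (rule sol_linear[OF y(1) L(1)]) (use p in eventually_elim, auto)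
  from sol_reflect[OF this]
  have "sol (-1) 0 (pot q w l) (\<lambda>x. L (y (- x))) (\<lambda>x. - L (y1 (- x)))" by simp
  from sol_glue[OF this y(1)]
  have "sol (-1) 1 (pot q w l) (\<lambda>x. if x \<le> 0 then L (y (- x)) else y x) (\<lambda>x. if x \<le> 0 then - L (y1 (- x)) else y1 x)"
    by (simp add: L)
  moreover have "\<exists>x\<in>{-1..1}. (if x \<le> 0 then L (y (- x)) else y x) \<noteq> 0"
  proof -
    obtain x where "x \<in> {0..1}" "y x \<noteq> 0" using y(3) by blast
    then show ?thesis using L(2) by (intro bexI[of _ x]) auto
  qed
  moreover have "L 0 = 0" using L(1) by (simp add: linear_0 bounded_linear.linear)
  ultimately show ?thesis
    unfolding is_eigenvalue_iff_sol using y(2) by force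
qed

section \<open>Unit weight: even and odd eigenfunctions on the half interval\<close>

locale even_problem = half_problem q "\<lambda>_. 1" for q +
  assumes q_even: "AE x in lborel. x \<in> {-1..1} \<longrightarrow> q (- x) = q x"
    and one_neg: "\<exists>\<mu>. is_eigenvalue q (\<lambda>t. 1) \<mu> \<and> \<mu> \<in> \<real> \<and> Re \<mu> < 0 \<and>
                    (\<forall>l. is_eigenvalue q (\<lambda>t. 1) l \<and> l \<noteq> \<mu> \<longrightarrow> l \<in> \<real> \<and> Re l > 0)"
begin

lemma eig_phi:
  assumes "\<phi> l 1 = 0" shows "is_eigenvalue q (\<lambda>_. 1) l"
proof (rule eigenvalue_from_half[OF phi(1) assms, where L = "\<lambda>x. x"])
  show "\<exists>x\<in>{0..1}. \<phi> l x \<noteq> 0" using phi(2)[of l] by (intro bexI[of _ 0]) auto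
  show "AE x in lborel. x \<in> {0..1} \<longrightarrow> (\<forall>z. pot q (\<lambda>_. 1) l x * z = pot q (\<lambda>_. 1) l (- x) * z)"
    using q_even by eventually_elim (auto simp: pot_def)
qed (auto simp: phi)

lemma eig_psi:
  assumes "\<psi> l 1 = 0" shows "is_eigenvalue q (\<lambda>_. 1) l"
proof (rule eigenvalue_from_half[OF psi(1) assms, where L = uminus])
  show "\<exists>x\<in>{0..1}. \<psi> l x \<noteq> 0"
  proof (rule ccontr)
    assume "\<not> ?thesis"
    then have "\<psi>1 l 0 = 0"
      by (intro has_vector_derivative_zero_on[OF solD(5)[OF psi(1)]]) auto
    then show False by (simp add: psi)
  qed
  show "AE x in lborel. x \<in> {0..1} \<longrightarrow> (\<forall>z. - (pot q (\<lambda>_. 1) l x * z) = pot q (\<lambda>_. 1) l (- x) * - z)"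
    using q_even by eventually_elim (auto simp: pot_def)
qed (auto simp: psi bounded_linear_minus[OF bounded_linear_ident])

text \<open>By evenness of \<open>q\<close> the reflected eigenfunction solves the same equation on
  \<open>[0, 1]\<close>. Adding and subtracting the two boundary conditions isolates the even part
  \<open>y 0 * \<phi> l\<close> and the odd part \<open>y1 0 * \<psi> l\<close> at 1, and the two
  coefficients cannot both vanish.\<close>

lemma eig_half:
  assumes "is_eigenvalue q (\<lambda>_. 1) l"
  shows "\<phi> l 1 = 0 \<or> \<psi> l 1 = 0"
proof (rule ccontr)
  assume A: "\<not> ?thesis"
  obtain y y1 where s: "sol (-1) 1 (pot q (\<lambda>_. 1) l) y y1"
    and y: "\<exists>x\<in>{-1..1}. y x \<noteq> 0" "y (-1) = 0" "y 1 = 0"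
    using assms unfolding is_eigenvalue_iff_sol by blast
  have s1: "sol 0 1 (pot q (\<lambda>_. 1) l) y y1" by (rule sol_subinterval[OF s]) auto
  have "sol 0 1 (\<lambda>x. pot q (\<lambda>_. 1) l (- x)) (\<lambda>x. y (- x)) (\<lambda>x. - y1 (- x))"
    using sol_reflect[OF s] by (rule sol_subinterval) auto
  then have s2: "sol 0 1 (pot q (\<lambda>_. 1) l) (\<lambda>x. y (- x)) (\<lambda>x. - y1 (- x))"
    by (rule sol_cong_potential) (use q_even in eventually_elim, auto simp: pot_def)
  have e1: "y x = y 0 * \<phi> l x + y1 0 * \<psi> l x" if "x \<in> {0..1}" for x
    by (rule sol_repr(1)[OF s1 that])
  have e2: "y (- x) = y 0 * \<phi> l x - y1 0 * \<psi> l x" if "x \<in> {0..1}" for x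
    using sol_repr(1)[OF s2 that] by simp
  have "y 0 * \<phi> l 1 + y1 0 * \<psi> l 1 = 0" "y 0 * \<phi> l 1 - y1 0 * \<psi> l 1 = 0"
    using e1[of 1] e2[of 1] y by auto
  then have "2 * (y 0 * \<phi> l 1) = 0" "2 * (y1 0 * \<psi> l 1) = 0"
    by (simp_all add: algebra_simps)
  then have z: "y 0 = 0" "y1 0 = 0" using A by auto
  obtain x where x: "x \<in> {-1..1}" "y x \<noteq> 0" using y(1) by blast
  then show False using e1[of x] e2[of "- x"] z by (cases "x \<ge> 0") auto
qed

text \<open>All eigenvalues other than the negative one are positive; applied with
  \<open>s = s'\<close>, this also excludes the eigenvalue 0.\<close>

lemma nonpos_eigenvalue_unique:
  assumes "is_eigenvalue q (\<lambda>_. 1) (of_real s)" "is_eigenvalue q (\<lambda>_. 1) (of_real s')" "s \<le> 0" "s' \<le> 0"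
  shows "s = s'" "s < 0"
proof -
  obtain \<mu> where \<mu>: "Re \<mu> < 0" "\<And>l. is_eigenvalue q (\<lambda>t. 1) l \<Longrightarrow> l \<noteq> \<mu> \<Longrightarrow> Re l > 0"
    using one_neg by blast
  have "of_real s = \<mu>" "of_real s' = \<mu>"
    using \<mu>(2)[OF assms(1)] \<mu>(2)[OF assms(2)] assms(3,4) by force+
  then show "s = s'" "s < 0" using \<mu>(1) by (metis Re_complex_of_real)+
qed

text \<open>The energy on \<open>[0, c]\<close> vanishes, since both boundary terms do; the
  condition at 0 holds for \<open>\<phi>\<close> and \<open>\<psi>\<close> alike. By a
  one-dimensional Sobolev bound, \<open>q\<close> cannot balance the positive terms once
  \<open>s \<le> - C\<close>, uniformly in \<open>c\<close>.\<close>

lemma no_zero_if_very_negative: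
  "\<exists>C>0. \<forall>s u u1 c. s \<le> - C \<longrightarrow> sol 0 1 (pot q (\<lambda>_. 1) (of_real s)) u u1 \<longrightarrow> u1 0 \<bullet> u 0 = 0 \<longrightarrow>
     c \<in> {0<..1} \<longrightarrow> u c = 0 \<longrightarrow> (\<forall>x\<in>{0..c}. u x = 0)"
proof -
  have aq: "(\<lambda>x. \<bar>q x\<bar>) absolutely_integrable_on {0..1}"
    using absolutely_integrable_norm[OF q_int] by (simp add: o_def)
  \<comment> \<open>The excess of 1 over the integral of \<open>\<bar>q\<bar>\<close> leaves the
    margin \<open>E / \<eta>\<close> that forces \<open>E = 0\<close>.\<close>
  define \<eta> where "\<eta> = integral {0..1} (\<lambda>x. \<bar>q x\<bar>) + 1"
  have aqi: "(\<lambda>x. \<bar>q x\<bar>) integrable_on {0..c}" if "c \<in> {0..1}" for c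
    using aq that integrable_subinterval_real[of "\<lambda>x. \<bar>q x\<bar>" 0 1 0 c] by (auto simp: absolutely_integrable_on_def)
  have "integral {0..1} (\<lambda>x. \<bar>q x\<bar>) \<ge> 0" by (intro integral_nonneg aqi) auto
  then have \<eta>: "\<eta> > 0" by (simp add: \<eta>_def)
  show ?thesis
  proof (intro exI[of _ "\<eta>\<^sup>2"] conjI allI impI ballI)
    show "\<eta>\<^sup>2 > 0" using \<eta> by simp
    fix s :: real and u u1 :: "real \<Rightarrow> complex" and c x :: real
    assume s: "s \<le> - \<eta>\<^sup>2" and u: "sol 0 1 (pot q (\<lambda>_. 1) (of_real s)) u u1" and u0: "u1 0 \<bullet> u 0 = 0"
      and c: "c \<in> {0<..1}" and uc: "u c = 0" and x: "x \<in> {0..c}"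
    have U: "sol 0 c (pot q (\<lambda>_. 1) (of_real s)) u u1"
      by (rule sol_subinterval[OF u]) (use c in auto)
    note S = solD[OF U]
    define E where "E = integral {0..c} (\<lambda>x. (norm (u1 x))\<^sup>2 + \<eta>\<^sup>2 * (norm (u x))\<^sup>2)"
    have ci: "(\<lambda>x. (norm (u1 x))\<^sup>2 + \<eta>\<^sup>2 * (norm (u x))\<^sup>2) integrable_on {d..c}" if "d \<in> {0..c}" for d
      by (intro integrable_continuous_real continuous_intros continuous_on_subset[OF S(3)] continuous_on_subset[OF S(4)])
         (use that in auto)
    \<comment> \<open>Since \<open>u c = 0\<close>, the left side is the integral of
      \<open>- \<eta>\<close> times the derivative of \<open>|u|^2\<close> over
      \<open>[x, c]\<close>; expanding \<open>|u1 + \<eta> u|^2 \<ge> 0\<close> bounds that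
      integrand.\<close>
    have bound: "\<eta> * (norm (u x))\<^sup>2 \<le> E" if x: "x \<in> {0..c}" for x
    proof -
      have sub: "{x..c} \<subseteq> {0..c}" using x by auto
      have "((\<lambda>t. \<eta> * (u t \<bullet> u1 t + u1 t \<bullet> u t)) has_integral \<eta> * (u c \<bullet> u c) - \<eta> * (u x \<bullet> u x)) {x..c}"
      proof (rule fundamental_theorem_of_calculus)
        fix t assume "t \<in> {x..c}"
        then have "(u has_vector_derivative u1 t) (at t within {x..c})"
          using S(5)[of t] sub by (blast intro: has_vector_derivative_within_subset[OF _ sub])
        then show "((\<lambda>t. \<eta> * (u t \<bullet> u t)) has_vector_derivative \<eta> * (u t \<bullet> u1 t + u1 t \<bullet> u t)) (at t within {x..c})"
          by (intro has_vector_derivative_mult_right bounded_bilinear.has_vector_derivative[OF bounded_bilinear_inner])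
      qed (use x in auto)
      from has_integral_neg[OF this]
      have "((\<lambda>t. - (\<eta> * (u t \<bullet> u1 t + u1 t \<bullet> u t))) has_integral \<eta> * (norm (u x))\<^sup>2) {x..c}"
        by (simp add: uc power2_norm_eq_inner)
      then have "\<eta> * (norm (u x))\<^sup>2 \<le> integral {x..c} (\<lambda>x. (norm (u1 x))\<^sup>2 + \<eta>\<^sup>2 * (norm (u x))\<^sup>2)"
      proof (rule has_integral_le[OF _ integrable_integral[OF ci[OF x]]])
        fix t
        have "0 \<le> (u1 t + \<eta> *\<^sub>R u t) \<bullet> (u1 t + \<eta> *\<^sub>R u t)" by simp
        then show "- (\<eta> * (u t \<bullet> u1 t + u1 t \<bullet> u t)) \<le> (norm (u1 t))\<^sup>2 + \<eta>\<^sup>2 * (norm (u t))\<^sup>2"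
          unfolding power2_norm_eq_inner
          by (simp add: inner_add_left inner_add_right inner_commute power2_eq_square algebra_simps)
      qed
      also have "\<dots> \<le> E"
        unfolding E_def by (intro integral_subset_le sub ci x) (use c in auto)
      finally show ?thesis .
    qed
    have E0: "E \<ge> 0" using bound[OF x] \<eta> by (meson mult_nonneg_nonneg less_imp_le order_trans zero_le_power2)
    have h1: "((\<lambda>x. (norm (u1 x))\<^sup>2 + Re (pot q (\<lambda>_. 1) (of_real s) x) * (norm (u x))\<^sup>2) has_integral 0) {0..c}"
      using has_integral_energy[OF U] c uc u0 by simp
    have h2: "((\<lambda>x. ((norm (u1 x))\<^sup>2 + \<eta>\<^sup>2 * (norm (u x))\<^sup>2) - E / \<eta> * \<bar>q x\<bar>) has_integral
        E - E / \<eta> * integral {0..c} (\<lambda>x. \<bar>q x\<bar>)) {0..c}"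
      unfolding E_def by (intro has_integral_diff has_integral_mult_right integrable_integral ci aqi) (use c in auto)
    have "E - E / \<eta> * integral {0..c} (\<lambda>x. \<bar>q x\<bar>) \<le> 0"
    proof (rule has_integral_le[OF h2 h1])
      fix t assume t: "t \<in> {0..c}"
      have "- (\<bar>q t\<bar> * (E / \<eta>)) \<le> q t * (norm (u t))\<^sup>2"
      proof -
        have "\<bar>q t * (norm (u t))\<^sup>2\<bar> \<le> \<bar>q t\<bar> * (E / \<eta>)"
          unfolding abs_mult using bound[OF t] \<eta> by (intro mult_mono) (auto simp: field_simps)
        then show ?thesis by linarith
      qed
      moreover have "\<eta>\<^sup>2 * (norm (u t))\<^sup>2 \<le> - s * (norm (u t))\<^sup>2"
        using s by (intro mult_right_mono) auto
      ultimately show "((norm (u1 t))\<^sup>2 + \<eta>\<^sup>2 * (norm (u t))\<^sup>2) - E / \<eta> * \<bar>q t\<bar>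
          \<le> (norm (u1 t))\<^sup>2 + Re (pot q (\<lambda>_. 1) (of_real s) t) * (norm (u t))\<^sup>2"
        by (simp add: pot_def algebra_simps)
    qed
    moreover have "E / \<eta> * integral {0..c} (\<lambda>x. \<bar>q x\<bar>) \<le> E / \<eta> * (\<eta> - 1)"
      unfolding \<eta>_def using c E0 \<eta> by (intro mult_left_mono) (auto simp: \<eta>_def intro!: integral_subset_le aqi)
    ultimately have "E / \<eta> \<le> 0" using \<eta> by (simp add: field_simps)
    then have "E = 0" using E0 \<eta> by (simp add: divide_le_0_iff)
    then show "u x = 0" using bound[OF x] \<eta> by (simp add: mult_le_0_iff)
  qed
qed

section \<open>Real fundamental solutions: zeros and signs\<close>

definition "Ph s x = Re (\<phi> (of_real s) x)"
definition "Ph1 s x = Re (\<phi>1 (of_real s) x)"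
definition "Ps s x = Re (\<psi> (of_real s) x)"
definition "Ps1 s x = Re (\<psi>1 (of_real s) x)"

lemma fund_of_real:
  assumes "x \<in> {0..1}"
  shows "\<phi> (of_real s) x = of_real (Ph s x)" "\<phi>1 (of_real s) x = of_real (Ph1 s x)"
    "\<psi> (of_real s) x = of_real (Ps s x)" "\<psi>1 (of_real s) x = of_real (Ps1 s x)"
  using fund_real[OF _ assms, of "of_real s"] by (simp_all add: Ph_def Ph1_def Ps_def Ps1_def)

lemma pot_real: "pot q (\<lambda>_. 1) (of_real s) = (\<lambda>x. of_real (q x - s))"
  by (simp add: pot_def fun_eq_iff)

lemma Ph_sol: "sol 0 1 (\<lambda>x. of_real (q x - s)) (\<phi> (of_real s)) (\<phi>1 (of_real s))"
  and Ps_sol: "sol 0 1 (\<lambda>x. of_real (q x - s)) (\<psi> (of_real s)) (\<psi>1 (of_real s))"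
  using phi(1)[of "of_real s"] psi(1)[of "of_real s"] by (simp_all add: pot_real)

lemma Ph_derivative: "x \<in> {0..1} \<Longrightarrow> (Ph s has_real_derivative Ph1 s x) (at x within {0..1})"
  and Ps_derivative: "x \<in> {0..1} \<Longrightarrow> (Ps s has_real_derivative Ps1 s x) (at x within {0..1})"
  using sol_Re(2)[OF Ph_sol] sol_Re(2)[OF Ps_sol]
  by (simp_all add: Ph_def[abs_def] Ph1_def Ps_def[abs_def] Ps1_def has_real_derivative_iff_has_vector_derivative)

lemma Ph_0: "Ph s 0 = 1" "Ph1 s 0 = 0" "Ps s 0 = 0" "Ps1 s 0 = 1"
  by (simp_all add: Ph_def Ph1_def Ps_def Ps1_def phi psi)

lemma real_wronskian:
  assumes "x \<in> {0..1}" shows "Ph s x * Ps1 s x - Ph1 s x * Ps s x = 1"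
proof -
  have "complex_of_real (Ph s x * Ps1 s x - Ph1 s x * Ps s x) = of_real 1"
    using wronskian[OF assms, of "of_real s"] by (simp add: fund_of_real[OF assms])
  then show ?thesis by (simp only: of_real_eq_iff)
qed

lemma continuous_on_real_fund:
  assumes "continuous_on S f" "continuous_on S g" "\<And>x. x \<in> S \<Longrightarrow> g x \<in> {0..1}"
  shows "continuous_on S (\<lambda>x. Ph (f x) (g x))" "continuous_on S (\<lambda>x. Ph1 (f x) (g x))"
    "continuous_on S (\<lambda>x. Ps (f x) (g x))" "continuous_on S (\<lambda>x. Ps1 (f x) (g x))"
  unfolding Ph_def Ph1_def Ps_def Ps1_def using assms
  by (auto intro!: continuous_on_Re continuous_on_fund continuous_on_of_real)

text \<open>\<open>Ps1 s 0 = 1\<close>, and uniform continuity on the compact rectangle keeps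
  \<open>Ps1\<close> positive on a strip whose width does not depend on \<open>s\<close>. This
  separates the trivial zero at 0 from all others.\<close>

lemma Ps_pos_near_0:
  "\<exists>\<rho>>0. \<rho> < 1 \<and> (\<forall>s\<in>{-C..0}. \<forall>x\<in>{0<..\<rho>}. Ps s x > 0)"
proof -
  let ?K = "{-C..0::real} \<times> {0..1::real}"
  have "continuous_on ?K (\<lambda>p. Ps1 (fst p) (snd p))"
    by (intro continuous_on_real_fund continuous_intros) auto
  then have "uniformly_continuous_on ?K (\<lambda>p. Ps1 (fst p) (snd p))"
    by (intro compact_uniformly_continuous compact_Times compact_Icc)
  then obtain d where d: "d > 0" "\<And>p p'. p \<in> ?K \<Longrightarrow> p' \<in> ?K \<Longrightarrow> dist p' p < d \<Longrightarrow>
      dist (Ps1 (fst p') (snd p')) (Ps1 (fst p) (snd p)) < 1"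
    unfolding uniformly_continuous_on_def by (metis zero_less_one)
  define \<rho> where "\<rho> = min (d / 2) (1 / 2)"
  have \<rho>: "\<rho> > 0" "\<rho> < 1" "\<rho> < d" using d(1) by (auto simp: \<rho>_def)
  have "Ps s x > 0" if s: "s \<in> {-C..0}" and x: "x \<in> {0<..\<rho>}" for s x
  proof -
    have "\<exists>\<xi>\<in>{0<..<x}. Ps s x - Ps s 0 = Ps1 s \<xi> * (x - 0)"
    proof (rule mvt_simple)
      fix t assume "0 \<le> t" "t \<le> x"
      then have t: "t \<in> {0..x}" by simp
      have sub: "{0..x} \<subseteq> {0..1}" using x \<rho> by auto
      have "(Ps s has_real_derivative Ps1 s t) (at t within {0..x})"
        using Ps_derivative[of t s] t sub by (blast intro: DERIV_subset[OF _ sub])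
      then show "(Ps s has_derivative (\<lambda>h. Ps1 s t * h)) (at t within {0..x})"
        by (simp add: has_field_derivative_def)
    qed (use x in auto)
    then obtain \<xi> where \<xi>: "\<xi> \<in> {0<..<x}" "Ps s x = Ps1 s \<xi> * x" by (auto simp: Ph_0)
    have "dist (Ps1 s \<xi>) (Ps1 s 0) < 1"
      using d(2)[of "(s, 0)" "(s, \<xi>)"] s x \<xi> \<rho> by (auto simp: dist_Pair_Pair dist_real_def)
    then have "Ps1 s \<xi> > 0" by (simp add: Ph_0 dist_real_def)
    then show ?thesis using \<xi> x by simp
  qed
  with \<rho> show ?thesis by blast
qed

lemma Ps_not_vanishing:
  assumes "0 < c" "c \<le> 1" shows "\<exists>x\<in>{0<..c}. Ps s x \<noteq> 0"
proof -
  obtain \<rho> where \<rho>: "\<rho> > 0" "\<rho> < 1" "\<forall>s\<in>{-(\<bar>s\<bar>)..0}. \<forall>x\<in>{0<..\<rho>}. Ps s x > 0"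
    using Ps_pos_near_0 by blast
  show ?thesis
  proof (cases "s \<le> 0")
    case True
    then have "Ps s (min \<rho> c) > 0" using \<rho> assms by auto
    then show ?thesis using \<rho> assms by (intro bexI[of _ "min \<rho> c"]) auto
  next
    case False
    show ?thesis
    proof (rule ccontr)
      assume "\<not> ?thesis"
      then have z: "Ps s x = 0" if "x \<in> {0..c}" for x
        using that by (cases "x = 0") (auto simp: Ph_0)
      have sub: "{0..c} \<subseteq> {0..1}" using assms by auto
      have "(Ps s has_vector_derivative Ps1 s 0) (at 0 within {0..c})"
        using Ps_derivative[of 0 s] unfolding has_real_derivative_iff_has_vector_derivative
        by (auto intro: has_vector_derivative_within_subset[OF _ sub])
      then have "Ps1 s 0 = 0"
        by (rule has_vector_derivative_zero_on) (use z assms in auto)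
      then show False by (simp add: Ph_0)
    qed
  qed
qed

lemma pos_if_no_zero:
  fixes f :: "real \<Rightarrow> real"
  assumes f: "continuous_on {a..b} f" and a: "f a > 0" and nz: "\<And>x. x \<in> {a..b} \<Longrightarrow> f x \<noteq> 0"
    and x: "x \<in> {a..b}"
  shows "f x > 0"
proof (rule ccontr)
  assume np: "\<not> f x > 0"
  have "\<exists>z. a \<le> z \<and> z \<le> x \<and> f z = 0"
    by (rule IVT2'[OF _ _ _ continuous_on_subset[OF f]]) (use a x np in auto)
  then show False using nz x by auto
qed

lemma Ps_pos_if_no_zero:
  assumes s: "s \<le> 0" and nz: "\<And>x. x \<in> {0<..1} \<Longrightarrow> Ps s x \<noteq> 0" and x: "x \<in> {0<..1}"
  shows "Ps s x > 0"
proof -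
  obtain \<rho> where \<rho>: "\<rho> > 0" "\<rho> < 1" "\<forall>s'\<in>{s..0}. \<forall>x\<in>{0<..\<rho>}. Ps s' x > 0"
    using Ps_pos_near_0[of "-s"] by auto
  show ?thesis
  proof (cases "x \<le> \<rho>")
    case True
    then show ?thesis using \<rho> s x by auto
  next
    case False
    show ?thesis
      by (rule pos_if_no_zero[of \<rho> 1 "Ps s"])
         (use \<rho> s x nz False in \<open>auto intro!: continuous_on_real_fund continuous_intros\<close>)
  qed
qed

text \<open>If some \<open>Ps s\<close> with \<open>s \<le> 0\<close> had a zero, the least such \<open>s\<close> would be an eigenvalue with odd
  eigenfunction without interior zeros, and the even problem would have a smaller eigenvalue.\<close>

lemma Ps_nonzero:
  assumes s0: "s0 \<le> 0" and x0: "x0 \<in> {0<..1}"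
  shows "Ps s0 x0 \<noteq> 0"
proof
  assume zero: "Ps s0 x0 = 0"
  obtain C0 where C0: "C0 > 0" "\<And>s u u1 c x. s \<le> - C0 \<Longrightarrow> sol 0 1 (pot q (\<lambda>_. 1) (of_real s)) u u1 \<Longrightarrow> u1 0 \<bullet> u 0 = 0 \<Longrightarrow>
     c \<in> {0<..1} \<Longrightarrow> u c = 0 \<Longrightarrow> x \<in> {0..c} \<Longrightarrow> u x = 0"
    using no_zero_if_very_negative by metis
  \<comment> \<open>At \<open>- C\<close> neither \<open>Ps\<close> nor \<open>Ph\<close> has a zero
    on \<open>(0, 1]\<close>, and the range \<open>[- C, 0]\<close> contains
    \<open>s0\<close>.\<close>
  define C where "C = max C0 (- s0)"
  have C: "C > 0" "- C \<le> - C0" "s0 \<in> {-C..0}" using C0(1) s0 by (auto simp: C_def)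
  have Psz: "Ps (- C) c \<noteq> 0" if c: "c \<in> {0<..1}" for c
  proof
    assume "Ps (- C) c = 0"
    then have "\<psi> (of_real (- C)) c = 0" using fund_of_real(3)[of c "-C"] c by simp
    then have "\<psi> (of_real (- C)) x = 0" if "x \<in> {0..c}" for x
      using C0(2)[OF C(2) psi(1) _ c _ that] by (simp add: psi)
    then have "Ps (- C) x = 0" if "x \<in> {0<..c}" for x using that by (simp add: Ps_def)
    then show False using Ps_not_vanishing[of c "-C"] c by auto
  qed
  have Phz: "Ph (- C) c \<noteq> 0" if c: "c \<in> {0..1}" for c
  proof
    assume z: "Ph (- C) c = 0"
    then have c': "c \<in> {0<..1}" using c by (cases "c = 0") (auto simp: Ph_0)
    have "\<phi> (of_real (- C)) c = 0" using fund_of_real(1)[of c "-C"] c z by simp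
    then have "\<phi> (of_real (- C)) 0 = 0"
      using C0(2)[OF C(2) phi(1) _ c', of 0] c by (simp add: phi)
    then show False by (simp add: phi)
  qed
  obtain \<rho> where \<rho>: "\<rho> > 0" "\<rho> < 1" and near: "\<And>s x. s \<in> {-C..0} \<Longrightarrow> x \<in> {0<..\<rho>} \<Longrightarrow> Ps s x > 0"
    using Ps_pos_near_0[of C] by blast
  \<comment> \<open>Restricting to \<open>x \<ge> \<rho>\<close> loses no zero in
    \<open>(0, 1]\<close> and makes the zero set compact, so a least parameter is attained.\<close>
  define Z where "Z = {p \<in> {-C..0} \<times> {\<rho>..1}. Ps (fst p) (snd p) = 0}"
  have inZ: "(s, x) \<in> Z" if "s \<in> {-C..0}" "x \<in> {0<..1}" "Ps s x = 0" for s x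
    using that near[of s x] by (cases "x \<le> \<rho>") (auto simp: Z_def)
  have "compact Z"
    unfolding compact_eq_bounded_closed
  proof
    show "bounded Z"
      by (rule bounded_subset[of "{-C..0} \<times> {\<rho>..1}"]) (auto simp: Z_def intro!: bounded_Times)
    show "closed Z"
      unfolding Z_def using \<rho>
      by (intro continuous_closed_preimage_constant continuous_on_real_fund continuous_intros)
         (auto intro!: closed_Times)
  qed
  moreover have "Z \<noteq> {}" using inZ[OF C(3) x0 zero] by blast
  ultimately obtain p where p: "p \<in> Z" "\<And>p'. p' \<in> Z \<Longrightarrow> fst p \<le> fst p'"
    using continuous_attains_inf[of Z fst] continuous_on_fst[OF continuous_on_id] by metis
  define s where "s = fst p"
  define x where "x = snd p"
  have sx: "s \<in> {-C..0}" "x \<in> {\<rho>..1}" "Ps s x = 0" using p(1) by (auto simp: Z_def s_def x_def)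
  have smin: "s \<le> s'" if "s' \<in> {-C..0}" "x' \<in> {0<..1}" "Ps s' x' = 0" for s' x'
    using p(2)[OF inZ[OF that]] by (simp add: s_def)
  have "s \<noteq> - C" using Psz[of x] sx \<rho> by auto
  then have sC: "- C < s" using sx by auto
  have pos: "Ps s' x' > 0" if s': "s' \<in> {-C..<s}" and x': "x' \<in> {0<..1}" for s' x'
    by (rule Ps_pos_if_no_zero[OF _ _ x']) (use s' sx smin[of s'] in fastforce)+
  \<comment> \<open>\<open>Ps s\<close> is the limit of the positive functions \<open>Ps s'\<close>
    with \<open>s' < s\<close>.\<close>
  have nonneg: "Ps s x' \<ge> 0" if x': "x' \<in> {0..1}" for x'
  proof (cases "x' = 0")
    case False
    have cl: "closure {-C..<s} = {-C..s}" using sC by simp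
    show ?thesis
    proof (rule continuous_ge_on_closure[of "{-C..<s}" "\<lambda>s. Ps s x'"])
      show "continuous_on (closure {- C..<s}) (\<lambda>s. Ps s x')"
        using x' by (intro continuous_on_real_fund continuous_intros)
      show "s \<in> closure {- C..<s}" using cl sC by auto
      show "0 \<le> Ps s' x'" if "s' \<in> {-C..<s}" for s'
        using pos[OF that, of x'] x' False by auto
    qed
  qed (simp add: Ph_0)
  have x01: "x \<in> {0..1}" "0 < x" using sx \<rho> by auto
  \<comment> \<open>An interior zero of a nonnegative function is a minimum, so \<open>Ps s\<close>
    and \<open>Ps1 s\<close> would vanish together, contrary to the Wronskian.\<close>
  have x1: "x = 1"
  proof (rule ccontr)
    assume "x \<noteq> 1"
    then have x: "0 < x" "x < 1" using x01 by auto
    have "at x within {0..1} = at x" using x by (intro at_within_interior) auto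
    then have der: "(Ps s has_real_derivative Ps1 s x) (at x)"
      using Ps_derivative[OF x01(1), of s] by simp
    have "Ps1 s x = 0"
    proof (rule DERIV_local_min[OF der])
      show "0 < min x (1 - x)" using x by simp
      show "\<forall>y. \<bar>x - y\<bar> < min x (1 - x) \<longrightarrow> Ps s x \<le> Ps s y"
      proof (intro allI impI)
        fix y assume "\<bar>x - y\<bar> < min x (1 - x)"
        then have "y \<in> {0..1}" by auto
        from nonneg[OF this] show "Ps s x \<le> Ps s y" using sx(3) by simp
      qed
    qed
    then show False using real_wronskian[OF x01(1), of s] sx(3) by simp
  qed
  \<comment> \<open>\<open>Ps s\<close> comes down to its zero at 1, so \<open>Ps1 s 1\<close> is
    not positive and the Wronskian makes \<open>Ph s 1\<close> negative. As
    \<open>Ph (- C) 1\<close> is positive, \<open>Ph\<close> gives a second eigenvalue below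
    \<open>s\<close>.\<close>
  have w1: "Ph s 1 * Ps1 s 1 = 1" using real_wronskian[of 1 s] sx(3) x1 by simp
  have "\<not> Ps1 s 1 > 0"
  proof
    assume "Ps1 s 1 > 0"
    from has_real_derivative_pos_inc_left[OF Ps_derivative this]
    obtain d where d: "d > 0" "\<And>h. h > 0 \<Longrightarrow> 1 - h \<in> {0..1} \<Longrightarrow> h < d \<Longrightarrow> Ps s (1 - h) < Ps s 1" by auto
    define h where "h = min (d / 2) (1 / 2)"
    have "Ps s (1 - h) < Ps s 1" using d(1) by (intro d(2)) (auto simp: h_def)
    moreover have "Ps s (1 - h) \<ge> 0" using d(1) by (intro nonneg) (auto simp: h_def)
    ultimately show False using sx(3) x1 by simp
  qed
  then have Phneg: "Ph s 1 < 0" using w1 by (metis mult_le_0_iff not_le zero_less_mult_iff zero_less_one less_eq_real_def)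
  have Phpos: "Ph (- C) 1 > 0"
    by (rule pos_if_no_zero[of 0 1 "Ph (- C)"]) (use Phz in \<open>auto simp: Ph_0 intro!: continuous_on_real_fund continuous_intros\<close>)
  have "\<exists>s'. - C \<le> s' \<and> s' \<le> s \<and> Ph s' 1 = 0"
    by (rule IVT2'[OF _ _ _ continuous_on_real_fund(1)]) (use Phneg Phpos sC in \<open>auto intro!: continuous_intros\<close>)
  then obtain s' where s': "s' \<le> s" "Ph s' 1 = 0" by blast
  have "is_eigenvalue q (\<lambda>_. 1) (of_real s')" using s' by (intro eig_phi) (simp add: fund_of_real)
  moreover have "is_eigenvalue q (\<lambda>_. 1) (of_real s)" using sx x1 by (intro eig_psi) (simp add: fund_of_real)
  ultimately have "s' = s" using s' sx by (intro nonpos_eigenvalue_unique(1)) auto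
  then show False using s' Phneg by simp
qed

lemma Ps_pos: "s \<le> 0 \<Longrightarrow> x \<in> {0<..1} \<Longrightarrow> Ps s x > 0"
  using Ps_pos_if_no_zero Ps_nonzero by blast

text \<open>If \<open>Ph 0 1\<close> were positive, so would be \<open>Ph 0\<close> on
  \<open>[0, 1]\<close>, because \<open>Ph / Ps\<close> has derivative \<open>- 1 / Ps^2\<close> on
  \<open>(0, 1]\<close>. Jacobi's identity with \<open>t = Ph 0\<close>, applied to the
  eigenfunction of the negative eigenvalue \<open>m\<close>, would then equate a nonnegative
  integral with \<open>m\<close> times the integral of its squared modulus.\<close>

lemma Ph_0_neg: "Ph 0 1 < 0"
proof (rule ccontr)
  assume "\<not> ?thesis"
  moreover have "Ph 0 1 \<noteq> 0"
  proof
    assume "Ph 0 1 = 0"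
    then have "is_eigenvalue q (\<lambda>_. 1) (of_real 0)" using fund_of_real(1)[of 1 0] by (intro eig_phi) simp
    then show False using nonpos_eigenvalue_unique(2)[of 0 0] by simp
  qed
  ultimately have P1: "Ph 0 1 > 0" by simp
  have pos: "Ph 0 x > 0" if x: "x \<in> {0..1}" for x
  proof (cases "x = 0 \<or> x = 1")
    case False
    then have x: "0 < x" "x < 1" using x by auto
    have "\<exists>\<xi>\<in>{x<..<1}. Ph 0 1 / Ps 0 1 - Ph 0 x / Ps 0 x = (- 1 / (Ps 0 \<xi>)\<^sup>2) * (1 - x)"
    proof (rule mvt_simple)
      fix t assume "x \<le> t" "t \<le> 1"
      then have t: "t \<in> {x..1}" by simp
      have sub: "{x..1} \<subseteq> {0..1}" using x by auto
      have "Ps 0 t \<noteq> 0" using Ps_pos[of 0 t] t x by auto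
      moreover have "(Ps 0 has_real_derivative Ps1 0 t) (at t within {x..1})"
        "(Ph 0 has_real_derivative Ph1 0 t) (at t within {x..1})"
        using Ps_derivative[of t 0] Ph_derivative[of t 0] t sub by (blast intro: DERIV_subset[OF _ sub])+
      moreover have "Ph1 0 t * Ps 0 t - Ph 0 t * Ps1 0 t = - 1"
        using real_wronskian[of t 0] t x by auto
      ultimately have "((\<lambda>x. Ph 0 x / Ps 0 x) has_real_derivative (- 1 / (Ps 0 t)\<^sup>2)) (at t within {x..1})"
        using DERIV_quotient[of "Ph 0" "Ph1 0 t" t "{x..1}" "Ps 0" "Ps1 0 t"]
        by (simp add: power2_eq_square mult.commute)
      then show "((\<lambda>x. Ph 0 x / Ps 0 x) has_derivative (\<lambda>h. - 1 / (Ps 0 t)\<^sup>2 * h)) (at t within {x..1})"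
        unfolding has_field_derivative_def .
    qed (use x in auto)
    then obtain \<xi> where "Ph 0 1 / Ps 0 1 - Ph 0 x / Ps 0 x = (- 1 / (Ps 0 \<xi>)\<^sup>2) * (1 - x)" by blast
    moreover have "(- 1 / (Ps 0 \<xi>)\<^sup>2) * (1 - x) \<le> 0" using x by (intro mult_nonpos_nonneg) auto
    moreover have "Ph 0 1 / Ps 0 1 > 0" using P1 Ps_pos[of 0 1] by simp
    ultimately have "Ph 0 x / Ps 0 x > 0" by linarith
    then show ?thesis using Ps_pos[of 0 x] x by (simp add: zero_less_divide_iff)
  qed (use P1 in \<open>auto simp: Ph_0\<close>)
  obtain \<mu> where \<mu>: "is_eigenvalue q (\<lambda>t. 1) \<mu>" "\<mu> \<in> \<real>" "Re \<mu> < 0"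
    using one_neg by blast
  define m where "m = Re \<mu>"
  have m: "\<mu> = of_real m" "m < 0" using \<mu> by (auto simp: m_def)
  \<comment> \<open>\<open>Ps\<close> has no zero at negative parameters, so the eigenfunction is
    even.\<close>
  have "\<psi> \<mu> 1 \<noteq> 0" using Ps_pos[of m 1] m by (simp add: fund_of_real)
  then have \<phi>1: "\<phi> \<mu> 1 = 0" using eig_half[OF \<mu>(1)] by blast
  have sm: "sol 0 1 (\<lambda>x. of_real (q x - m)) (\<phi> \<mu>) (\<phi>1 \<mu>)"
    using Ph_sol[of m] m by simp
  note S = solD[OF sm]
  note R = sol_Re[OF Ph_sol[of 0]]
  define k where "k x = (norm (\<phi>1 \<mu> x - (Ph1 0 x / Ph 0 x) *\<^sub>R \<phi> \<mu> x))\<^sup>2" for x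
  have kc: "continuous_on {0..1} k"
    and 1: "((\<lambda>x. (norm (\<phi>1 \<mu> x))\<^sup>2 + q x * (norm (\<phi> \<mu> x))\<^sup>2) has_integral
      integral {0..1} k + (Ph1 0 1 / Ph 0 1 * (norm (\<phi> \<mu> 1))\<^sup>2 - Ph1 0 0 / Ph 0 0 * (norm (\<phi> \<mu> 0))\<^sup>2)) {0..1}"
    unfolding k_def[abs_def]
    by (rule has_integral_picone[where t = "Ph 0" and ?t1.0 = "Ph1 0" and a = 0 and b = 1 and q = q and s = "\<phi> \<mu>" and ?s1.0 = "\<phi>1 \<mu>"];
        use R S(4,5) pos in \<open>simp add: Ph_def[abs_def] Ph1_def[abs_def]\<close>)+
  have 2: "((\<lambda>x. (norm (\<phi>1 \<mu> x))\<^sup>2 + (q x - m) * (norm (\<phi> \<mu> x))\<^sup>2) has_integral 0) {0..1}"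
    using has_integral_energy[OF sm] by (simp add: \<phi>1 phi)
  \<comment> \<open>The boundary terms vanish because \<open>\<phi> \<mu> 1 = 0\<close> and
    \<open>Ph1 0 0 = 0\<close>.\<close>
  have "((\<lambda>x. m * (norm (\<phi> \<mu> x))\<^sup>2) has_integral integral {0..1} k) {0..1}"
    using has_integral_diff[OF 1 2] by (simp add: \<phi>1 Ph_0 algebra_simps)
  then have eq: "integral {0..1} k = m * integral {0..1} (\<lambda>x. (norm (\<phi> \<mu> x))\<^sup>2)"
    by (metis integral_mult_right integral_unique)
  have "integral {0..1} k \<ge> 0"
    by (intro integral_nonneg integrable_continuous_real kc) (simp add: k_def)
  moreover have sc: "continuous_on {0..1} (\<lambda>x. (norm (\<phi> \<mu> x))\<^sup>2)" by (intro continuous_intros S(3))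
  then have "integral {0..1} (\<lambda>x. (norm (\<phi> \<mu> x))\<^sup>2) \<ge> 0"
    by (intro integral_nonneg integrable_continuous_real) auto
  ultimately have "integral {0..1} (\<lambda>x. (norm (\<phi> \<mu> x))\<^sup>2) = 0"
    using eq m(2) by (metis mult_less_0_iff not_le order_antisym_conv linorder_not_less)
  then have "(norm (\<phi> \<mu> 0))\<^sup>2 = 0"
    using integral_eq_0_iff[OF sc] by auto
  then show False by (simp add: phi)
qed

text \<open>\<open>Ps 0\<close> vanishes at 0 and so cannot serve in Jacobi's identity on the closed
  interval. A small multiple of \<open>Ph 0\<close>, which is 1 at 0, repairs this without spoiling
  positivity near 1, where \<open>Ph 0\<close> is negative.\<close>

lemma positive_solution:
  "\<exists>t t1. abs_cont_on 0 1 t1 \<and> (\<forall>x\<in>{0..1}. (t has_vector_derivative t1 x) (at x within {0..1}) \<and> t x > 0) \<and>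
    (AE x in lborel. x \<in> {0..1} \<longrightarrow> (t1 has_vector_derivative q x * t x) (at x within {0..1}))"
proof -
  have c: "continuous_on {0..1} (Ph 0)" "continuous_on {0..1} (Ps 0)"
    by (intro continuous_on_real_fund continuous_intros; simp)+
  obtain d where d: "d > 0" "\<And>x. x \<in> {0..1} \<Longrightarrow> dist x 0 < d \<Longrightarrow> dist (Ph 0 x) (Ph 0 0) < 1"
    using c(1) unfolding continuous_on_iff by (metis atLeastAtMost_iff order_refl zero_less_one zero_le_one)
  define \<rho> where "\<rho> = min (d / 2) (1 / 2)"
  have \<rho>: "0 < \<rho>" "\<rho> < 1" "\<rho> < d" using d(1) by (auto simp: \<rho>_def)
  have Phpos: "Ph 0 x > 0" if "x \<in> {0..\<rho>}" for x
    using d(2)[of x] that \<rho> by (auto simp: Ph_0 dist_real_def)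
  have "\<exists>x\<in>{\<rho>..1}. \<forall>y\<in>{\<rho>..1}. Ps 0 x \<le> Ps 0 y"
    using \<rho> by (intro continuous_attains_inf continuous_on_subset[OF c(2)]) auto
  then obtain z where z: "z \<in> {\<rho>..1}" "\<And>y. y \<in> {\<rho>..1} \<Longrightarrow> Ps 0 z \<le> Ps 0 y" by blast
  define m where "m = Ps 0 z"
  have m: "m > 0" unfolding m_def using z \<rho> by (intro Ps_pos) auto
  obtain M where M: "M > 0" "\<And>x. x \<in> {0..1} \<Longrightarrow> norm (Ph 0 x) \<le> M"
    using continuous_on_Icc_bound[OF c(1)] by metis
  \<comment> \<open>\<open>m\<close> is the minimum of \<open>Ps 0\<close> on
    \<open>[\<rho>, 1]\<close> and \<open>M\<close> bounds \<open>\<bar>Ph 0\<bar>\<close>, so the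
    added term costs at most \<open>m / 2\<close> there.\<close>
  define \<epsilon> where "\<epsilon> = m / (2 * M)"
  have \<epsilon>: "\<epsilon> > 0" using m M by (simp add: \<epsilon>_def)
  have pos: "Ps 0 x + \<epsilon> * Ph 0 x > 0" if x: "x \<in> {0..1}" for x
  proof (cases "x \<le> \<rho>")
    case True
    have "Ps 0 x \<ge> 0" using Ps_pos[of 0 x] x by (cases "x = 0") (auto simp: Ph_0)
    moreover have "\<epsilon> * Ph 0 x > 0" using Phpos[of x] True x \<epsilon> by simp
    ultimately show ?thesis by simp
  next
    case False
    have "\<epsilon> * - Ph 0 x \<le> \<epsilon> * M" using M(2)[OF x] \<epsilon> by (intro mult_left_mono) auto
    also have "\<dots> = m / 2" using M(1) by (simp add: \<epsilon>_def)
    finally have "\<epsilon> * Ph 0 x \<ge> - (m / 2)" by simp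
    moreover have "Ps 0 x \<ge> m" using z(2)[of x] False x by (simp add: m_def)
    ultimately show ?thesis using m by linarith
  qed
  note A = sol_Re[OF Ps_sol[of 0], folded Ps_def Ps1_def] and B = sol_Re[OF Ph_sol[of 0], folded Ph_def Ph1_def]
  have "AE x in lborel. x \<in> {0..1} \<longrightarrow>
    ((\<lambda>x. Ps1 0 x + \<epsilon> * Ph1 0 x) has_vector_derivative q x * (Ps 0 x + \<epsilon> * Ph 0 x)) (at x within {0..1})"
    using A(3) B(3)
  proof eventually_elim
    case (elim x)
    show ?case
    proof
      assume "x \<in> {0..1}"
      with elim have "((\<lambda>x. Ps1 0 x + \<epsilon> * Ph1 0 x) has_vector_derivative (q x - 0) * Ps 0 x + \<epsilon> * ((q x - 0) * Ph 0 x)) (at x within {0..1})"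
        by (intro has_vector_derivative_add has_vector_derivative_mult_right) auto
      then show "((\<lambda>x. Ps1 0 x + \<epsilon> * Ph1 0 x) has_vector_derivative q x * (Ps 0 x + \<epsilon> * Ph 0 x)) (at x within {0..1})"
        by (simp add: algebra_simps)
    qed
  qed
  then show ?thesis
    using A(1,2) B(1,2) pos
    by (intro exI[of _ "\<lambda>x. Ps 0 x + \<epsilon> * Ph 0 x"] exI[of _ "\<lambda>x. Ps1 0 x + \<epsilon> * Ph1 0 x"] conjI ballI
          abs_cont_on_add abs_cont_on_mult abs_cont_on_const has_vector_derivative_add has_vector_derivative_mult_right) auto
qed

end

section \<open>At most one conjugate pair\<close>

lemma continuous_on_AE_zero:
  fixes f :: "real \<Rightarrow> 'a::real_normed_vector"
  assumes f: "continuous_on {a..b} f" and ae: "AE x in lborel. x \<in> {a..b} \<longrightarrow> f x = 0"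
    and "a < b" "x \<in> {a..b}"
  shows "f x = 0"
proof -
  obtain N where N: "negligible N" "\<And>x. x \<notin> N \<Longrightarrow> x \<in> {a..b} \<Longrightarrow> f x = 0"
    using ae unfolding AE_lborel_iff_negligible by blast
  have "((\<lambda>x. norm (f x)) has_integral 0) {a..b}"
    by (rule has_integral_spike[OF N(1) _ has_integral_0]) (use N(2) in auto)
  moreover have "continuous_on {a..b} (\<lambda>x. norm (f x))" by (intro continuous_intros f)
  ultimately show ?thesis
    using integral_eq_0_iff[of a b "\<lambda>x. norm (f x)"] assms by (auto dest: integral_unique)
qed

lemma is_eigenvalue_cnj:
  assumes "is_eigenvalue q w l" shows "is_eigenvalue q w (cnj l)"
proof -
  obtain y y1 where y: "sol (-1) 1 (pot q w l) y y1" "\<exists>x\<in>{-1..1}. y x \<noteq> 0" "y (-1) = 0" "y 1 = 0"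
    using assms unfolding is_eigenvalue_iff_sol by blast
  have "sol (-1) 1 (pot q w (cnj l)) (\<lambda>x. cnj (y x)) (\<lambda>x. cnj (y1 x))"
    using sol_cnj[OF y(1)] by (simp add: pot_def[abs_def])
  then show ?thesis unfolding is_eigenvalue_iff_sol using y by fastforce
qed

text \<open>Cancels \<open>w\<close> between the two integrated equations without separating the integrals.\<close>

lemma neutral_pair:
  assumes y: "sol a b (pot q w l) y y1" and z: "sol a b (pot q w m) z z1" and ab: "a \<le> b"
    and bc: "y a = 0" "y b = 0" "z a = 0" "z b = 0" and lm: "l \<noteq> cnj m"
  shows "((\<lambda>x. y1 x * cnj (z1 x) + of_real (q x) * y x * cnj (z x)) has_integral 0) {a..b}"
proof -
  have 1: "((\<lambda>x. y1 x * cnj (z1 x) + pot q w l x * y x * cnj (z x)) has_integral 0) {a..b}"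
    using has_integral_sesquilinear[OF y z ab] bc by simp
  have "((\<lambda>x. z1 x * cnj (y1 x) + pot q w m x * z x * cnj (y x)) has_integral 0) {a..b}"
    using has_integral_sesquilinear[OF z y ab] bc by simp
  from has_integral_linear[OF this bounded_linear_cnj]
  have 2: "((\<lambda>x. y1 x * cnj (z1 x) + pot q w (cnj m) x * y x * cnj (z x)) has_integral 0) {a..b}"
    by (simp add: o_def pot_def mult_ac)
  have ne: "cnj m - l \<noteq> 0" using lm by auto
  \<comment> \<open>The weights come from
    \<open>cnj m * (q - l w) - l * (q - cnj m w) = (cnj m - l) * q\<close>.\<close>
  have "((\<lambda>x. (cnj m * (y1 x * cnj (z1 x) + pot q w l x * y x * cnj (z x))
      - l * (y1 x * cnj (z1 x) + pot q w (cnj m) x * y x * cnj (z x))) / (cnj m - l)) has_integral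
      (cnj m * 0 - l * 0) / (cnj m - l)) {a..b}"
    by (intro has_integral_divide has_integral_diff has_integral_mult_right 1 2)
  moreover have "(cnj m * (y1 x * cnj (z1 x) + pot q w l x * y x * cnj (z x))
      - l * (y1 x * cnj (z1 x) + pot q w (cnj m) x * y x * cnj (z x))) / (cnj m - l)
    = y1 x * cnj (z1 x) + of_real (q x) * y x * cnj (z x)" for x
  proof -
    have "cnj m * (y1 x * cnj (z1 x) + pot q w l x * y x * cnj (z x))
      - l * (y1 x * cnj (z1 x) + pot q w (cnj m) x * y x * cnj (z x))
      = (y1 x * cnj (z1 x) + of_real (q x) * y x * cnj (z x)) * (cnj m - l)"
      by (simp add: pot_def algebra_simps)
    then show ?thesis using ne by simp
  qed
  ultimately show ?thesis by simp
qed

context even_problem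
begin

text \<open>In Jacobi's identity with the positive solution \<open>t\<close>, the boundary terms
  vanish with \<open>s\<close>. If the integral is zero, then \<open>s / t\<close> has zero
  derivative, and \<open>s 0 = 0\<close> makes it zero.\<close>

lemma energy_nonneg:
  fixes s s1 :: "real \<Rightarrow> complex"
  assumes s: "\<And>x. x \<in> {0..1} \<Longrightarrow> (s has_vector_derivative s1 x) (at x within {0..1})"
    and s1: "continuous_on {0..1} s1" and bc: "s 0 = 0" "s 1 = 0"
  shows "\<exists>E\<ge>0. ((\<lambda>x. (norm (s1 x))\<^sup>2 + q x * (norm (s x))\<^sup>2) has_integral E) {0..1} \<and>
    (E = 0 \<longrightarrow> (\<forall>x\<in>{0..1}. s x = 0))"
proof -
  obtain t t1 where t1: "abs_cont_on 0 1 t1"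
    and t: "\<And>x. x \<in> {0..1} \<Longrightarrow> (t has_vector_derivative t1 x) (at x within {0..1})"
    and pos: "\<And>x. x \<in> {0..1} \<Longrightarrow> t x > 0"
    and tq: "AE x in lborel. x \<in> {0..1} \<longrightarrow> (t1 has_vector_derivative q x * t x) (at x within {0..1})"
    using positive_solution by blast
  define k where "k x = (norm (s1 x - (t1 x / t x) *\<^sub>R s x))\<^sup>2" for x
  note P = has_integral_picone[OF zero_le_one t1 t tq pos s s1, folded k_def]
  have kint: "((\<lambda>x. (norm (s1 x))\<^sup>2 + q x * (norm (s x))\<^sup>2) has_integral integral {0..1} k) {0..1}"
    using P(1) bc by simp
  have knn: "k x \<ge> 0" for x by (simp add: k_def)
  then have "integral {0..1} k \<ge> 0"
    by (intro integral_nonneg integrable_continuous_real P(2))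
  moreover have "s x = 0" if k0: "integral {0..1} k = 0" and x: "x \<in> {0..1}" for x
  proof -
    have kz: "k x = 0" if "x \<in> {0..1}" for x
      using integral_eq_0_iff[OF P(2)] knn k0 that by auto
    have der: "((\<lambda>x. inverse (t x) *\<^sub>R s x) has_vector_derivative 0) (at x within {0..1})" if x: "x \<in> {0..1}" for x
    proof -
      have ne: "t x \<noteq> 0" using pos[OF x] by simp
      have "s1 x = (t1 x / t x) *\<^sub>R s x" using kz[OF x] by (simp add: k_def)
      moreover have "((\<lambda>x. inverse (t x)) has_real_derivative - (inverse (t x) * t1 x * inverse (t x))) (at x within {0..1})"
        using t[OF x] by (intro DERIV_inverse' ne) (simp add: has_real_derivative_iff_has_vector_derivative)
      from has_vector_derivative_scaleR[OF this s[OF x]]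
      have "((\<lambda>x. inverse (t x) *\<^sub>R s x) has_vector_derivative
        inverse (t x) *\<^sub>R s1 x + (- (inverse (t x) * t1 x * inverse (t x))) *\<^sub>R s x) (at x within {0..1})" .
      ultimately show ?thesis by (simp add: divide_inverse mult_ac)
    qed
    obtain c where c: "\<And>x. x \<in> {0..1} \<Longrightarrow> inverse (t x) *\<^sub>R s x = c"
      using has_vector_derivative_zero_constant[OF _ der] by auto
    have "c = 0" using c[of 0] bc by simp
    then show "s x = 0" using c[OF x] pos[OF x] by auto
  qed
  ultimately show ?thesis using kint by blast
qed

text \<open>Once the neutral combination is known to vanish, the two equations leave
  \<open>(l - m) w A y = 0\<close>. So \<open>A y\<close> and then \<open>B z\<close> vanish,
  against the choice of nontrivial coefficients and eigenfunctions.\<close>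

lemma nonreal_eigenvalues_conjugate:
  assumes w: "AE x in lborel. x \<in> {-1..1} \<longrightarrow> w x \<noteq> 0"
    and l: "is_eigenvalue q w l" "l \<notin> \<real>" and m: "is_eigenvalue q w m" "m \<notin> \<real>" and lm: "l \<noteq> m"
  shows "l = cnj m"
proof (rule ccontr)
  assume lcm: "l \<noteq> cnj m"
  obtain y y1 where y: "sol (-1) 1 (pot q w l) y y1" "\<exists>x\<in>{-1..1}. y x \<noteq> 0" "y (-1) = 0" "y 1 = 0"
    using l unfolding is_eigenvalue_iff_sol by blast
  obtain z z1 where z: "sol (-1) 1 (pot q w m) z z1" "\<exists>x\<in>{-1..1}. z x \<noteq> 0" "z (-1) = 0" "z 1 = 0"
    using m unfolding is_eigenvalue_iff_sol by blast
  have nc: "l \<noteq> cnj l" "m \<noteq> cnj m" "m \<noteq> cnj l"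
    using l(2) m(2) lcm by (auto simp: Reals_cnj_iff)
  \<comment> \<open>A nontrivial solution of \<open>A * y 0 + B * z 0 = 0\<close>; if both values
    vanish, any nonzero pair serves.\<close>
  define A where "A = (if y 0 = 0 \<and> z 0 = 0 then 1 else z 0)"
  define B where "B = (if y 0 = 0 \<and> z 0 = 0 then 0 else - y 0)"
  have AB: "A \<noteq> 0 \<or> B \<noteq> 0" "A * y 0 + B * z 0 = 0" by (auto simp: A_def B_def)
  define s where "s x = A * y x + B * z x" for x
  define s1 where "s1 x = A * y1 x + B * z1 x" for x
  note Y = solD[OF y(1)] and Z = solD[OF z(1)]
  have sder: "(s has_vector_derivative s1 x) (at x within {-1..1})" if "x \<in> {-1..1}" for x
    unfolding s_def s1_def using that by (intro has_vector_derivative_add has_vector_derivative_mult_right Y Z)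
  have s1c: "continuous_on {-1..1} s1" unfolding s1_def by (intro continuous_intros Y Z)
  have s0: "s (-1) = 0" "s 0 = 0" "s 1 = 0" using AB y z by (auto simp: s_def)
  define Q where "Q x = (norm (s1 x))\<^sup>2 + q x * (norm (s x))\<^sup>2" for x
  \<comment> \<open>All four pairings are neutral: the mixed ones because
    \<open>l \<noteq> cnj m\<close>, the diagonal ones because \<open>l\<close> and \<open>m\<close>
    are not real.\<close>
  have "((\<lambda>x. A * cnj A * (y1 x * cnj (y1 x) + of_real (q x) * y x * cnj (y x))
      + A * cnj B * (y1 x * cnj (z1 x) + of_real (q x) * y x * cnj (z x))
      + B * cnj A * (z1 x * cnj (y1 x) + of_real (q x) * z x * cnj (y x))
      + B * cnj B * (z1 x * cnj (z1 x) + of_real (q x) * z x * cnj (z x))) has_integral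
      A * cnj A * 0 + A * cnj B * 0 + B * cnj A * 0 + B * cnj B * 0) {-1..1}"
    by (intro has_integral_add has_integral_mult_right neutral_pair[OF y(1) y(1)] neutral_pair[OF y(1) z(1)]
        neutral_pair[OF z(1) y(1)] neutral_pair[OF z(1) z(1)] y z nc lcm) auto
  also have "(\<lambda>x. A * cnj A * (y1 x * cnj (y1 x) + of_real (q x) * y x * cnj (y x))
      + A * cnj B * (y1 x * cnj (z1 x) + of_real (q x) * y x * cnj (z x))
      + B * cnj A * (z1 x * cnj (y1 x) + of_real (q x) * z x * cnj (y x))
      + B * cnj B * (z1 x * cnj (z1 x) + of_real (q x) * z x * cnj (z x))) = (\<lambda>x. of_real (Q x))"
  proof
    fix x
    have "complex_of_real (Q x) = s1 x * cnj (s1 x) + of_real (q x) * (s x * cnj (s x))"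
      unfolding Q_def of_real_add of_real_mult complex_norm_square ..
    then show "A * cnj A * (y1 x * cnj (y1 x) + of_real (q x) * y x * cnj (y x))
      + A * cnj B * (y1 x * cnj (z1 x) + of_real (q x) * y x * cnj (z x))
      + B * cnj A * (z1 x * cnj (y1 x) + of_real (q x) * z x * cnj (y x))
      + B * cnj B * (z1 x * cnj (z1 x) + of_real (q x) * z x * cnj (z x)) = of_real (Q x)"
      by (simp add: s_def s1_def algebra_simps)
  qed
  finally have "((\<lambda>x. complex_of_real (Q x)) has_integral 0) {-1..1}" by simp
  from has_integral_linear[OF this bounded_linear_Re]
  have Q0: "(Q has_integral 0) {-1..1}" by (simp add: o_def)
  have subs: "{0..1} \<subseteq> {-1..1::real}" by auto
  have "\<exists>E\<ge>0. ((\<lambda>x. (norm (s1 x))\<^sup>2 + q x * (norm (s x))\<^sup>2) has_integral E) {0..1} \<and>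
    (E = 0 \<longrightarrow> (\<forall>x\<in>{0..1}. s x = 0))"
  proof (rule energy_nonneg)
    show "(s has_vector_derivative s1 x) (at x within {0..1})" if "x \<in> {0..1}" for x
      using sder[of x] that by (auto intro: has_vector_derivative_within_subset[OF _ subs])
    show "continuous_on {0..1} s1" by (rule continuous_on_subset[OF s1c subs])
  qed (use s0 in auto)
  then obtain E1 where E1: "E1 \<ge> 0" "(Q has_integral E1) {0..1}" "E1 = 0 \<Longrightarrow> x \<in> {0..1} \<Longrightarrow> s x = 0" for x
    unfolding Q_def[abs_def] by blast
  \<comment> \<open>The left half is reflected to \<open>[0, 1]\<close>; evenness of
    \<open>q\<close> then identifies this energy with that of \<open>s\<close> on
    \<open>[- 1, 0]\<close>.\<close>
  have "\<exists>E\<ge>0. ((\<lambda>x. (norm (- s1 (- x)))\<^sup>2 + q x * (norm (s (- x)))\<^sup>2) has_integral E) {0..1} \<and>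
    (E = 0 \<longrightarrow> (\<forall>x\<in>{0..1}. s (- x) = 0))"
  proof (rule energy_nonneg)
    fix x :: real assume x: "x \<in> {0..1}"
    have "((\<lambda>x. s (- x)) has_vector_derivative - s1 (- x)) (at x within {- 1..- (- 1)})"
      using x by (intro has_vector_derivative_reflect sder) auto
    then show "((\<lambda>x. s (- x)) has_vector_derivative - s1 (- x)) (at x within {0..1})"
      by (auto intro: has_vector_derivative_within_subset[OF _ subs])
  next
    show "continuous_on {0..1} (\<lambda>x. - s1 (- x))"
      by (intro continuous_on_minus continuous_on_compose2[OF s1c] continuous_intros) auto
  qed (use s0 in auto)
  then obtain E2 where E2: "E2 \<ge> 0" "((\<lambda>x. (norm (s1 (- x)))\<^sup>2 + q x * (norm (s (- x)))\<^sup>2) has_integral E2) {0..1}"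
      "E2 = 0 \<Longrightarrow> x \<in> {0..1} \<Longrightarrow> s (- x) = 0" for x
    by auto
  obtain N where N: "negligible N" "\<And>x. x \<notin> N \<Longrightarrow> x \<in> {-1..1} \<Longrightarrow> q (- x) = q x"
    using q_even unfolding AE_lborel_iff_negligible by blast
  have "((\<lambda>x. Q (- x)) has_integral E2) {0..1}"
    by (rule has_integral_spike[OF N(1) _ E2(2)]) (use N(2) in \<open>auto simp: Q_def\<close>)
  then have "(Q has_integral E2) {-1..0}"
    using has_integral_reflect_real[where f = Q and i = E2 and a = "-1" and b = 0] by simp
  from has_integral_combine[OF _ _ this E1(2)] have "(Q has_integral E2 + E1) {-1..1}" by simp
  with Q0 have "E2 + E1 = 0" by (rule has_integral_unique[symmetric, OF _ ])
  then have E: "E1 = 0" "E2 = 0" using E1(1) E2(1) by auto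
  have sz: "s x = 0" if "x \<in> {-1..1}" for x
    using E1(3)[OF E(1), of x] E2(3)[OF E(2), of "- x"] that by (cases "x \<ge> 0") auto
  have s1z: "s1 x = 0" if "x \<in> {-1..1}" for x
    by (rule has_vector_derivative_zero_on[OF sder[OF that] sz that]) auto
  have ae: "AE x in lborel. x \<in> {-1..1} \<longrightarrow> A * y x = 0"
    using Y(6) Z(6) w
  proof eventually_elim
    case (elim x)
    show ?case
    proof
      assume x: "x \<in> {-1..1}"
      have "(s1 has_vector_derivative A * (pot q w l x * y x) + B * (pot q w m x * z x)) (at x within {-1..1})"
        unfolding s1_def[abs_def] using elim x by (intro has_vector_derivative_add has_vector_derivative_mult_right) auto
      then have "A * (pot q w l x * y x) + B * (pot q w m x * z x) = 0"
        by (rule has_vector_derivative_zero_on[OF _ s1z x]) auto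
      then have "of_real (q x) * s x - of_real (w x) * (l * (A * y x) + m * (B * z x)) = 0"
        by (simp add: pot_def s_def algebra_simps)
      then have "l * (A * y x) + m * (B * z x) = 0" using sz[OF x] elim x by simp
      moreover have "B * z x = - (A * y x)" using sz[OF x] unfolding s_def by (metis add.commute add_eq_0_iff)
      ultimately have "(l - m) * (A * y x) = 0" by (simp add: algebra_simps)
      then show "A * y x = 0" using lm by simp
    qed
  qed
  have Ay: "A * y x = 0" if "x \<in> {-1..1}" for x
    by (rule continuous_on_AE_zero[OF _ ae _ that]) (auto intro!: continuous_intros Y)
  have "B * z x = 0" if "x \<in> {-1..1}" for x
    using sz[OF that] Ay[OF that] unfolding s_def by simp
  with Ay AB(1) y(2) z(2) show False by auto
qed

end

section \<open>Existence of an imaginary eigenvalue\<close>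

context half_problem
begin

text \<open>The solution \<open>\<psi> 1 * \<phi> - \<phi> 1 * \<psi>\<close> vanishes at \<open>1\<close>, and its energy is the inner product of
  \<open>\<phi> 1\<close> and \<open>\<psi> 1\<close>.\<close>

lemma normalised_negative_solution:
  assumes neg: "\<phi> (\<i> * of_real a) 1 \<bullet> \<psi> (\<i> * of_real a) 1 < 0"
  shows "\<exists>u u1 E. sol 0 1 (pot q w (\<i> * of_real a)) u u1 \<and> (\<forall>x\<in>{0..1}. norm (u x) \<le> 1) \<and>
    (\<exists>x\<in>{0..1}. norm (u x) = 1) \<and> u 1 = 0 \<and> E \<le> 0 \<and>
    ((\<lambda>x. (norm (u1 x))\<^sup>2 + q x * (norm (u x))\<^sup>2) has_integral E) {0..1}"
proof -
  let ?l = "\<i> * of_real a"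
  define c where "c x = \<psi> ?l 1 * \<phi> ?l x + (- \<phi> ?l 1) * \<psi> ?l x" for x
  define c1 where "c1 x = \<psi> ?l 1 * \<phi>1 ?l x + (- \<phi> ?l 1) * \<psi>1 ?l x" for x
  have c: "sol 0 1 (pot q w ?l) c c1" unfolding c_def c1_def by (rule sol_comb)
  have c0: "c 0 = \<psi> ?l 1" "c1 0 = - \<phi> ?l 1" "c 1 = 0" by (simp_all add: c_def c1_def phi psi)
  have "continuous_on {0..1} (\<lambda>x. norm (c x))" by (intro continuous_intros solD(3)[OF c])
  then obtain z where z: "z \<in> {0..1}" "\<And>x. x \<in> {0..1} \<Longrightarrow> norm (c x) \<le> norm (c z)"
    using continuous_attains_sup[of "{0..1}" "\<lambda>x. norm (c x)"] by auto
  have "c 0 \<noteq> 0" using neg c0 by auto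
  then have N: "norm (c z) > 0" using z(2)[of 0] by (metis atLeastAtMost_iff norm_le_zero_iff not_le order_refl zero_le_one order_trans)
  \<comment> \<open>Supremum norm exactly 1 keeps a uniform limit from being zero; the scaling
    multiplies the energy by \<open>(norm r)^2\<close> and keeps its sign.\<close>
  define r where "r = inverse (complex_of_real (norm (c z)))"
  define u where "u x = r * c x" for x
  define u1 where "u1 x = r * c1 x" for x
  have u: "sol 0 1 (pot q w ?l) u u1" unfolding u_def u1_def by (rule sol_mult[OF c])
  have nr: "norm r = inverse (norm (c z))" by (simp add: r_def norm_inverse)
  have nu: "norm (u x) = norm (c x) / norm (c z)" for x by (simp add: u_def norm_mult nr field_simps)
  have E: "((\<lambda>x. (norm (u1 x))\<^sup>2 + q x * (norm (u x))\<^sup>2) has_integral - (u1 0 \<bullet> u 0)) {0..1}"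
    using has_integral_energy[OF u] by (simp add: pot_def u_def c0)
  have "(r * z) \<bullet> (r * z') = (norm r)\<^sup>2 * (z \<bullet> z')" for z z'
    unfolding cmod_power2 by (simp add: inner_complex_def algebra_simps power2_eq_square)
  then have "u1 0 \<bullet> u 0 = (norm r)\<^sup>2 * (- (\<phi> ?l 1 \<bullet> \<psi> ?l 1))" by (simp add: u_def u1_def c0)
  then have "- (u1 0 \<bullet> u 0) \<le> 0" using neg by (simp add: mult_nonneg_nonpos)
  moreover have "\<forall>x\<in>{0..1}. norm (u x) \<le> 1" using z(2) N by (simp add: nu divide_le_eq)
  moreover have "\<exists>x\<in>{0..1}. norm (u x) = 1" using z(1) N by (intro bexI[of _ z]) (auto simp: nu)
  moreover have "u 1 = 0" by (simp add: u_def c0)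
  ultimately show ?thesis using u E by blast
qed

text \<open>If the energy stayed negative along the whole imaginary axis, normalised solutions would
  converge uniformly, and dividing the twice integrated equation by the spectral parameter would
  force the limit to be annihilated by \<open>w\<close>.\<close>

lemma exists_nonneg_inner:
  assumes w: "AE x in lborel. x \<in> {0..1} \<longrightarrow> w x \<noteq> 0"
  shows "\<exists>a>0. \<phi> (\<i> * of_real a) 1 \<bullet> \<psi> (\<i> * of_real a) 1 \<ge> 0"
proof (rule ccontr)
  assume "\<not> ?thesis"
  then have neg: "\<phi> (\<i> * of_real a) 1 \<bullet> \<psi> (\<i> * of_real a) 1 < 0" if "a > 0" for a
    using that by (auto simp: not_le)
  let ?I = "{0..1::real}"
  define a where "a n = real n + 1" for n
  have a0: "a n > 0" for n by (simp add: a_def)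
  define good where "good n U \<longleftrightarrow> sol 0 1 (pot q w (\<i> * of_real (a n))) (fst U) (fst (snd U)) \<and>
    (\<forall>x\<in>?I. norm (fst U x) \<le> 1) \<and> (\<exists>x\<in>?I. norm (fst U x) = 1) \<and> fst U 1 = 0 \<and> snd (snd U) \<le> 0 \<and>
    ((\<lambda>x. (norm (fst (snd U) x))\<^sup>2 + q x * (norm (fst U x))\<^sup>2) has_integral snd (snd U)) ?I" for n U
  have "\<exists>U. good n U" for n
    using normalised_negative_solution[OF neg[OF a0[of n]]] unfolding good_def split_paired_Ex by simp
  then obtain U where U: "\<And>n. good n (U n)" by metis
  define u where "u n = fst (U n)" for n
  define u1 where "u1 n = fst (snd (U n))" for n
  define E where "E n = snd (snd (U n))" for n
  note good = U[unfolded good_def, folded u_def u1_def E_def]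
  have u: "\<And>n. sol 0 1 (pot q w (\<i> * of_real (a n))) (u n) (u1 n)"
    and u_le: "\<And>n x. x \<in> ?I \<Longrightarrow> norm (u n x) \<le> 1" and u_eq: "\<And>n. \<exists>x\<in>?I. norm (u n x) = 1"
    and u_1: "\<And>n. u n 1 = 0" and E: "\<And>n. E n \<le> 0"
      "\<And>n. ((\<lambda>x. (norm (u1 n x))\<^sup>2 + q x * (norm (u n x))\<^sup>2) has_integral E n) ?I"
    using good by blast+
  have uc: "continuous_on ?I (u n)" and u1c: "continuous_on ?I (u1 n)" for n
    by (rule solD[OF u])+
  define K where "K = integral ?I (\<lambda>x. \<bar>q x\<bar>)"
  have aqi: "(\<lambda>x. \<bar>q x\<bar>) integrable_on ?I" and awi: "(\<lambda>x. \<bar>w x\<bar>) integrable_on ?I"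
    using absolutely_integrable_norm[OF q_int] absolutely_integrable_norm[OF w_int]
    by (simp_all add: o_def absolutely_integrable_on_def)
  have K0: "K \<ge> 0" unfolding K_def by (intro integral_nonneg aqi) auto
  have u1i: "(\<lambda>x. (norm (u1 n x))\<^sup>2) integrable_on S" if "S = {c..d}" "{c..d} \<subseteq> ?I" for n S c d
    unfolding that(1) by (intro integrable_continuous_real continuous_intros continuous_on_subset[OF u1c] that)
  \<comment> \<open>With \<open>norm (u n x) \<le> 1\<close> and nonpositive energy, the integral of
    \<open>|u1|^2\<close> is at most that of \<open>\<bar>q\<bar>\<close>, whatever the value of
    \<open>a n\<close>.\<close>
  have u1K: "integral ?I (\<lambda>x. (norm (u1 n x))\<^sup>2) \<le> K" for n
  proof -
    have "((\<lambda>x. (norm (u1 n x))\<^sup>2 - \<bar>q x\<bar>) has_integral integral ?I (\<lambda>x. (norm (u1 n x))\<^sup>2) - K) ?I"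
      unfolding K_def by (intro has_integral_diff integrable_integral aqi u1i) auto
    then have "integral ?I (\<lambda>x. (norm (u1 n x))\<^sup>2) - K \<le> E n"
    proof (rule has_integral_le[OF _ E(2)])
      fix x assume x: "x \<in> ?I"
      have "(norm (u n x))\<^sup>2 \<le> 1" using u_le[OF x, of n] by (simp add: power_le_one)
      then have "\<bar>q x * (norm (u n x))\<^sup>2\<bar> \<le> \<bar>q x\<bar> * 1"
        unfolding abs_mult by (intro mult_left_mono) auto
      then show "(norm (u1 n x))\<^sup>2 - \<bar>q x\<bar> \<le> (norm (u1 n x))\<^sup>2 + q x * (norm (u n x))\<^sup>2" by linarith
    qed
    then show ?thesis using E(1)[of n] by linarith
  qed
  \<comment> \<open>Cauchy-Schwarz in the form \<open>2 c \<le> \<eta> + c^2 / \<eta>\<close>;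
    leaving \<open>\<eta>\<close> free avoids square roots.\<close>
  have holder: "norm (u n y - u n x) \<le> (\<eta> * (y - x) + K / \<eta>) / 2"
    if xy: "x \<in> ?I" "y \<in> ?I" "x \<le> y" and \<eta>: "\<eta> > 0" for n x y \<eta>
  proof -
    have sub: "{x..y} \<subseteq> ?I" using xy by auto
    have "(u1 n has_integral (u n y - u n x)) {x..y}"
    proof (rule fundamental_theorem_of_calculus[OF xy(3)])
      show "(u n has_vector_derivative u1 n t) (at t within {x..y})" if "t \<in> {x..y}" for t
        using solD(5)[OF u, of t n] that sub by (blast intro: has_vector_derivative_within_subset[OF _ sub])
    qed
    then have "norm (u n y - u n x) = norm (integral {x..y} (u1 n))" by (simp add: integral_unique)
    also have "\<dots> \<le> integral {x..y} (\<lambda>t. \<eta> / 2 + (norm (u1 n t))\<^sup>2 * (1 / (2 * \<eta>)))"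
    proof (rule Henstock_Kurzweil_Integration.integral_norm_bound_integral)
      show "u1 n integrable_on {x..y}" by (intro integrable_continuous_real continuous_on_subset[OF u1c sub])
      show "(\<lambda>t. \<eta> / 2 + (norm (u1 n t))\<^sup>2 * (1 / (2 * \<eta>))) integrable_on {x..y}"
        by (intro integrable_continuous_real continuous_intros continuous_on_subset[OF u1c sub])
      show "norm (u1 n t) \<le> \<eta> / 2 + (norm (u1 n t))\<^sup>2 * (1 / (2 * \<eta>))" for t
      proof -
        have "0 \<le> (norm (u1 n t) - \<eta>)\<^sup>2 / (2 * \<eta>)" using \<eta> by simp
        also have "\<dots> = \<eta> / 2 + (norm (u1 n t))\<^sup>2 * (1 / (2 * \<eta>)) - norm (u1 n t)"
          using \<eta> by (simp add: power2_eq_square field_simps)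
        finally show ?thesis by simp
      qed
    qed
    also have "\<dots> = (y - x) * (\<eta> / 2) + integral {x..y} (\<lambda>t. (norm (u1 n t))\<^sup>2) * (1 / (2 * \<eta>))"
    proof -
      have "(\<lambda>t. (norm (u1 n t))\<^sup>2 * (1 / (2 * \<eta>))) integrable_on {x..y}"
        by (rule integrable_on_mult_left[OF u1i[OF refl sub]])
      then have "integral {x..y} (\<lambda>t. \<eta> / 2 + (norm (u1 n t))\<^sup>2 * (1 / (2 * \<eta>)))
          = integral {x..y} (\<lambda>t. \<eta> / 2) + integral {x..y} (\<lambda>t. (norm (u1 n t))\<^sup>2 * (1 / (2 * \<eta>)))"
        by (intro Henstock_Kurzweil_Integration.integral_add integrable_const_ivl)
      also have "integral {x..y} (\<lambda>t. \<eta> / 2) = (y - x) * (\<eta> / 2)"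
        using integral_const_real[of "\<eta> / 2" x y] xy by simp
      also have "integral {x..y} (\<lambda>t. (norm (u1 n t))\<^sup>2 * (1 / (2 * \<eta>)))
          = integral {x..y} (\<lambda>t. (norm (u1 n t))\<^sup>2) * (1 / (2 * \<eta>))"
        by (rule integral_mult_left)
      finally show ?thesis .
    qed
    also have "\<dots> \<le> (y - x) * (\<eta> / 2) + K * (1 / (2 * \<eta>))"
    proof (intro add_left_mono mult_right_mono)
      have "integral {x..y} (\<lambda>t. (norm (u1 n t))\<^sup>2) \<le> integral ?I (\<lambda>t. (norm (u1 n t))\<^sup>2)"
        by (intro integral_subset_le sub u1i[OF refl sub] u1i[OF refl order_refl]) simp
      with u1K[of n] show "integral {x..y} (\<lambda>t. (norm (u1 n t))\<^sup>2) \<le> K" by linarith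
    qed (use \<eta> in simp)
    also have "\<dots> = (\<eta> * (y - x) + K / \<eta>) / 2" using \<eta> by (simp add: field_simps)
    finally show ?thesis .
  qed
  have equi: "\<exists>d>0. \<forall>n y. y \<in> ?I \<and> norm (x - y) < d \<longrightarrow> norm (u n x - u n y) < e"
    if x: "x \<in> ?I" and e: "e > 0" for x e
  proof -
    \<comment> \<open>This puts \<open>K / \<eta>\<close> below \<open>e\<close>, and a distance
      below \<open>e / \<eta>\<close> does the same for the other term.\<close>
    define \<eta> where "\<eta> = (K + 1) / e"
    have \<eta>: "\<eta> > 0" "K / \<eta> < e" using e K0 by (auto simp: \<eta>_def field_simps)
    have "norm (u n x - u n y) < e" if y: "y \<in> ?I" "norm (x - y) < e / \<eta>" for n y
    proof -
      have "norm (u n x - u n y) \<le> (\<eta> * \<bar>x - y\<bar> + K / \<eta>) / 2"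
      proof (cases "x \<le> y")
        case True
        then show ?thesis using holder[OF x y(1) True \<eta>(1), of n] by (simp add: norm_minus_commute)
      next
        case False
        then show ?thesis using holder[OF y(1) x _ \<eta>(1), of n] by simp
      qed
      moreover have "\<eta> * \<bar>x - y\<bar> < e" using y(2) \<eta>(1) by (simp add: field_simps)
      ultimately show ?thesis using \<eta>(2) by simp
    qed
    moreover have "e / \<eta> > 0" using e \<eta> by simp
    ultimately show ?thesis by blast
  qed
  obtain g k where gc: "continuous_on ?I g" and k: "strict_mono (k :: nat \<Rightarrow> nat)"
    and lim: "\<And>e. 0 < e \<Longrightarrow> \<exists>N. \<forall>n x. n \<ge> N \<and> x \<in> ?I \<longrightarrow> norm (u (k n) x - g x) < e"
    using Arzela_Ascoli[of ?I u 1, OF compact_Icc u_le equi] by metis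
  define W where "W h t = integral {0..t} (\<lambda>s. of_real (w s) * h s)" for h :: "real \<Rightarrow> complex" and t
  define V where "V h x = integral {0..x} (W h)" for h x
  define P where "P n t = integral {0..t} (\<lambda>s. of_real (q s) * u n s)" for n t
  have cw: "(\<lambda>s. complex_of_real (w s)) absolutely_integrable_on ?I" "(\<lambda>s. complex_of_real (q s)) absolutely_integrable_on ?I"
    using absolutely_integrable_linear[OF w_int bounded_linear_of_real]
      absolutely_integrable_linear[OF q_int bounded_linear_of_real] by (simp_all add: o_def)
  have wh: "(\<lambda>s. of_real (w s) * h s) absolutely_integrable_on ?I" "(\<lambda>s. of_real (q s) * h s) absolutely_integrable_on ?I"
    if "continuous_on ?I h" for h :: "real \<Rightarrow> complex"
    by (rule absolutely_integrable_mult_continuous[OF cw(1) that] absolutely_integrable_mult_continuous[OF cw(2) that])+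
  have whi: "(\<lambda>s. of_real (w s) * h s) integrable_on {0..t}" "(\<lambda>s. of_real (q s) * h s) integrable_on {0..t}"
    if "continuous_on ?I h" "t \<in> ?I" for h :: "real \<Rightarrow> complex" and t
    using wh[OF that(1)] that(2) integrable_subinterval_real[of _ 0 1 0 t]
    by (auto simp: absolutely_integrable_on_def)
  have Wc: "continuous_on ?I (W h)" if "continuous_on ?I h" for h
    unfolding W_def by (intro abs_cont_on_imp_continuous_on abs_cont_on_integral wh that)
  have Pc: "continuous_on ?I (P n)" for n
    unfolding P_def by (intro abs_cont_on_imp_continuous_on abs_cont_on_integral wh uc)
  have Ii: "h integrable_on {0..t}" if "continuous_on ?I h" "t \<in> ?I" for h :: "real \<Rightarrow> complex" and t
    using that by (intro integrable_continuous_real continuous_on_subset[OF that(1)]) auto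
  have bound_int: "norm (integral {0..x} h) \<le> B" if "continuous_on ?I h" "x \<in> ?I" "\<And>t. t \<in> ?I \<Longrightarrow> norm (h t) \<le> B"
    for h :: "real \<Rightarrow> complex" and x B
  proof -
    have "norm (integral {0..x} h) \<le> integral {0..x} (\<lambda>t. B)"
      using that by (intro Henstock_Kurzweil_Integration.integral_norm_bound_integral Ii) auto
    also have "\<dots> = x * B" using that by simp
    also have "\<dots> \<le> 1 * B"
    proof (rule mult_right_mono)
      have "norm (h 0) \<le> B" by (rule that(3)) simp
      then show "0 \<le> B" using norm_ge_zero[of "h 0"] by linarith
    qed (use that(2) in simp)
    finally show ?thesis by simp
  qed
  have Pb: "norm (P n t) \<le> K" if t: "t \<in> ?I" for n t
  proof -
    have "norm (P n t) \<le> integral {0..t} (\<lambda>x. \<bar>q x\<bar>)"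
      unfolding P_def
    proof (rule Henstock_Kurzweil_Integration.integral_norm_bound_integral)
      show "(\<lambda>x. \<bar>q x\<bar>) integrable_on {0..t}" using integrable_subinterval_real[OF aqi, of 0 t] t by auto
      show "norm (of_real (q s) * u n s) \<le> \<bar>q s\<bar>" if "s \<in> {0..t}" for s
        using u_le[of s n] that t by (simp add: norm_mult mult_left_le)
    qed (use whi uc t in auto)
    also have "\<dots> \<le> K"
      unfolding K_def using integrable_subinterval_real[OF aqi, of 0 t] t aqi by (intro integral_subset_le) auto
    finally show ?thesis .
  qed
  have u1_eq: "u1 n t = u1 n 0 + P n t - \<i> * of_real (a n) * W (u n) t" if t: "t \<in> ?I" for n t
  proof -
    have "sol 0 t (pot q w (\<i> * of_real (a n))) (u n) (u1 n)" by (rule sol_subinterval[OF u]) (use t in auto)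
    note S = solD[OF this]
    have "((\<lambda>s. pot q w (\<i> * of_real (a n)) s * u n s) has_integral (u1 n t - u1 n 0)) {0..t}"
      using t by (intro abs_cont_on_has_integral_derivative[OF _ S(1,6)]) auto
    moreover have "((\<lambda>s. of_real (q s) * u n s - \<i> * of_real (a n) * (of_real (w s) * u n s)) has_integral
        P n t - \<i> * of_real (a n) * W (u n) t) {0..t}"
      unfolding P_def W_def by (intro has_integral_diff has_integral_mult_right integrable_integral whi uc t)
    moreover have "(\<lambda>s. of_real (q s) * u n s - \<i> * of_real (a n) * (of_real (w s) * u n s))
        = (\<lambda>s. pot q w (\<i> * of_real (a n)) s * u n s)"
      by (simp add: pot_def fun_eq_iff algebra_simps)
    ultimately have "u1 n t - u1 n 0 = P n t - \<i> * of_real (a n) * W (u n) t"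
      by (metis has_integral_unique)
    then show ?thesis by (simp add: algebra_simps)
  qed
  define R where "R n x = integral {0..x} (P n)" for n x
  have Rb: "norm (R n x) \<le> K" if "x \<in> ?I" for n x
    unfolding R_def by (rule bound_int[OF Pc that Pb])
  have u_eq2: "u n x = u n 0 + of_real x * u1 n 0 + R n x - \<i> * of_real (a n) * V (u n) x" if x: "x \<in> ?I" for n x
  proof -
    have sub: "{0..x} \<subseteq> ?I" using x by auto
    have "(u1 n has_integral (u n x - u n 0)) {0..x}"
    proof (rule fundamental_theorem_of_calculus)
      show "(u n has_vector_derivative u1 n t) (at t within {0..x})" if "t \<in> {0..x}" for t
        using solD(5)[OF u, of t n] that sub by (blast intro: has_vector_derivative_within_subset[OF _ sub])
    qed (use x in auto)
    moreover have const: "((\<lambda>t. u1 n 0) has_integral (x - 0) *\<^sub>R u1 n 0) {0..x}"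
      using has_integral_const_real[of "u1 n 0" 0 x] x by simp
    have "((\<lambda>t. u1 n 0 + P n t - \<i> * of_real (a n) * W (u n) t) has_integral
        (x - 0) *\<^sub>R u1 n 0 + R n x - \<i> * of_real (a n) * V (u n) x) {0..x}"
      unfolding R_def V_def using x
      by (intro has_integral_diff has_integral_add const has_integral_mult_right integrable_integral Ii Pc Wc uc) auto
    then have "(u1 n has_integral (x - 0) *\<^sub>R u1 n 0 + R n x - \<i> * of_real (a n) * V (u n) x) {0..x}"
    proof (rule has_integral_eq[rotated])
      show "u1 n 0 + P n t - \<i> * of_real (a n) * W (u n) t = u1 n t" if "t \<in> {0..x}" for t
        by (rule u1_eq[symmetric]) (use that sub in blast)
    qed
    ultimately have "u n x - u n 0 = (x - 0) *\<^sub>R u1 n 0 + R n x - \<i> * of_real (a n) * V (u n) x"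
      by (rule has_integral_unique)
    then show ?thesis by (simp add: scaleR_conv_of_real algebra_simps)
  qed
  \<comment> \<open>No bound on \<open>u1 n 0\<close> is available, so it is eliminated through
    \<open>u n 1 = 0\<close>. The terms left beside \<open>V\<close> are bounded by 1 or
    \<open>K\<close>, and division by \<open>a n\<close> makes \<open>V (u n)\<close> nearly linear
    in \<open>x\<close>.\<close>
  have Vb: "norm (V (u n) x - of_real x * V (u n) 1) \<le> (2 + 2 * K) / a n" if x: "x \<in> ?I" for n x
  proof -
    have e1: "u1 n 0 = \<i> * of_real (a n) * V (u n) 1 - u n 0 - R n 1"
      using u_eq2[of 1 n] u_1[of n] by (simp add: algebra_simps add_eq_0_iff)
    have eq: "\<i> * of_real (a n) * (V (u n) x - of_real x * V (u n) 1)
      = (u n 0 - u n x) - of_real x * u n 0 + (R n x - of_real x * R n 1)"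
      using u_eq2[OF x, of n] unfolding e1 by (simp add: algebra_simps)
    have "a n * norm (V (u n) x - of_real x * V (u n) 1) = norm (\<i> * of_real (a n) * (V (u n) x - of_real x * V (u n) 1))"
      using a0[of n] by (simp add: norm_mult)
    also have "\<i> * of_real (a n) * (V (u n) x - of_real x * V (u n) 1)
      = (of_real (1 - x) * u n 0 - u n x) + (R n x - of_real x * R n 1)"
      unfolding eq by (simp add: algebra_simps)
    also have "norm \<dots> \<le> (1 + 1) + (K + K)"
    proof (intro norm_triangle_mono order_trans[OF norm_triangle_ineq4] add_mono)
      have "norm (of_real (1 - x) * u n 0) \<le> 1 * 1"
        unfolding norm_mult norm_of_real using x u_le[of 0 n] by (intro mult_mono) auto
      then show "norm (of_real (1 - x) * u n 0) \<le> 1" by simp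
      show "norm (u n x) \<le> 1" by (rule u_le[OF x])
      show "norm (R n x) \<le> K" by (rule Rb[OF x])
      have "norm (of_real x * R n 1) \<le> 1 * K"
        unfolding norm_mult using x Rb[of 1 n] by (intro mult_mono) auto
      then show "norm (of_real x * R n 1) \<le> K" by simp
    qed
    finally show ?thesis using a0[of n] by (simp add: field_simps)
  qed
  define B where "B = integral ?I (\<lambda>x. \<bar>w x\<bar>)"
  have B0: "B \<ge> 0" unfolding B_def by (intro integral_nonneg awi) auto
  have Wdiff: "norm (W h t - W h' t) \<le> B * e"
    if "continuous_on ?I h" "continuous_on ?I h'" "t \<in> ?I" "\<And>s. s \<in> ?I \<Longrightarrow> norm (h s - h' s) \<le> e" for h h' t e
  proof -
    have "norm (h 0 - h' 0) \<le> e" by (rule that(4)) simp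
    then have e0: "e \<ge> 0" using norm_ge_zero[of "h 0 - h' 0"] by linarith
    have awt: "(\<lambda>x. \<bar>w x\<bar>) integrable_on {0..t}" using integrable_subinterval_real[OF awi, of 0 t] that by auto
    have "W h t - W h' t = integral {0..t} (\<lambda>s. of_real (w s) * (h s - h' s))"
      unfolding W_def using whi that by (simp add: integral_diff[symmetric] right_diff_distrib)
    also have "norm \<dots> \<le> integral {0..t} (\<lambda>s. \<bar>w s\<bar> * e)"
    proof (rule Henstock_Kurzweil_Integration.integral_norm_bound_integral)
      show "(\<lambda>s. complex_of_real (w s) * (h s - h' s)) integrable_on {0..t}"
        by (intro whi(1) continuous_intros that)
      show "norm (complex_of_real (w s) * (h s - h' s)) \<le> \<bar>w s\<bar> * e" if "s \<in> {0..t}" for s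
        unfolding norm_mult using \<open>t \<in> ?I\<close> that \<open>\<And>s. s \<in> ?I \<Longrightarrow> norm (h s - h' s) \<le> e\<close>
        by (intro mult_mono) auto
    qed (intro integrable_on_mult_left awt)
    also have "\<dots> = integral {0..t} (\<lambda>s. \<bar>w s\<bar>) * e" by simp
    also have "\<dots> \<le> B * e"
      unfolding B_def using awt awi that e0 by (intro mult_right_mono integral_subset_le) auto
    finally show ?thesis .
  qed
  have Vdiff: "norm (V h x - V h' x) \<le> B * e"
    if "continuous_on ?I h" "continuous_on ?I h'" "x \<in> ?I" "\<And>s. s \<in> ?I \<Longrightarrow> norm (h s - h' s) \<le> e" for h h' x e
  proof -
    have "V h x - V h' x = integral {0..x} (\<lambda>t. W h t - W h' t)"
      unfolding V_def by (intro integral_diff[symmetric] Ii Wc that)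
    also have "norm \<dots> \<le> B * e"
      by (intro bound_int continuous_intros Wc Wdiff that) auto
    finally show ?thesis .
  qed
  have Vlim: "(\<lambda>n. V (u (k n)) x) \<longlonglongrightarrow> V g x" if x: "x \<in> ?I" for x
  proof (rule LIMSEQ_I)
    fix e :: real assume e: "e > 0"
    define e' where "e' = e / (B + 1)"
    have e': "e' > 0" using e B0 by (simp add: e'_def)
    obtain N where N: "\<And>n x. n \<ge> N \<Longrightarrow> x \<in> ?I \<Longrightarrow> norm (u (k n) x - g x) < e'" using lim[OF e'] by blast
    have "norm (V (u (k n)) x - V g x) < e" if "n \<ge> N" for n
    proof -
      have "norm (V (u (k n)) x - V g x) \<le> B * e'"
        by (rule Vdiff[OF uc gc x]) (use N[OF that] in \<open>auto intro: less_imp_le\<close>)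
      also have "\<dots> < (B + 1) * e'" using e' by simp
      also have "\<dots> = e" using B0 by (simp add: e'_def)
      finally show ?thesis .
    qed
    then show "\<exists>N. \<forall>n\<ge>N. norm (V (u (k n)) x - V g x) < e" by blast
  qed
  \<comment> \<open>In the limit \<open>V g\<close> is exactly linear. One differentiation makes
    \<open>W g\<close> constant, hence 0 by its value at 0, and a second one gives
    \<open>w g = 0\<close> almost everywhere.\<close>
  have Vg: "V g x = of_real x * V g 1" if x: "x \<in> ?I" for x
  proof -
    have "(\<lambda>n. V (u (k n)) x - of_real x * V (u (k n)) 1) \<longlonglongrightarrow> V g x - of_real x * V g 1"
      by (intro tendsto_intros Vlim x) auto
    moreover have "(\<lambda>n. V (u (k n)) x - of_real x * V (u (k n)) 1) \<longlonglongrightarrow> 0"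
    proof (rule Lim_null_comparison)
      have "norm (V (u (k n)) x - of_real x * V (u (k n)) 1) \<le> (2 + 2 * K) * inverse (real (Suc n))" for n
      proof -
        have "real (Suc n) \<le> a (k n)" using seq_suble[OF k, of n] by (simp add: a_def)
        then have "(2 + 2 * K) / a (k n) \<le> (2 + 2 * K) / real (Suc n)"
          using K0 a0 by (intro divide_left_mono) auto
        with Vb[OF x, of "k n"] show ?thesis by (simp add: divide_inverse)
      qed
      then show "\<forall>\<^sub>F n in sequentially. norm (V (u (k n)) x - of_real x * V (u (k n)) 1) \<le> (2 + 2 * K) * inverse (real (Suc n))"
        by (intro always_eventually) blast
      show "(\<lambda>n. (2 + 2 * K) * inverse (real (Suc n))) \<longlonglongrightarrow> 0"
        using tendsto_mult_right_zero[OF LIMSEQ_inverse_real_of_nat] by simp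
    qed
    ultimately have "V g x - of_real x * V g 1 = 0" by (rule LIMSEQ_unique)
    then show ?thesis by simp
  qed
  have Wg: "W g x = V g 1" if x: "x \<in> ?I" for x
  proof -
    have "(V g has_vector_derivative W g x) (at x within ?I)"
      unfolding V_def by (rule integral_has_vector_derivative[OF Wc[OF gc] x])
    moreover have "((\<lambda>x. of_real x * V g 1) has_vector_derivative V g 1) (at x within ?I)"
      by (auto intro!: derivative_eq_intros simp: scaleR_conv_of_real[symmetric])
    ultimately have "((\<lambda>x. V g x - of_real x * V g 1) has_vector_derivative W g x - V g 1) (at x within ?I)"
      by (rule has_vector_derivative_diff)
    then have "W g x - V g 1 = 0"
    proof (rule has_vector_derivative_zero_on[OF _ _ x])
      show "V g t - of_real t * V g 1 = 0" if "t \<in> ?I" for t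
        unfolding right_minus_eq by (rule Vg[OF that])
    qed simp
    then show ?thesis by simp
  qed
  then have W0: "W g x = 0" if "x \<in> ?I" for x
    using Wg[OF that] Wg[of 0] by (simp add: W_def)
  have "AE x in lborel. x \<in> ?I \<longrightarrow> (W g has_vector_derivative of_real (w x) * g x) (at x within ?I)"
    unfolding W_def by (rule lebesgue_differentiation) (use whi(1)[OF gc, of 1] in auto)
  then have "AE x in lborel. x \<in> ?I \<longrightarrow> g x = 0"
    using w
  proof eventually_elim
    case (elim x)
    show ?case
    proof
      assume x: "x \<in> ?I"
      have "of_real (w x) * g x = 0"
        by (rule has_vector_derivative_zero_on[OF _ W0 x]) (use elim x in auto)
      then show "g x = 0" using elim x by simp
    qed
  qed
  then have g0: "g x = 0" if "x \<in> ?I" for x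
    using continuous_on_AE_zero[OF gc _ _ that] by simp
  \<comment> \<open>The uniform limit is zero, yet every \<open>u n\<close> attains modulus
    1.\<close>
  obtain N where N: "\<And>n x. n \<ge> N \<Longrightarrow> x \<in> ?I \<Longrightarrow> norm (u (k n) x - g x) < 1"
    using lim[of 1] by auto
  obtain x where "x \<in> ?I" "norm (u (k N) x) = 1" using u_eq by blast
  then show False using N[of N x] g0 by simp
qed

text \<open>A zero of \<open>F\<close> makes the boundary values \<open>p\<close> of
  \<open>\<phi>\<close> and \<open>\<i> s\<close>, with \<open>s\<close> that of
  \<open>\<psi>\<close>, linearly dependent over the reals. Real coefficients are what continuation
  by conjugation demands, since then \<open>y 0\<close> is real and \<open>y1 0\<close>
  imaginary.\<close>

lemma imaginary_eigenvalue_exists: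
  assumes w: "AE x in lborel. x \<in> {0..1} \<longrightarrow> w x \<noteq> 0"
    and sym: "AE x in lborel. x \<in> {0..1} \<longrightarrow> q (- x) = q x \<and> w (- x) = - w x"
    and neg: "\<phi> 0 1 \<bullet> \<psi> 0 1 < 0"
  shows "\<exists>a>0. is_eigenvalue q w (\<i> * of_real a)"
proof -
  define F where "F a = \<phi> (\<i> * of_real a) 1 \<bullet> \<psi> (\<i> * of_real a) 1" for a
  obtain b where b: "b > 0" "F b \<ge> 0" using exists_nonneg_inner[OF w] by (auto simp: F_def)
  have "continuous_on {0..b} F"
    unfolding F_def by (intro continuous_intros continuous_on_fund) auto
  then have "\<exists>a. 0 \<le> a \<and> a \<le> b \<and> F a = 0"
    using b neg by (intro IVT') (auto simp: F_def)
  then obtain a where a: "0 \<le> a" "F a = 0" by blast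
  have "a \<noteq> 0" using a neg by (auto simp: F_def)
  then have a0: "a > 0" using a by simp
  let ?l = "\<i> * complex_of_real a"
  define p where "p = \<phi> ?l 1"
  define s where "s = \<psi> ?l 1"
  have ps: "Re (p * cnj s) = 0" using a(2) by (simp add: F_def p_def s_def inner_complex_def)
  \<comment> \<open>Multiplying \<open>p * cnj s = \<i> * Im (p * cnj s)\<close> by \<open>s\<close>
    gives a relation with these real coefficients; if \<open>s = 0\<close>, then
    \<open>\<psi>\<close> alone already vanishes at 1.\<close>
  define A where "A = (if s = 0 then 0 else (norm s)\<^sup>2)"
  define B where "B = (if s = 0 then 1 else - Im (p * cnj s))"
  have comb: "of_real A * p + \<i> * of_real B * s = 0"
  proof (cases "s = 0")
    case False
    have "p * cnj s = \<i> * of_real (Im (p * cnj s))" using ps by (simp add: complex_eq_iff)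
    moreover have "\<i> * of_real B = - (\<i> * of_real (Im (p * cnj s)))"
      using False by (simp only: B_def if_False of_real_minus mult_minus_right)
    ultimately have e: "\<i> * of_real B = - (p * cnj s)" by (metis (no_types))
    have "of_real A = s * cnj s" using False by (simp only: A_def if_False complex_norm_square)
    then show ?thesis unfolding e by (simp add: algebra_simps)
  qed (simp add: A_def)
  define y where "y x = of_real A * \<phi> ?l x + \<i> * of_real B * \<psi> ?l x" for x
  define y1 where "y1 x = of_real A * \<phi>1 ?l x + \<i> * of_real B * \<psi>1 ?l x" for x
  have y: "sol 0 1 (pot q w ?l) y y1" unfolding y_def y1_def by (rule sol_comb)
  have y0: "y 0 = of_real A" "y1 0 = \<i> * of_real B" "y 1 = 0"
    using comb by (simp_all add: y_def y1_def phi psi p_def s_def)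
  have "is_eigenvalue q w ?l"
  proof (rule eigenvalue_from_half[OF y y0(3) _ bounded_linear_cnj])
    show "\<exists>x\<in>{0..1}. y x \<noteq> 0"
    proof (rule ccontr)
      assume "\<not> ?thesis"
      then have z: "\<And>x. x \<in> {0..1} \<Longrightarrow> y x = 0" by blast
      then have "y1 0 = 0"
        using has_vector_derivative_zero_on[OF solD(5)[OF y], of 0] by auto
      then have "A = 0" "B = 0" using y0 z[of 0] by auto
      then show False by (auto simp: A_def B_def split: if_splits)
    qed
    \<comment> \<open>Conjugation changes the sign of \<open>\<i> a w\<close>, and so does
      reflection, because \<open>w\<close> is odd.\<close>
    show "AE x in lborel. x \<in> {0..1} \<longrightarrow> (\<forall>z. cnj (pot q w ?l x * z) = pot q w ?l (- x) * cnj z)"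
      using sym by eventually_elim (auto simp: pot_def)
  qed (simp_all add: y0)
  then show ?thesis using a0 by blast
qed

end

lemma set_integrable_imp_absolutely_integrable:
  fixes f :: "real \<Rightarrow> real"
  assumes "set_integrable lborel {-1..1} f" shows "f absolutely_integrable_on {0..1}"
proof -
  have "f absolutely_integrable_on {-1..1}"
    using assms unfolding set_integrable_def
    by (subst integrable_completion) (auto dest: borel_measurable_integrable)
  then show ?thesis by (rule absolutely_integrable_on_subinterval) auto
qed

theorem theorem1p5:
  fixes q w :: "real \<Rightarrow> real"
  assumes q_L1: "set_integrable lborel {-1..1} q"
    and w_L1: "set_integrable lborel {-1..1} w"
    and w_nz: "AE x in lborel. x \<in> {-1..1} \<longrightarrow> w x \<noteq> 0"
    and q_even: "AE x in lborel. x \<in> {-1..1} \<longrightarrow> q (-x) = q x"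
    and w_odd: "AE x in lborel. x \<in> {-1..1} \<longrightarrow> w (-x) = - w x"
    and one_neg: "\<exists>\<mu>. is_eigenvalue q (\<lambda>t. 1) \<mu> \<and> \<mu> \<in> \<real> \<and> Re \<mu> < 0 \<and>
                    (\<forall>l. is_eigenvalue q (\<lambda>t. 1) l \<and> l \<noteq> \<mu> \<longrightarrow> l \<in> \<real> \<and> Re l > 0)"
  shows "\<exists>\<alpha>::real. \<alpha> > 0 \<and>
           {l. is_eigenvalue q w l \<and> l \<notin> \<real>} = {\<i> * complex_of_real \<alpha>, - \<i> * complex_of_real \<alpha>}"
proof -
  note q = set_integrable_imp_absolutely_integrable[OF q_L1]
    and w = set_integrable_imp_absolutely_integrable[OF w_L1]
  interpret H: half_problem q w by unfold_locales (rule q w)+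
  interpret E: even_problem q
  proof unfold_locales
    show "q absolutely_integrable_on {0..1}" by (rule q)
    show "(\<lambda>_. 1::real) absolutely_integrable_on {0..1::real}" by (rule absolutely_integrable_on_const) auto
  qed (rule q_even one_neg)+
  \<comment> \<open>At the parameter 0 both weights give the potential \<open>q\<close>, so the
    signs found for unit weight carry over to \<open>w\<close>.\<close>
  have pot0: "pot q (\<lambda>_. 1) 0 = pot q w 0" by (simp add: pot_def fun_eq_iff)
  have "E.\<phi> 0 1 = H.\<phi> 0 1" "E.\<psi> 0 1 = H.\<psi> 0 1"
    using H.sol_repr(1)[of 0 "E.\<phi> 0" "E.\<phi>1 0" 1] H.sol_repr(1)[of 0 "E.\<psi> 0" "E.\<psi>1 0" 1]
      E.phi[of 0] E.psi[of 0] by (simp_all add: pot0)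
  moreover have "E.\<phi> 0 1 \<bullet> E.\<psi> 0 1 = E.Ph 0 1 * E.Ps 0 1"
    using E.fund_of_real(1,3)[of 1 0] by (simp add: inner_complex_def)
  ultimately have "H.\<phi> 0 1 \<bullet> H.\<psi> 0 1 < 0"
    using E.Ph_0_neg E.Ps_pos[of 0 1] by (simp add: mult_neg_pos)
  moreover have "AE x in lborel. x \<in> {0..1} \<longrightarrow> w x \<noteq> 0"
    using w_nz by eventually_elim auto
  moreover have "AE x in lborel. x \<in> {0..1} \<longrightarrow> q (- x) = q x \<and> w (- x) = - w x"
    using q_even w_odd by eventually_elim auto
  ultimately obtain \<alpha> where \<alpha>: "\<alpha> > 0" "is_eigenvalue q w (\<i> * of_real \<alpha>)"
    using H.imaginary_eigenvalue_exists by blast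
  have nr: "\<i> * complex_of_real \<alpha> \<notin> \<real>" "- \<i> * complex_of_real \<alpha> \<notin> \<real>"
    using \<alpha>(1) by (auto simp: complex_is_Real_iff)
  have "is_eigenvalue q w (- \<i> * of_real \<alpha>)"
    using is_eigenvalue_cnj[OF \<alpha>(2)] by simp
  moreover have "l = - \<i> * of_real \<alpha>" if "is_eigenvalue q w l" "l \<notin> \<real>" "l \<noteq> \<i> * of_real \<alpha>" for l
    using E.nonreal_eigenvalues_conjugate[OF w_nz that(1,2) \<alpha>(2) nr(1) that(3)] by simp
  ultimately show ?thesis
    using \<alpha> nr by (intro exI[of _ \<alpha>]) blast
qed

end
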